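(* Let $k,b$ be positive integers such that either $k\ge 4$, or $k=3$ and $b\ge 2$. Let $H$ be a graph for which there exists $H'\subseteq H$ with $d_1(H')=m_1(H)$ and either $H'=K_k$ or $H'=C_k$. Then there exist constants $c,C>0$ such that for the $(1:b)$ Client-Waiter vertex $H$-game played on $G\sim G(n,p)$, $$\lim_{n\to\infty}\Pr[G\text{ is Client's win}]=\begin{cases}1 & p\ge Cn^{-1/m_1(H)},\\ 0& p\le cn^{-1/m_1(H)}.\end{cases}$$
   Context: For a graph $F$ with $v(F)\ge 2$, $d_1(F)=\frac{e(F)}{v(F)-1}$ and $m_1(F)=\max\{d_1(F'):F'\subseteq F,\ v(F')\ge 2\}$. $G(n,p)$ is the binomial random graph. The $(1:b)$ Client-Waiter vertex $H$-game on a graph $G$: in each round Waiter offers a set of $t$ previously unclaimed vertices with $1\le t\le b+1$; Client claims one of them and Waiter claims the rest; in the last round, Client claims one of the remaining vertices and Waiter the rest. Client wins if the subgraph of $G$ induced by his vertices contains a (not necessarily induced) copy of $H$; otherwise Waiter wins. "Client's win" means Client has a winning strategy. *)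

theory Defs
  imports Complex_Main
begin

definition is_graph :: "'a set \<Rightarrow> 'a set set \<Rightarrow> bool" where
  "is_graph V E \<longleftrightarrow> finite V \<and> (\<forall>e\<in>E. e \<subseteq> V \<and> card e = 2)"

definition d1 :: "'a set \<Rightarrow> 'a set set \<Rightarrow> real" where
  "d1 V E = real (card E) / (real (card V) - 1)"

definition subgraphs2 :: "'a set \<Rightarrow> 'a set set \<Rightarrow> ('a set \<times> 'a set set) set" where
  "subgraphs2 V E = {(V', E'). V' \<subseteq> V \<and> E' \<subseteq> E \<and> (\<forall>e\<in>E'. e \<subseteq> V') \<and> card V' \<ge> 2}"

definition m1 :: "'a set \<Rightarrow> 'a set set \<Rightarrow> real" where
  "m1 V E = Max ((\<lambda>(V', E'). d1 V' E') ` subgraphs2 V E)"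

definition is_clique_graph :: "nat \<Rightarrow> 'a set \<Rightarrow> 'a set set \<Rightarrow> bool" where
  "is_clique_graph k V E \<longleftrightarrow> finite V \<and> card V = k \<and> E = {e. e \<subseteq> V \<and> card e = 2}"

definition is_cycle_graph :: "nat \<Rightarrow> 'a set \<Rightarrow> 'a set set \<Rightarrow> bool" where
  "is_cycle_graph k V E \<longleftrightarrow> k \<ge> 3 \<and>
     (\<exists>g. bij_betw g {0..<k} V \<and> E = {{g i, g ((i + 1) mod k)} | i. i < k})"

definition has_copy_in :: "'h set \<Rightarrow> 'h set set \<Rightarrow> nat set set \<Rightarrow> nat set \<Rightarrow> bool" where
  "has_copy_in VH EH E S \<longleftrightarrow>
     (\<exists>f. inj_on f VH \<and> f ` VH \<subseteq> S \<and> (\<forall>e\<in>EH. f ` e \<in> E))"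

(* Client wins the (1:b) Client-Waiter vertex H-game on the graph with edge set E, from
   the position where U is the set of unclaimed vertices and C is Client's set.
   In each round Waiter offers T \<subseteq> U with 1 \<le> |T| \<le> b+1, Client claims one vertex of T,
   Waiter claims the rest; the game ends when all vertices are claimed. *)
inductive client_wins_from ::
  "'h set \<Rightarrow> 'h set set \<Rightarrow> nat \<Rightarrow> nat set set \<Rightarrow> nat set \<Rightarrow> nat set \<Rightarrow> bool"
  for VH EH b E where
  finish: "U = {} \<Longrightarrow> has_copy_in VH EH E C \<Longrightarrow> client_wins_from VH EH b E U C"
| round: "U \<noteq> {} \<Longrightarrow>
    (\<forall>T. T \<subseteq> U \<and> T \<noteq> {} \<and> card T \<le> b + 1 \<longrightarrow>
        (\<exists>v\<in>T. client_wins_from VH EH b E (U - T) (insert v C))) \<Longrightarrow>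
    client_wins_from VH EH b E U C"

definition client_win :: "'h set \<Rightarrow> 'h set set \<Rightarrow> nat \<Rightarrow> nat \<Rightarrow> nat set set \<Rightarrow> bool" where
  "client_win VH EH b n E \<longleftrightarrow> client_wins_from VH EH b E {0..<n} {}"

definition all_edges :: "nat \<Rightarrow> nat set set" where
  "all_edges n = {e. e \<subseteq> {0..<n} \<and> card e = 2}"

definition gnp_prob :: "nat \<Rightarrow> real \<Rightarrow> (nat set set \<Rightarrow> bool) \<Rightarrow> real" where
  "gnp_prob n p P = (\<Sum>E\<in>{E. E \<subseteq> all_edges n \<and> P E}.
      p ^ card E * (1 - p) ^ (card (all_edges n) - card E))"

end

theory Submission
  imports Defs "HOL-Library.FuncSet" "HOL-Library.Disjoint_Sets" "HOL-Real_Asymp.Real_Asymp"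
begin

text \<open>
  Above the threshold, Client ends with at least \<open>n / (b + 1)\<close> vertices whatever happens.  Every
  subgraph \<open>F\<close> of \<open>H\<close> with an edge satisfies \<open>n\<^sup>v p\<^sup>e \<ge> C n\<close>, so by Janson's inequality a
  fixed linear-sized vertex set contains no copy of \<open>H\<close> with probability at most
  \<open>exp (- 2 n)\<close>, and a union bound over all vertex sets finishes.

  Below the threshold, write \<open>m1 = k / q\<close>, so \<open>q = 2\<close> for \<open>K_k\<close> and \<open>q = k - 1\<close> for \<open>C_k\<close>, and let
  \<open>phi F = k v(F) - q e(F)\<close>.  A single copy has \<open>phi = k\<close>; attaching a copy along one vertex leaves
  \<open>phi\<close> unchanged and any other way of attaching it strictly decreases \<open>phi\<close>.  The expected number of
  embeddings of \<open>F\<close> is at most \<open>c\<^sup>e n powr (phi F / k)\<close>.  Exploring a connected union of copies in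
  breadth-first order for logarithmically many steps therefore shows that with high probability no
  connected union of copies has \<open>phi < 0\<close>.

  If all connected unions have \<open>phi \<ge> 0\<close>, Waiter wins with a fixed family of disjoint blocks of size
  at most \<open>b + 1\<close>, offered one by one, such that every copy has two vertices in some block: Client gets
  at most one vertex of each block.  For cliques, the part that is not tree-like is so
  small that splitting its vertices into few blocks works by the pigeonhole principle.  For cycles,
  each step of the exploration creates only cycles through a common vertex set, and \<open>phi \<ge> 0\<close> gives
  Hall's condition for choosing disjoint pairs from these sets.
\<close>

section \<open>The game and block coverings\<close>

text \<open>On both sides the adaptive game is replaced by a static statement, which makes first
  moments and union bounds usable. Above the threshold this demands a failure probability below
  \<open>2 ^ (- n)\<close>, hence a Janson bound with exponent linear in \<open>n\<close>; the raw
  exponent can have the wrong sign when copies overlap a lot, so the events are sampled at an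
  optimised rate. Below the threshold, subgraphs of bounded size do not suffice: tree-like unions
  keep \<open>phi = k\<close>, and of each fixed size up to order \<open>n\<close> of them are
  expected. A small \<open>c\<close> makes their number decay geometrically in the number of
  attached copies, so about \<open>log n\<close> steps exhaust it, while a negative
  \<open>phi\<close> gains \<open>n powr (- 1 / k)\<close>, which beats every power of
  \<open>log n\<close>. The deterministic part then lives on a budget: \<open>phi\<close> starts at
  \<open>k\<close> and may not become negative. The count \<open>k \<le> \<beta> * (k - 2)\<close>
  used for cliques fails, among \<open>k \<ge> 3\<close> and \<open>\<beta> \<ge> 2\<close>, exactly
  for triangles against blocks of size 2.\<close>

lemma client_wins_from_transversal:
  assumes "client_wins_from VH EH b E U C"
    and "\<Union>P = U" "disjoint P" "\<forall>B\<in>P. finite B \<and> card B \<le> b + 1" "{} \<notin> P"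
  shows "\<exists>C'. C \<subseteq> C' \<and> C' \<subseteq> C \<union> U \<and> (\<forall>B\<in>P. \<exists>v. (C' - C) \<inter> B \<subseteq> {v}) \<and> has_copy_in VH EH E C'"
  using assms
proof (induction arbitrary: P)
  case (finish U C)
  then show ?case by auto
next
  case (round U C)
  then obtain B where B: "B \<in> P" by auto
  with round have "B \<subseteq> U" "B \<noteq> {}" "card B \<le> b + 1" by auto
  \<comment> \<open>Waiter offers the whole block \<open>B\<close>; the other blocks stay untouched
    and partition \<open>U - B\<close>, which keeps the induction going.\<close>
  then obtain v where v: "v \<in> B" and
    IH: "\<And>P. \<Union>P = U - B \<Longrightarrow> disjoint P \<Longrightarrow> \<forall>B\<in>P. finite B \<and> card B \<le> b + 1 \<Longrightarrow> {} \<notin> P \<Longrightarrow>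
      \<exists>C'. insert v C \<subseteq> C' \<and> C' \<subseteq> insert v C \<union> (U - B) \<and>
        (\<forall>B\<in>P. \<exists>w. (C' - insert v C) \<inter> B \<subseteq> {w}) \<and> has_copy_in VH EH E C'"
    using round(2) by metis
  have dB: "B' \<inter> B = {}" if "B' \<in> P - {B}" for B'
    using that round.prems(2) B by (auto simp: disjoint_def)
  have "\<Union>(P - {B}) = U - B"
    using dB round.prems(1) B by blast
  moreover have "disjoint (P - {B})" using round.prems(2) by (auto simp: disjoint_def)
  ultimately obtain C' where C': "insert v C \<subseteq> C'" "C' \<subseteq> insert v C \<union> (U - B)"
      "\<forall>B\<in>P - {B}. \<exists>w. (C' - insert v C) \<inter> B \<subseteq> {w}" "has_copy_in VH EH E C'"
    using IH[of "P - {B}"] round.prems by auto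
  have "\<exists>w. (C' - C) \<inter> B' \<subseteq> {w}" if "B' \<in> P" for B'
  proof (cases "B' = B")
    case True
    have "(C' - C) \<inter> B \<subseteq> {v}" using C'(2) by auto
    then show ?thesis using True by blast
  next
    case False
    then obtain w where "(C' - insert v C) \<inter> B' \<subseteq> {w}" using C'(3) \<open>B' \<in> P\<close> by blast
    moreover have "v \<notin> B'" using dB[of B'] False \<open>B' \<in> P\<close> v by blast
    ultimately show ?thesis by blast
  qed
  moreover have "C \<subseteq> C'" using C'(1) by simp
  moreover have "C' \<subseteq> C \<union> U" using C'(2) v \<open>B \<subseteq> U\<close> by auto
  ultimately show ?case using C'(4) by (intro exI[of _ C'] conjI ballI) simp_all
qed

text \<open>Each round moves at most \<open>b + 1\<close> vertices out of \<open>U\<close> and one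
  of them into \<open>C\<close>, so \<open>(b + 1) * card C + card U\<close> never drops. Client may
  therefore pick arbitrarily.\<close>

lemma client_wins_from_large_sets:
  assumes "finite U" "finite C" "C \<inter> U = {}" "C \<union> U \<subseteq> {0..<n}" "n \<le> (b + 1) * card C + card U"
    and copy: "\<And>S. S \<subseteq> {0..<n} \<Longrightarrow> n \<le> (b + 1) * card S \<Longrightarrow> has_copy_in VH EH E S"
  shows "client_wins_from VH EH b E U C"
  using assms(1-5)
proof (induction "card U" arbitrary: U C rule: less_induct)
  case less
  show ?case
  proof (cases "U = {}")
    case True
    then show ?thesis using less.prems copy by (intro finish) auto
  next
    case False
    show ?thesis
    proof (rule round[OF False], intro allI impI)
      fix T assume T: "T \<subseteq> U \<and> T \<noteq> {} \<and> card T \<le> b + 1"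
      then obtain v where v: "v \<in> T" by auto
      have fT: "finite T" using T less.prems(1) finite_subset by blast
      have cT: "0 < card T" using T fT by auto
      have cU: "card (U - T) = card U - card T" "card T \<le> card U"
        using T fT less.prems(1) by (auto simp: card_Diff_subset card_mono)
      have "v \<notin> C" using v T less.prems(3) by auto
      then have cC: "card (insert v C) = card C + 1" using less.prems by simp
      have "client_wins_from VH EH b E (U - T) (insert v C)"
      proof (rule less.hyps)
        show "card (U - T) < card U" using cU cT by linarith
        show "n \<le> (b + 1) * card (insert v C) + card (U - T)"
        proof -
          have "(b + 1) * card (insert v C) = (b + 1) * card C + (b + 1)" using cC by simp
          then show ?thesis using less.prems(5) cU T by linarith
        qed
      qed (use less.prems T v in auto)
      then show "\<exists>v\<in>T. client_wins_from VH EH b E (U - T) (insert v C)" using v by blast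
    qed
  qed
qed

section \<open>Block coverings as strategies for Waiter\<close>

text \<open>A strategy for Waiter with \<beta> = b + 1: a set with at most one vertex in each block
  cannot contain a member of \<open>\<K>\<close>.\<close>

definition coverable :: "nat \<Rightarrow> 'a set set \<Rightarrow> bool" where
  "coverable \<beta> \<K> \<longleftrightarrow> (\<exists>\<B>. disjoint \<B> \<and> (\<forall>B\<in>\<B>. finite B \<and> card B \<le> \<beta>) \<and>
     (\<forall>K\<in>\<K>. \<exists>B\<in>\<B>. 2 \<le> card (B \<inter> K)))"

lemma coverable_imp_not_client_win:
  assumes cov: "coverable (b + 1) \<K>"
    and copies: "\<And>S. S \<subseteq> {0..<n} \<Longrightarrow> has_copy_in VH EH E S \<Longrightarrow> \<exists>K\<in>\<K>. K \<subseteq> S"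
  shows "\<not> client_win VH EH b n E"
proof
  assume "client_win VH EH b n E"
  then have cw: "client_wins_from VH EH b E {0..<n} {}" by (simp add: client_win_def)
  from cov obtain \<B> where B: "disjoint \<B>" "\<forall>B\<in>\<B>. finite B \<and> card B \<le> b + 1"
    "\<forall>K\<in>\<K>. \<exists>B\<in>\<B>. 2 \<le> card (B \<inter> K)" by (auto simp: coverable_def)
  \<comment> \<open>The transversal argument needs a partition of the whole board: blocks are cut
    down to the board, empty traces dropped, and leftover vertices offered as singletons.\<close>
  define P1 where "P1 = (\<lambda>B. B \<inter> {0..<n}) ` \<B> - {{}}"
  define P where "P = P1 \<union> (\<lambda>x. {x}) ` ({0..<n} - \<Union>\<B>)"
  have "\<Union>P = {0..<n}" by (auto simp: P_def P1_def)
  moreover have "disjoint P"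
  proof (rule disjointI)
    fix a b assume ab: "a \<in> P" "b \<in> P" "a \<noteq> b"
    have "a' \<inter> b' = {}" if "a' \<in> \<B>" "b' \<in> \<B>" "a' \<noteq> b'" for a' b'
      using that disjointD[OF B(1)] by blast
    then show "a \<inter> b = {}" using ab unfolding P_def P1_def by auto
  qed
  moreover have "\<forall>B\<in>P. finite B \<and> card B \<le> b + 1"
  proof
    fix A assume "A \<in> P"
    then consider B where "B \<in> \<B>" "A = B \<inter> {0..<n}" | x where "A = {x}"
      by (auto simp: P_def P1_def)
    then show "finite A \<and> card A \<le> b + 1"
    proof cases
      case 1
      then have "card A \<le> card B" using B(2) by (auto intro!: card_mono)
      then show ?thesis using 1 B(2) by auto
    qed auto
  qed
  moreover have "{} \<notin> P" by (auto simp: P_def P1_def)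
  ultimately have "\<exists>C'. {} \<subseteq> C' \<and> C' \<subseteq> {} \<union> {0..<n} \<and> (\<forall>B\<in>P. \<exists>v. (C' - {}) \<inter> B \<subseteq> {v}) \<and>
      has_copy_in VH EH E C'"
    by (rule client_wins_from_transversal[OF cw])
  then obtain C where C: "C \<subseteq> {0..<n}" "\<forall>B\<in>P. \<exists>v. C \<inter> B \<subseteq> {v}" "has_copy_in VH EH E C"
    unfolding Un_empty_left Diff_empty by (elim exE conjE)
  from copies[OF C(1) C(3)] obtain K where K: "K \<in> \<K>" "K \<subseteq> C" by auto
  then obtain A where A: "A \<in> \<B>" "2 \<le> card (A \<inter> K)" using B(3) by blast
  then have ne: "A \<inter> K \<noteq> {}" by auto
  then have "A \<inter> {0..<n} \<in> P" using A K C(1) by (auto simp: P_def P1_def)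
  then obtain v where "C \<inter> (A \<inter> {0..<n}) \<subseteq> {v}" using bspec[OF C(2)] by metis
  then have "A \<inter> K \<subseteq> {v}" using K C(1) by blast
  then have "card (A \<inter> K) \<le> 1" using card_mono[of "{v}"] by fastforce
  then show False using A(2) by simp
qed

text \<open>Trimming the blocks to the vertices of \<open>\<K>\<close> loses no intersection with a
  member, and makes coverings of vertex-disjoint families compatible.\<close>

lemma coverable_inside:
  assumes "coverable \<beta> \<K>"
  shows "\<exists>\<B>. disjoint \<B> \<and> (\<forall>B\<in>\<B>. finite B \<and> card B \<le> \<beta> \<and> B \<subseteq> \<Union>\<K>) \<and>
     (\<forall>K\<in>\<K>. \<exists>B\<in>\<B>. 2 \<le> card (B \<inter> K))"
proof -
  from assms obtain \<B> where B: "disjoint \<B>" "\<forall>B\<in>\<B>. finite B \<and> card B \<le> \<beta>"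
    "\<forall>K\<in>\<K>. \<exists>B\<in>\<B>. 2 \<le> card (B \<inter> K)" by (auto simp: coverable_def)
  let ?B = "(\<lambda>B. B \<inter> \<Union>\<K>) ` \<B>"
  have "disjoint ?B"
  proof (rule disjointI)
    fix a b assume "a \<in> ?B" "b \<in> ?B" "a \<noteq> b"
    then obtain a' b' where "a' \<in> \<B>" "b' \<in> \<B>" "a = a' \<inter> \<Union>\<K>" "b = b' \<inter> \<Union>\<K>" by auto
    then show "a \<inter> b = {}" using disjointD[OF B(1), of a' b'] \<open>a \<noteq> b\<close> by auto
  qed
  moreover have "\<forall>B\<in>?B. finite B \<and> card B \<le> \<beta> \<and> B \<subseteq> \<Union>\<K>"
  proof
    fix A assume "A \<in> ?B"
    then obtain B' where B': "B' \<in> \<B>" "A = B' \<inter> \<Union>\<K>" by auto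
    then have "card A \<le> card B'" using B(2) by (auto intro!: card_mono)
    then show "finite A \<and> card A \<le> \<beta> \<and> A \<subseteq> \<Union>\<K>" using B' B(2) by auto
  qed
  moreover have "\<forall>K\<in>\<K>. \<exists>B\<in>?B. 2 \<le> card (B \<inter> K)"
  proof
    fix K assume K: "K \<in> \<K>"
    then obtain A where A: "A \<in> \<B>" "2 \<le> card (A \<inter> K)" using B(3) by blast
    have "A \<inter> \<Union>\<K> \<inter> K = A \<inter> K" using K by auto
    then show "\<exists>B\<in>?B. 2 \<le> card (B \<inter> K)" using A by (intro bexI[of _ "A \<inter> \<Union>\<K>"]) auto
  qed
  ultimately show ?thesis by blast
qed

lemma coverable_Un:
  assumes "coverable \<beta> \<K>" "coverable \<beta> \<L>" "\<Union>\<K> \<inter> \<Union>\<L> = {}"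
  shows "coverable \<beta> (\<K> \<union> \<L>)"
proof -
  from coverable_inside[OF assms(1)] obtain \<B> where B: "disjoint \<B>"
    "\<forall>B\<in>\<B>. finite B \<and> card B \<le> \<beta> \<and> B \<subseteq> \<Union>\<K>"
    "\<forall>K\<in>\<K>. \<exists>B\<in>\<B>. 2 \<le> card (B \<inter> K)" by blast
  from coverable_inside[OF assms(2)] obtain \<C> where C: "disjoint \<C>"
    "\<forall>B\<in>\<C>. finite B \<and> card B \<le> \<beta> \<and> B \<subseteq> \<Union>\<L>"
    "\<forall>K\<in>\<L>. \<exists>B\<in>\<C>. 2 \<le> card (B \<inter> K)" by blast
  have "B' \<inter> C' = {}" if "B' \<in> \<B>" "C' \<in> \<C>" for B' C' using that B(2) C(2) assms(3) by blast
  then have "disjoint (\<B> \<union> \<C>)"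
    using disjointD[OF B(1)] disjointD[OF C(1)] by (intro disjointI) (metis Int_commute Un_iff)
  moreover have "\<forall>B\<in>\<B> \<union> \<C>. finite B \<and> card B \<le> \<beta>" using B(2) C(2) by auto
  moreover have "\<forall>K\<in>\<K> \<union> \<L>. \<exists>B\<in>\<B> \<union> \<C>. 2 \<le> card (B \<inter> K)" using B(3) C(3) by blast
  ultimately show ?thesis unfolding coverable_def by blast
qed

text \<open>Connectedness of a family whose member \<open>A\<close> has vertex set \<open>v A\<close>.\<close>

definition linked :: "('b \<Rightarrow> 'a set) \<Rightarrow> 'b set \<Rightarrow> bool" where
  "linked v \<K> \<longleftrightarrow>
     (\<forall>\<G>. \<G> \<subset> \<K> \<and> \<G> \<noteq> {} \<longrightarrow> (\<exists>A\<in>\<K> - \<G>. v A \<inter> \<Union>(v ` \<G>) \<noteq> {}))"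

abbreviation connected_family :: "'a set set \<Rightarrow> bool" where
  "connected_family \<equiv> linked (\<lambda>K. K)"

lemma linked_singleton: "linked v {A}"
  by (auto simp: linked_def)

lemma linked_insert:
  assumes "linked v \<K>" "v A \<inter> \<Union>(v ` \<K>) \<noteq> {}"
  shows "linked v (insert A \<K>)"
  unfolding linked_def
proof (intro allI impI)
  fix \<G> assume G: "\<G> \<subset> insert A \<K> \<and> \<G> \<noteq> {}"
  show "\<exists>B\<in>insert A \<K> - \<G>. v B \<inter> \<Union>(v ` \<G>) \<noteq> {}"
  proof (cases "\<K> \<subseteq> \<G>")
    case True
    then have "A \<notin> \<G>" using G by auto
    then show ?thesis using assms(2) True by blast
  next
    case nK: False
    show ?thesis
    proof (cases "\<G> \<inter> \<K> = {}")
      case True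
      then have "\<G> = {A}" using G by auto
      then obtain B where "B \<in> \<K>" "v A \<inter> v B \<noteq> {}" using assms(2) by blast
      then show ?thesis using \<open>\<G> = {A}\<close> True by blast
    next
      case False
      have "\<G> \<inter> \<K> \<subset> \<K>" using nK by blast
      then obtain B where "B \<in> \<K> - (\<G> \<inter> \<K>)" "v B \<inter> \<Union>(v ` (\<G> \<inter> \<K>)) \<noteq> {}"
        using assms(1) False unfolding linked_def by meson
      then show ?thesis by blast
    qed
  qed
qed

lemma linked_Un_meeting:
  assumes "linked v \<K>" "finite \<L>" "\<And>A. A \<in> \<L> \<Longrightarrow> v A \<inter> \<Union>(v ` \<K>) \<noteq> {}"
  shows "linked v (\<K> \<union> \<L>)"
  using assms(2,3)
proof (induction \<L> rule: finite_induct)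
  case (insert A \<L>)
  then have "v A \<inter> \<Union>(v ` (\<K> \<union> \<L>)) \<noteq> {}" by blast
  then show ?case using linked_insert[of v "\<K> \<union> \<L>" A] insert by auto
qed (use assms(1) in auto)

text \<open>A minimal uncoverable subfamily is connected: a split into two vertex-disjoint proper
  parts would give two coverable families, whose coverings could be united.\<close>

lemma not_coverable_connected:
  assumes "finite \<K>" "\<not> coverable \<beta> \<K>"
  shows "\<exists>\<G>\<subseteq>\<K>. \<G> \<noteq> {} \<and> connected_family \<G> \<and> \<not> coverable \<beta> \<G>"
proof -
  define Q where "Q = {\<G>. \<G> \<subseteq> \<K> \<and> \<not> coverable \<beta> \<G>}"
  have "finite Q" "Q \<noteq> {}" using assms by (auto simp: Q_def)
  then obtain \<G> where G: "\<G> \<in> Q" and min: "\<And>\<H>. \<H> \<in> Q \<Longrightarrow> \<H> \<subseteq> \<G> \<Longrightarrow> \<G> = \<H>"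
    by (meson finite_has_minimal)
  have "\<G> \<noteq> {}" using G by (auto simp: Q_def coverable_def dest!: spec[of _ "{}"])
  moreover have "connected_family \<G>"
    unfolding linked_def image_ident
  proof (intro allI impI, rule ccontr)
    fix \<H> assume H: "\<H> \<subset> \<G> \<and> \<H> \<noteq> {}" and "\<not> (\<exists>A\<in>\<G> - \<H>. A \<inter> \<Union>\<H> \<noteq> {})"
    then have dis: "\<Union>\<H> \<inter> \<Union>(\<G> - \<H>) = {}" by blast
    have "coverable \<beta> \<H>" "coverable \<beta> (\<G> - \<H>)"
      using min[of \<H>] min[of "\<G> - \<H>"] H G by (auto simp: Q_def)
    from coverable_Un[OF this dis] have "coverable \<beta> \<G>" using H by (simp add: Un_absorb1 psubset_imp_subset)
    then show False using G by (simp add: Q_def)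
  qed
  ultimately show ?thesis using G by (auto simp: Q_def)
qed

section \<open>Families of cliques\<close>

lemma blocks_exist:
  assumes "finite N" "card N \<le> \<beta> * m"
  shows "\<exists>\<B>. finite \<B> \<and> card \<B> \<le> m \<and> disjoint \<B> \<and> (\<forall>B\<in>\<B>. card B \<le> \<beta>) \<and> \<Union>\<B> = N"
  using assms
proof (induction m arbitrary: N)
  case 0
  then show ?case by (intro exI[of _ "{}"]) auto
next
  case (Suc m)
  obtain B where B: "B \<subseteq> N" "card B = min \<beta> (card N)"
    using obtain_subset_with_card_n[of "min \<beta> (card N)" N] by auto
  have "card (N - B) \<le> \<beta> * m"
    using B Suc.prems by (auto simp: card_Diff_subset finite_subset[OF B(1)] min_def split: if_splits)
  with Suc.IH[of "N - B"] Suc.prems obtain \<B> where IH: "finite \<B>" "card \<B> \<le> m" "disjoint \<B>"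
    "\<forall>B\<in>\<B>. card B \<le> \<beta>" "\<Union>\<B> = N - B" by auto
  have "disjoint (insert B \<B>)"
    using IH(5) disjointD[OF IH(3)] by (intro disjointI) blast
  then show ?case using IH B card_insert_le_m1[of "Suc m" \<B> B]
    by (intro exI[of _ "insert B \<B>"]) (auto simp: card_insert_if)
qed

text \<open>Cutting \<open>N\<close> into at most \<open>m\<close> blocks makes any
  \<open>m + 1\<close> of its vertices collide in one of them.\<close>

lemma pigeonhole_blocks:
  assumes "finite N" "card N \<le> \<beta> * m"
  shows "\<exists>\<B>. disjoint \<B> \<and> (\<forall>B\<in>\<B>. finite B \<and> card B \<le> \<beta> \<and> B \<subseteq> N) \<and>
    (\<forall>T. T \<subseteq> N \<and> m < card T \<longrightarrow> (\<exists>B\<in>\<B>. 2 \<le> card (B \<inter> T)))"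
proof -
  obtain \<B> where B: "finite \<B>" "card \<B> \<le> m" "disjoint \<B>" "\<forall>B\<in>\<B>. card B \<le> \<beta>" "\<Union>\<B> = N"
    using blocks_exist[OF assms] by auto
  have "\<exists>B\<in>\<B>. 2 \<le> card (B \<inter> T)" if T: "T \<subseteq> N" "m < card T" for T
  proof (rule ccontr)
    assume "\<not> ?thesis"
    then have *: "card (B \<inter> T) \<le> 1" if "B \<in> \<B>" for B using that by force
    have "T = (\<Union>B\<in>\<B>. B \<inter> T)" using T B(5) by auto
    then have "card T \<le> (\<Sum>B\<in>\<B>. card (B \<inter> T))" using card_UN_le[OF B(1)] by metis
    also have "\<dots> \<le> (\<Sum>B\<in>\<B>. 1)" using * by (intro sum_mono) auto
    finally show False using B(2) T(2) by simp
  qed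
  moreover have "finite B \<and> B \<subseteq> N" if "B \<in> \<B>" for B
    using that B(5) assms(1) by (auto intro: finite_subset)
  ultimately show ?thesis using B by (intro exI[of _ \<B>]) auto
qed

definition pairs_of :: "'a set \<Rightarrow> 'a set set" where
  "pairs_of K = {e. e \<subseteq> K \<and> card e = 2}"

lemma card_pairs_of: "finite K \<Longrightarrow> 2 * int (card (pairs_of K)) = int (card K) * (int (card K) - 1)"
proof -
  assume "finite K"
  then have c: "card (pairs_of K) = card K * (card K - 1) div 2"
    by (simp add: pairs_of_def n_subsets choose_two)
  have "even (card K * (card K - 1))" by (cases "card K") auto
  then have "2 * card (pairs_of K) = card K * (card K - 1)" using c by simp
  then have "2 * int (card (pairs_of K)) = int (card K) * int (card K - 1)"
    by (metis of_nat_mult of_nat_numeral)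
  then show ?thesis by (cases "card K") auto
qed

lemma finite_pairs_of: "finite K \<Longrightarrow> finite (pairs_of K)"
  by (auto simp: pairs_of_def)

lemma pair_in_pairs_of: "x \<in> K \<Longrightarrow> y \<in> K \<Longrightarrow> x \<noteq> y \<Longrightarrow> {x, y} \<in> pairs_of K"
  by (auto simp: pairs_of_def)

section \<open>Potential and closed sets in a family of cliques\<close>

locale clique_family =
  fixes \<K> :: "'a set set" and k :: nat
  assumes finite_family: "finite \<K>"
    and clique: "K \<in> \<K> \<Longrightarrow> finite K \<and> card K = k"
    and k3: "3 \<le> k"
    and sparse: "\<G> \<subseteq> \<K> \<Longrightarrow> \<G> \<noteq> {} \<Longrightarrow> connected_family \<G> \<Longrightarrow>
      2 * card (\<Union>(pairs_of ` \<G>)) \<le> k * card (\<Union>\<G>)"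
    and connected: "connected_family \<K>"
    and nonempty: "\<K> \<noteq> {}"
begin

definition inside :: "'a set \<Rightarrow> 'a set set" where "inside V = {K \<in> \<K>. K \<subseteq> V}"
text \<open>Only pairs from cliques lying inside \<open>V\<close> count; a pair in \<open>V\<close>
  from a clique that leaves \<open>V\<close> does not. This is the quantity that
  \<open>sparse\<close> controls.\<close>

definition edg :: "'a set \<Rightarrow> 'a set set" where "edg V = \<Union>(pairs_of ` inside V)"
definition phi :: "'a set \<Rightarrow> int" where "phi V = int k * int (card V) - 2 * int (card (edg V))"
definition good :: "'a set \<Rightarrow> bool" where
  "good V \<longleftrightarrow> V = \<Union>(inside V) \<and> V \<noteq> {} \<and> connected_family (inside V)"
text \<open>A clique not contained in a closed set has at least two vertices outside it, so a block
  placed on new vertices can catch it.\<close>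

definition closed :: "'a set \<Rightarrow> bool" where "closed V \<longleftrightarrow> (\<forall>K\<in>\<K>. card (K - V) \<noteq> 1)"

lemma finite_inside: "finite (inside V)"
  using finite_family by (simp add: inside_def)

lemma good_finite: "good V \<Longrightarrow> finite V"
  unfolding good_def using finite_inside[of V] clique by (metis (no_types, lifting) finite_Union inside_def mem_Collect_eq)

lemma finite_edg: "finite (edg V)"
  unfolding edg_def using finite_inside clique by (auto simp: inside_def intro!: finite_pairs_of)

lemma edg_subset: "e \<in> edg V \<Longrightarrow> e \<subseteq> V"
  by (auto simp: edg_def inside_def pairs_of_def)

lemma edg_mono: "V \<subseteq> W \<Longrightarrow> edg V \<subseteq> edg W"
  by (auto simp: edg_def inside_def)

lemma edgI: "K \<in> \<K> \<Longrightarrow> K \<subseteq> V \<Longrightarrow> x \<in> K \<Longrightarrow> y \<in> K \<Longrightarrow> x \<noteq> y \<Longrightarrow> {x, y} \<in> edg V"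
  using pair_in_pairs_of[of x K y] by (auto simp: edg_def inside_def)

lemma phi_nonneg: "good V \<Longrightarrow> 0 \<le> phi V"
proof -
  assume V: "good V"
  then have "2 * card (edg V) \<le> k * card V"
  proof -
    have g: "V = \<Union>(inside V)" "V \<noteq> {}" "connected_family (inside V)" using V by (auto simp: good_def)
    then have "inside V \<noteq> {}" by auto
    then have "2 * card (\<Union>(pairs_of ` inside V)) \<le> k * card (\<Union>(inside V))"
      using g by (intro sparse) (auto simp: inside_def)
    then show ?thesis unfolding edg_def using g(1) by simp
  qed
  then have "int (2 * card (edg V)) \<le> int (k * card V)" by linarith
  then show ?thesis by (simp add: phi_def)
qed

lemma clique_nonempty: "K \<in> \<K> \<Longrightarrow> K \<noteq> {}"
  using clique[of K] k3 by auto

lemma inside_clique: "K \<in> \<K> \<Longrightarrow> inside K = {K}"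
  unfolding inside_def using clique card_subset_eq[of K] by auto

lemma good_clique: "K \<in> \<K> \<Longrightarrow> good K"
  unfolding good_def using inside_clique linked_singleton clique_nonempty by fastforce

lemma phi_clique: "K \<in> \<K> \<Longrightarrow> phi K = int k"
  unfolding phi_def edg_def using inside_clique clique card_pairs_of[of K] by (simp add: algebra_simps)

lemma good_extend:
  assumes "good V" "K \<in> \<K>" "K \<inter> V \<noteq> {}"
  shows "good (V \<union> K)"
proof -
  have V: "V = \<Union>(inside V)" "connected_family (inside V)" using assms(1) by (auto simp: good_def)
  have c: "connected_family (insert K (inside V))"
    using linked_insert[OF V(2), of K] assms(3) V(1) by simp
  have "connected_family (insert K (inside V) \<union> inside (V \<union> K))"
  proof (rule linked_Un_meeting[OF c finite_inside])
    fix A assume "A \<in> inside (V \<union> K)"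
    then have "A \<subseteq> \<Union>(insert K (inside V))" "A \<noteq> {}"
      using V(1) clique_nonempty by (auto simp: inside_def)
    then show "A \<inter> \<Union>((\<lambda>K. K) ` insert K (inside V)) \<noteq> {}" by auto
  qed
  moreover have "insert K (inside V) \<union> inside (V \<union> K) = inside (V \<union> K)"
    using assms(2) by (auto simp: inside_def)
  moreover have "V \<union> K = \<Union>(inside (V \<union> K))"
  proof
    show "V \<union> K \<subseteq> \<Union>(inside (V \<union> K))"
    proof -
      have "inside V \<subseteq> inside (V \<union> K)" "K \<in> inside (V \<union> K)" using assms(2) by (auto simp: inside_def)
      then show ?thesis using V(1) by blast
    qed
  qed (auto simp: inside_def)
  ultimately show ?thesis using assms(1) by (auto simp: good_def)
qed

text \<open>The \<open>a\<close> new vertices add \<open>k a\<close>, and twice the number of new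
  pairs of the clique is \<open>k a + a (k - 1 - a)\<close>; each edge of \<open>X\<close>, created
  besides these pairs, costs 2 more. The third condition on \<open>X\<close> keeps it disjoint from
  the pairs counted for \<open>K\<close>.\<close>

lemma phi_step:
  assumes "good V" "K \<in> \<K>" "card (K - V) = a"
    and X: "X \<subseteq> edg (V \<union> K)" "X \<inter> edg V = {}" "\<And>e. e \<in> X \<Longrightarrow> \<not> e \<subseteq> K \<or> e \<subseteq> V"
  shows "phi (V \<union> K) \<le> phi V - int a * (int k - 1 - int a) - 2 * int (card X)"
proof -
  note finV = good_finite[OF assms(1)]
  have K: "finite K" "card K = k" using clique assms(2) by auto
  define P where "P = pairs_of K - pairs_of (K \<inter> V)"
  have PV: "P \<inter> edg V = {}" using edg_subset by (fastforce simp: P_def pairs_of_def)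
  have PX: "P \<inter> X = {}" using X(3) by (fastforce simp: P_def pairs_of_def)
  have sub: "P \<union> X \<union> edg V \<subseteq> edg (V \<union> K)"
    using X(1) edg_mono[of V "V \<union> K"] assms(2) by (auto simp: P_def edg_def inside_def)
  have finX: "finite X" using X(1) finite_edg finite_subset by blast
  have finP: "finite P" using K by (auto simp: P_def finite_pairs_of)
  have "card P + card X + card (edg V) = card (P \<union> X \<union> edg V)"
    using PV PX X(2) finX finP finite_edg by (subst card_Un_disjoint; auto simp: card_Un_disjoint)
  also have "\<dots> \<le> card (edg (V \<union> K))" using sub finite_edg by (intro card_mono)
  finally have 1: "card P + card X + card (edg V) \<le> card (edg (V \<union> K))" .
  have sub2: "pairs_of (K \<inter> V) \<subseteq> pairs_of K" by (auto simp: pairs_of_def)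
  have cKV: "card (K \<inter> V) + a = k"
    using card_Diff_subset_Int[of K V] K assms(3) card_mono[of K "K \<inter> V"] by auto
  have "card P = card (pairs_of K) - card (pairs_of (K \<inter> V))"
    unfolding P_def using sub2 K by (intro card_Diff_subset finite_pairs_of) auto
  moreover have "card (pairs_of (K \<inter> V)) \<le> card (pairs_of K)"
    using sub2 K by (intro card_mono finite_pairs_of) auto
  ultimately have "2 * int (card P) = 2 * int (card (pairs_of K)) - 2 * int (card (pairs_of (K \<inter> V)))"
    by simp
  also have "\<dots> = int k * (int k - 1) - int (card (K \<inter> V)) * (int (card (K \<inter> V)) - 1)"
    using card_pairs_of[of K] card_pairs_of[of "K \<inter> V"] K by simp
  also have "\<dots> = int k * (int k - 1) - (int k - int a) * (int k - int a - 1)"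
    using cKV by (metis add_diff_cancel_right' of_nat_add)
  finally have 2: "2 * int (card P) = int k * int a + int a * (int k - 1 - int a)"
    by (simp add: algebra_simps)
  have "card (V \<union> K) = card V + a"
    using assms(3) finV K by (metis Un_Diff_cancel card_Un_disjoint Diff_disjoint finite_Diff)
  then have "phi (V \<union> K) = int k * int (card V) + int k * int a - 2 * int (card (edg (V \<union> K)))"
    by (simp add: phi_def algebra_simps)
  also have "\<dots> \<le> int k * int (card V) + int k * int a - 2 * (int (card P) + int (card X) + int (card (edg V)))"
    using 1 by (simp flip: of_nat_add)
  finally show ?thesis using 2 by (simp add: phi_def)
qed

text \<open>The sets reached by the closure process started from the single clique \<open>A\<close>.
  Every step costs \<open>k - 2\<close>, so a long generation uses up the budget.\<close>

inductive generated :: "'a set \<Rightarrow> 'a set \<Rightarrow> bool" for A where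
  base: "generated A A"
| step: "generated A U \<Longrightarrow> K \<in> \<K> \<Longrightarrow> card (K - U) = 1 \<Longrightarrow> generated A (U \<union> K)"

lemma meets_if_card_diff_1: "K \<in> \<K> \<Longrightarrow> card (K - U) = 1 \<Longrightarrow> K \<inter> U \<noteq> {}"
  using clique[of K] k3 by (cases "K \<inter> U = {}") (auto simp: Diff_triv)

lemma generated_bounds:
  assumes "generated A U" "A \<in> \<K>"
  shows "good U \<and> k \<le> card U \<and> U \<subseteq> \<Union>\<K> \<and> phi U \<le> int k - (int k - 2) * (int (card U) - int k)"
  using assms(1)
proof induction
  case base
  then show ?case using good_clique phi_clique clique assms(2) by auto
next
  case (step U K)
  have fin: "finite U" "finite K" using step good_finite clique by auto
  have "card (U \<union> K) = card U + 1"
    using step.hyps(3) fin by (metis Un_Diff_cancel card_Un_disjoint Diff_disjoint finite_Diff)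
  moreover have "phi (U \<union> K) \<le> phi U - 1 * (int k - 1 - 1)"
    using phi_step[of U K 1 "{}"] step by simp
  ultimately show ?case using step good_extend[of U K] meets_if_card_diff_1[of K U]
    by (auto simp: algebra_simps)
qed

text \<open>After attaching \<open>A\<close> to \<open>V\<close>, the closure adds \<open>s\<close> further vertices at cost \<open>k - 2\<close> each.  Either
  all of them are already generated from \<open>A\<close> alone, or some edge joins a new vertex to \<open>V - U\<close>, which
  costs another 2.\<close>

lemma extend_closed:
  assumes V: "good V" "closed V" and A: "A \<in> \<K>" "A \<inter> V \<noteq> {}" and a: "card (A - V) = a" "a \<noteq> 0"
  obtains s U where "good (V \<union> U)" "closed (V \<union> U)" "A \<subseteq> U" "card (U - V) = a + s" "U \<inter> V = A \<inter> V"
    "phi (V \<union> U) \<le> phi V - int a * (int k - 1 - int a) - (int k - 2) * int s" 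
    "phi (V \<union> U) \<le> phi V - int a * (int k - 1 - int a) - (int k - 2) * int s - 2 \<or> generated A U"
proof -
  \<comment> \<open>\<open>cross U\<close> records that an extra edge between the new part
    \<open>U - V\<close> and the old part \<open>V - U\<close> has appeared; its cost of 2 is
    charged once, at the first appearance. As long as there is none, the closure behaves as if
    \<open>V\<close> outside \<open>A\<close> were absent, so \<open>U\<close> is generated from
    \<open>A\<close>.\<close>
  define cross where "cross U \<longleftrightarrow> (\<exists>e\<in>edg (V \<union> U). e \<inter> (U - V) \<noteq> {} \<and> e \<inter> (V - U) \<noteq> {})" for U
  define Inv where "Inv s U \<longleftrightarrow> good (V \<union> U) \<and> A \<subseteq> U \<and> card (U - V) = a + s \<and> U \<inter> V = A \<inter> V \<and>
    U \<subseteq> \<Union>\<K> \<and>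
    phi (V \<union> U) \<le> phi V - int a * (int k - 1 - int a) - (int k - 2) * int s - (if cross U then 2 else 0) \<and>
    (cross U \<or> generated A U)" for s U
  have "Inv 0 A"
  proof -
    have "phi (V \<union> A) \<le> phi V - int a * (int k - 1 - int a) - (if cross A then 2 else 0)"
    proof (cases "cross A")
      case True
      then obtain e where e: "e \<in> edg (V \<union> A)" "e \<inter> (A - V) \<noteq> {}" "e \<inter> (V - A) \<noteq> {}"
        by (auto simp: cross_def)
      then have "phi (V \<union> A) \<le> phi V - int a * (int k - 1 - int a) - 2 * int (card {e})"
        by (intro phi_step) (use V A a edg_subset in auto)
      then show ?thesis using True by simp
    next
      case False
      then show ?thesis using phi_step[of V A a "{}"] V A a by simp
    qed
    then show ?thesis using good_extend[OF V(1) A] A a by (auto simp: Inv_def intro: generated.base)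
  qed
  moreover have step: "Inv (Suc s) (insert z U)" if I: "Inv s U" and K: "K \<in> \<K>" "K - (V \<union> U) = {z}" for s U K z
  proof -
    have gU: "good (V \<union> U)" using I by (simp add: Inv_def)
    have c1: "card (K - (V \<union> U)) = 1" using K by simp
    have un: "V \<union> insert z U = (V \<union> U) \<union> K" using K(2) by auto
    have g: "good (V \<union> insert z U)"
      unfolding un by (intro good_extend gU K meets_if_card_diff_1 c1)
    have z: "z \<in> K" "z \<notin> V" "z \<notin> U" using K by auto
    have finU: "finite (U - V)" using good_finite[OF gU] by (auto intro: finite_subset)
    have cU: "card (insert z U - V) = a + Suc s"
      using I z finU by (simp add: Inv_def insert_Diff_if)
    have mono: "cross U \<Longrightarrow> cross (insert z U)"
      unfolding cross_def using edg_mono[of "V \<union> U" "V \<union> insert z U"] z(2) by blast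
    have phi0: "phi (V \<union> insert z U) \<le> phi (V \<union> U) - (int k - 2)"
      unfolding un using phi_step[OF gU K(1) c1, of "{}"] by simp
    have phi2: "phi (V \<union> insert z U) \<le> phi (V \<union> U) - (int k - 2) - 2" if cr: "\<not> cross U" "cross (insert z U)"
    proof -
      obtain e0 where e0: "e0 \<in> edg (V \<union> insert z U)" "e0 \<inter> (insert z U - V) \<noteq> {}" "e0 \<inter> (V - insert z U) \<noteq> {}"
        using cr(2) by (auto simp: cross_def)
      \<comment> \<open>An edge not yet charged has to be found. The crossing edge \<open>e0\<close>
        itself serves unless it is one of the pairs of \<open>K\<close> at \<open>z\<close>, which
        the cost \<open>k - 2\<close> already covers.\<close>
      have "\<exists>e. e \<in> edg (V \<union> insert z U) \<and> e \<notin> edg (V \<union> U) \<and> (\<not> e \<subseteq> K \<or> e \<subseteq> V \<union> U)"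
      proof (cases "z \<in> e0")
        case False
        then have "e0 \<inter> (U - V) \<noteq> {}" "e0 \<inter> (V - U) \<noteq> {}" using e0 by auto
        then have "e0 \<notin> edg (V \<union> U)" using cr(1) by (auto simp: cross_def)
        moreover have "e0 \<subseteq> V \<union> U" using edg_subset[OF e0(1)] False by auto
        ultimately show ?thesis using e0 by blast
      next
        case True
        then have n0: "e0 \<notin> edg (V \<union> U)" using z edg_subset by blast
        obtain j where j: "j \<in> e0" "j \<in> V" "j \<notin> U" using e0(3) by auto
        show ?thesis
        proof (cases "j \<in> K")
          case False
          then show ?thesis using e0 n0 j by blast
        next
          case True
          \<comment> \<open>Closedness of \<open>V\<close> supplies a second vertex \<open>y\<close>
            of \<open>K\<close> outside \<open>V\<close>, which was added earlier. The pair
            \<open>{y, j}\<close> would have crossed before had it been an edge then, so it is new;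
            and it lies inside \<open>V \<union> U\<close>, outside the pairs charged for
            \<open>K\<close>.\<close>
          have "card (K - V) \<noteq> 1" using V(2) K(1) by (auto simp: closed_def)
          moreover have "z \<in> K - V" using z by auto
          ultimately have "K - V \<noteq> {z}" "K - V \<noteq> {}" by auto
          then obtain y where y: "y \<in> K - V" "y \<noteq> z" by blast
          then have yU: "y \<in> U - V" using K(2) by blast
          have ed: "{y, j} \<in> edg (V \<union> insert z U)"
            using K y j True by (intro edgI[of K]) auto
          have "{y, j} \<inter> (U - V) \<noteq> {}" "{y, j} \<inter> (V - U) \<noteq> {}" using yU j by auto
          then have "{y, j} \<notin> edg (V \<union> U)" using cr(1) unfolding cross_def by auto
          moreover have "{y, j} \<subseteq> V \<union> U" using yU j by auto
          ultimately show ?thesis using ed by blast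
        qed
      qed
      then obtain e where "e \<in> edg (V \<union> insert z U)" "e \<notin> edg (V \<union> U)" "\<not> e \<subseteq> K \<or> e \<subseteq> V \<union> U" by blast
      then have "phi (V \<union> insert z U) \<le> phi (V \<union> U) - int 1 * (int k - 1 - int 1) - 2 * int (card {e})"
        unfolding un by (intro phi_step) (use gU K c1 in auto)
      then show ?thesis by simp
    qed
    \<comment> \<open>A vertex of \<open>K\<close> in \<open>V - U\<close> would form a crossing
      edge with \<open>z\<close>; so \<open>K\<close> misses only \<open>z\<close> from
      \<open>U\<close> and is a legal generation step.\<close>
    have gen: "generated A (insert z U)" if nc: "\<not> cross (insert z U)"
    proof -
      have "generated A U" using nc mono I by (auto simp: Inv_def)
      moreover have "K - U = {z}"
      proof -
        have False if "j \<in> K" "j \<in> V - U" for j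
        proof -
          have "{z, j} \<in> edg (V \<union> insert z U)" using K z that by (intro edgI[of K]) auto
          moreover have "{z, j} \<inter> (insert z U - V) \<noteq> {}" "{z, j} \<inter> (V - insert z U) \<noteq> {}" using that z by auto
          ultimately show False using nc unfolding cross_def by auto
        qed
        then show ?thesis using K(2) by auto
      qed
      moreover have "U \<union> K = insert z U" using calculation(2) by auto
      ultimately show ?thesis using generated.step[of A U K] K(1) by simp
    qed
    have ph: "phi (V \<union> insert z U) \<le> phi V - int a * (int k - 1 - int a) - (int k - 2) * int (Suc s) - (if cross (insert z U) then 2 else 0)"
    proof -
      have e: "(int k - 2) * int (Suc s) = (int k - 2) * int s + (int k - 2)" by (simp add: algebra_simps)
      have I': "phi (V \<union> U) \<le> phi V - int a * (int k - 1 - int a) - (int k - 2) * int s - (if cross U then 2 else 0)"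
        using I by (simp add: Inv_def)
      show ?thesis unfolding e using I' phi0 phi2 mono by (cases "cross U"; cases "cross (insert z U)") auto
    qed
    show ?thesis
      unfolding Inv_def using I g cU ph gen z K by (auto simp: Inv_def)
  qed
  have bound: "s \<le> card (\<Union>\<K>)" if "Inv s U" for s U
  proof -
    have "finite (\<Union>\<K>)" using finite_family clique by auto
    then have "card (U - V) \<le> card (\<Union>\<K>)" using that by (intro card_mono) (auto simp: Inv_def)
    then show ?thesis using that by (simp add: Inv_def)
  qed
  \<comment> \<open>A run of maximal length cannot be prolonged, which is closedness.\<close>
  ultimately obtain s where s: "\<exists>U. Inv s U" "\<And>s'. \<exists>U. Inv s' U \<Longrightarrow> s' \<le> s"
    using Nat.ex_has_greatest_nat[of "\<lambda>s. \<exists>U. Inv s U" 0 "card (\<Union>\<K>)"] by blast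
  then obtain U where U: "Inv s U" by blast
  have "closed (V \<union> U)"
    unfolding closed_def
  proof (intro ballI notI)
    fix K assume "K \<in> \<K>" "card (K - (V \<union> U)) = 1"
    then obtain z where "K - (V \<union> U) = {z}" by (auto simp: card_1_singleton_iff)
    then have "Inv (Suc s) (insert z U)" using step[OF U \<open>K \<in> \<K>\<close>] by blast
    then show False using s(2)[of "Suc s"] by auto
  qed
  then show thesis using U that[of U s] by (auto simp: Inv_def split: if_splits)
qed

text \<open>Starting from the largest generated set tames later closures: a closure without an extra
  edge is generated from its first clique, hence adds no more vertices than the start did, and the
  start has already paid \<open>k - 2\<close> for each of its own.\<close>

lemma maximal_generated:
  obtains A W where "A \<in> \<K>" "generated A W" "good W" "closed W"
    "\<And>A' U. A' \<in> \<K> \<Longrightarrow> generated A' U \<Longrightarrow> card U \<le> card W"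
proof -
  have finU: "finite (\<Union>\<K>)" using finite_family clique by auto
  define Q where "Q m \<longleftrightarrow> (\<exists>A\<in>\<K>. \<exists>U. generated A U \<and> card U = m)" for m
  have "Q m \<Longrightarrow> m \<le> card (\<Union>\<K>)" for m
    unfolding Q_def using generated_bounds finU by (metis card_mono)
  moreover have "\<exists>m. Q m" unfolding Q_def using nonempty generated.base by blast
  ultimately obtain m where m: "Q m" "\<And>m'. Q m' \<Longrightarrow> m' \<le> m"
    using Nat.ex_has_greatest_nat[of Q _ "card (\<Union>\<K>)"] by blast
  then obtain A W where W: "A \<in> \<K>" "generated A W" "card W = m" by (auto simp: Q_def)
  have gW: "good W" using generated_bounds W by blast
  have "closed W"
    unfolding closed_def
  proof (intro ballI notI)
    fix K assume K: "K \<in> \<K>" "card (K - W) = 1"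
    have "card (W \<union> K) = card W + 1"
      using K good_finite[OF gW] clique by (metis Un_Diff_cancel card_Un_disjoint Diff_disjoint finite_Diff)
    moreover have "Q (card (W \<union> K))" unfolding Q_def using generated.step[OF W(2) K] W(1) by blast
    ultimately show False using m(2) W(3) by fastforce
  qed
  then show thesis using that W gW m(2) by (metis Q_def)
qed

section \<open>Extending a covering along closed sets\<close>

definition covered_inside :: "nat \<Rightarrow> 'a set \<Rightarrow> bool" where
  "covered_inside \<beta> V \<longleftrightarrow> (\<exists>\<B>. disjoint \<B> \<and> (\<forall>B\<in>\<B>. finite B \<and> card B \<le> \<beta> \<and> B \<subseteq> V) \<and>
     (\<forall>K\<in>inside V. \<exists>B\<in>\<B>. 2 \<le> card (B \<inter> K)))"

lemma covered_inside_extend: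
  assumes "covered_inside \<beta> V" "disjoint \<C>" "\<forall>B\<in>\<C>. finite B \<and> card B \<le> \<beta> \<and> B \<subseteq> W - V" "V \<subseteq> W"
    and "\<And>K. K \<in> \<K> \<Longrightarrow> K \<subseteq> W \<Longrightarrow> \<not> K \<subseteq> V \<Longrightarrow> \<exists>B\<in>\<C>. 2 \<le> card (B \<inter> K)"
  shows "covered_inside \<beta> W"
proof -
  from assms(1) obtain \<B> where B: "disjoint \<B>" "\<forall>B\<in>\<B>. finite B \<and> card B \<le> \<beta> \<and> B \<subseteq> V"
     "\<forall>K\<in>inside V. \<exists>B\<in>\<B>. 2 \<le> card (B \<inter> K)" by (auto simp: covered_inside_def)
  have "B' \<inter> C' = {}" if "B' \<in> \<B>" "C' \<in> \<C>" for B' C'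
    using bspec[OF B(2) that(1)] bspec[OF assms(3) that(2)] by auto
  then have "disjoint (\<B> \<union> \<C>)"
    using disjointD[OF B(1)] disjointD[OF assms(2)] by (intro disjointI) (metis Int_commute Un_iff)
  moreover have "\<forall>B\<in>\<B> \<union> \<C>. finite B \<and> card B \<le> \<beta> \<and> B \<subseteq> W"
    using B(2) assms(3,4) by auto
  moreover have "\<exists>B\<in>\<B> \<union> \<C>. 2 \<le> card (B \<inter> K)" if "K \<in> inside W" for K
    using that B(3) assms(5)[of K] by (cases "K \<subseteq> V") (auto simp: inside_def)
  ultimately show ?thesis unfolding covered_inside_def by blast
qed

text \<open>The attached clique has the fewest new vertices among the cliques that meet
  \<open>V\<close> and leave it. If it meets \<open>V\<close> in one vertex, every new clique has at
  least \<open>k - 1\<close> new vertices and pigeonhole with \<open>k - 2\<close> blocks applies,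
  once at most \<open>k\<close> vertices are new. If it meets \<open>V\<close> in more, its cost
  \<open>a (k - 1 - a) \<ge> k - 2\<close> leaves so little budget that it is the only new clique,
  and one pair suffices.\<close>

lemma covered_extension:
  assumes \<beta>: "2 \<le> \<beta>" "k \<le> \<beta> * (k - 2)"
    and V: "good V" "closed V" "covered_inside \<beta> V" "phi V \<le> int k - (int k - 2) * int s0"
    and max: "\<And>A' U. A' \<in> \<K> \<Longrightarrow> generated A' U \<Longrightarrow> card U \<le> k + s0"
    and ne: "\<exists>A\<in>\<K>. \<not> A \<subseteq> V"
  shows "\<exists>W. V \<subset> W \<and> good W \<and> closed W \<and> covered_inside \<beta> W \<and> phi W \<le> phi V"
proof -
  have finV: "finite V" using V good_finite by auto
  define cand where "cand = {A \<in> \<K>. \<not> A \<subseteq> V \<and> A \<inter> V \<noteq> {}}"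
  have "inside V \<subset> \<K>" using ne by (auto simp: inside_def)
  moreover have "inside V \<noteq> {}" "V = \<Union>(inside V)" using V(1) by (auto simp: good_def)
  ultimately have "\<exists>A\<in>\<K> - inside V. A \<inter> V \<noteq> {}"
    using connected unfolding linked_def image_ident by metis
  then have "cand \<noteq> {}" by (auto simp: cand_def inside_def)
  moreover have "finite cand" using finite_family by (simp add: cand_def)
  ultimately obtain A where A: "A \<in> cand" and min: "\<And>B. B \<in> cand \<Longrightarrow> card (A - V) \<le> card (B - V)"
    using arg_min_if_finite(1)[of cand "\<lambda>B. card (B - V)"] arg_min_least[of cand _ "\<lambda>B. card (B - V)"] by blast
  have AK: "A \<in> \<K>" "\<not> A \<subseteq> V" "A \<inter> V \<noteq> {}" "finite A" "card A = k"
    using A clique by (auto simp: cand_def)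
  define a where "a = card (A - V)"
  have "a \<noteq> 0" using AK by (auto simp: a_def)
  moreover have "a \<noteq> 1" using V(2) AK by (auto simp: closed_def a_def)
  ultimately have a2: "2 \<le> a" by simp
  have aAV: "a + card (A \<inter> V) = k"
    using AK card_Diff_subset_Int[of A V] card_mono[of A "A \<inter> V"] by (auto simp: a_def)
  have "card (A \<inter> V) \<noteq> 0" using AK by auto
  then have ak: "a \<le> k - 1" using aAV by linarith
  from extend_closed[OF V(1,2) AK(1,3) a_def[symmetric] \<open>a \<noteq> 0\<close>]
  obtain s U where U: "good (V \<union> U)" "closed (V \<union> U)" "A \<subseteq> U" "card (U - V) = a + s" "U \<inter> V = A \<inter> V"
    and phiU: "phi (V \<union> U) \<le> phi V - int a * (int k - 1 - int a) - (int k - 2) * int s"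
    "phi (V \<union> U) \<le> phi V - int a * (int k - 1 - int a) - (int k - 2) * int s - 2 \<or> generated A U" by metis
  have finU: "finite U" using good_finite[OF U(1)] by auto
  have cardU: "card U = k + s"
    using card_Diff_subset_Int[of U V] finU U(3,4,5) aAV AK(4) a2 by auto
  have gen: "s \<le> s0" if "generated A U" using max[OF AK(1) that] cardU by simp
  have pos: "0 \<le> phi (V \<union> U)" using phi_nonneg U by blast
  define ca cs c0 where "ca = int a * (int k - 1 - int a)" and "cs = (int k - 2) * int s"
    and "c0 = (int k - 2) * int s0"
  note phiU = phiU[folded ca_def cs_def] and V4 = V(4)[folded c0_def]
  have k3': "3 \<le> int k" using k3 by simp
  have ka: "0 \<le> ca" unfolding ca_def using ak k3 by (intro mult_nonneg_nonneg) auto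
  have ks: "0 \<le> cs" "0 \<le> c0" using k3 by (auto simp: cs_def c0_def)
  have cs_ge: "m \<le> s \<Longrightarrow> (int k - 2) * int m \<le> cs" and c0_ge: "m \<le> s0 \<Longrightarrow> (int k - 2) * int m \<le> c0" for m
    unfolding cs_def c0_def using k3 by (auto intro!: mult_left_mono)
  have sub: "V \<subset> V \<union> U" using AK U(3) by auto
  have dec: "phi (V \<union> U) \<le> phi V" using phiU ka ks by linarith
  have newU: "K - V \<subseteq> U - V" if "K \<subseteq> V \<union> U" for K using that by auto
  have "\<exists>\<C>. disjoint \<C> \<and> (\<forall>B\<in>\<C>. finite B \<and> card B \<le> \<beta> \<and> B \<subseteq> U - V) \<and>
    (\<forall>K\<in>\<K>. K \<subseteq> V \<union> U \<and> \<not> K \<subseteq> V \<longrightarrow> (\<exists>B\<in>\<C>. 2 \<le> card (B \<inter> K)))"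
  proof (cases "a = k - 1")
    case True
    \<comment> \<open>Two closure steps cost \<open>2 k - 4\<close>. With an extra edge
      \<open>phi\<close> drops to at most \<open>k - (2 k - 4) - 2 < 0\<close>; without one,
      \<open>s0 \<ge> 2\<close>, the start has spent as much again, and
      \<open>k - 2 (2 k - 4) < 0\<close> for \<open>k \<ge> 3\<close>.\<close>
    have "s \<le> 1"
    proof (rule ccontr)
      assume "\<not> s \<le> 1"
      then have s2: "2 \<le> s" by simp
      have c: "2 * int k - 4 \<le> cs" using cs_ge[OF s2] by (simp add: algebra_simps)
      then have "\<not> phi (V \<union> U) \<le> phi V - ca - cs - 2" using pos V4 ka ks k3' by linarith
      then have "generated A U" using phiU(2) by blast
      then have "2 * int k - 4 \<le> c0" using gen s2 c0_ge[of 2] by (simp add: algebra_simps)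
      then show False using c phiU(1) pos V4 ka k3' by linarith
    qed
    \<comment> \<open>There are at most \<open>(k - 1) + 1\<close> new vertices; here the relation
      between \<open>k\<close> and the block size enters.\<close>
    then have "card (U - V) \<le> \<beta> * (k - 2)" using U(4) True \<beta>(2) k3 by linarith
    from pigeonhole_blocks[OF _ this] finU obtain \<C> where C: "disjoint \<C>"
      "\<forall>B\<in>\<C>. finite B \<and> card B \<le> \<beta> \<and> B \<subseteq> U - V"
      "\<forall>T. T \<subseteq> U - V \<and> k - 2 < card T \<longrightarrow> (\<exists>B\<in>\<C>. 2 \<le> card (B \<inter> T))" by auto
    have "\<exists>B\<in>\<C>. 2 \<le> card (B \<inter> K)" if K: "K \<in> \<K>" "K \<subseteq> V \<union> U" "\<not> K \<subseteq> V" for K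
    proof -
      have "k - 1 \<le> card (K - V)"
      proof (cases "K \<inter> V = {}")
        case True
        then show ?thesis using clique[OF K(1)] by (simp add: Diff_triv)
      next
        case False
        then show ?thesis using min[of K] K True by (auto simp: cand_def a_def)
      qed
      then have "k - 2 < card (K - V)" using k3 by linarith
      then obtain B where B: "B \<in> \<C>" "2 \<le> card (B \<inter> (K - V))"
        using C(3) newU[OF K(2)] by blast
      have "card (B \<inter> (K - V)) \<le> card (B \<inter> K)" using C(2) B(1) by (intro card_mono) auto
      then show ?thesis using B by (intro bexI[of _ B]) auto
    qed
    then show ?thesis using C by (intro exI[of _ \<C>]) blast
  next
    case False
    then have ak2: "a \<le> k - 2" and k4: "4 \<le> k" using ak a2 by auto
    \<comment> \<open>This product is exactly \<open>a (k - 1 - a) - (k - 2)\<close>.\<close>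
    have "0 \<le> (int a - 1) * (int k - 2 - int a)" using a2 ak2 by (intro mult_nonneg_nonneg) auto
    then have kk: "int k - 2 \<le> ca" by (simp add: ca_def algebra_simps)
    have s0: "s = 0"
    proof (rule ccontr)
      assume "s \<noteq> 0"
      then have c: "int k - 2 \<le> cs" using cs_ge[of 1] by simp
      then have "\<not> phi (V \<union> U) \<le> phi V - ca - cs - 2" using pos V4 kk ks k4 by linarith
      then have "generated A U" using phiU(2) by blast
      then have "int k - 2 \<le> c0" using gen \<open>s \<noteq> 0\<close> c0_ge[of 1] by simp
      then show False using phiU(1) pos V4 kk c k4 by linarith
    qed
    have "card U = card A" using cardU s0 AK by simp
    then have UA: "U = A" using U(3) finU card_subset_eq by metis
    \<comment> \<open>A second new clique reaches a vertex \<open>w\<close> of \<open>V\<close>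
      outside \<open>A\<close> and, by closedness, has two new vertices. Their edges to
      \<open>w\<close> are not pairs of \<open>A\<close> and cost 4 on top of \<open>k - 2\<close>,
      more than the whole budget \<open>k\<close>.\<close>
    have uniq: "K = A" if K: "K \<in> \<K>" "K \<subseteq> V \<union> A" "\<not> K \<subseteq> V" for K
    proof (rule ccontr)
      assume "K \<noteq> A"
      then have "\<not> K \<subseteq> A" using clique[OF K(1)] AK card_subset_eq by metis
      then obtain w where w: "w \<in> K" "w \<in> V" "w \<notin> A" using K(2) by auto
      have "finite (K - V)" "K - V \<noteq> {}" "card (K - V) \<noteq> 1"
        using K clique V(2) by (auto simp: closed_def)
      then have "card (K - V) \<noteq> 0" "card (K - V) \<noteq> 1" by auto
      then have "2 \<le> card (K - V)" by linarith
      then obtain n1 n2 where n: "n1 \<in> K - V" "n2 \<in> K - V" "n1 \<noteq> n2"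
        using \<open>finite (K - V)\<close> by (auto simp: card_le_Suc_iff numeral_2_eq_2)
      have "n1 \<in> A" "n2 \<in> A" using n K(2) by auto
      have d: "{n1, w} \<noteq> {n2, w}" using n w by (auto simp: doubleton_eq_iff)
      have "phi (V \<union> A) \<le> phi V - int a * (int k - 1 - int a) - 2 * int (card {{n1, w}, {n2, w}})"
      proof (rule phi_step[OF V(1) AK(1) a_def[symmetric]])
        have "{n1, w} \<in> edg (V \<union> A)" "{n2, w} \<in> edg (V \<union> A)"
          using K w n by (auto intro!: edgI[of K])
        then show "{{n1, w}, {n2, w}} \<subseteq> edg (V \<union> A)" by simp
        show "{{n1, w}, {n2, w}} \<inter> edg V = {}" using n edg_subset by blast
      qed (use w in auto)
      then have "phi (V \<union> A) \<le> phi V - ca - 4" using d by (simp add: ca_def)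
      then show False using pos UA V4 kk ks by simp
    qed
    obtain P where P: "P \<subseteq> A - V" "card P = 2"
      using a2 obtain_subset_with_card_n[of 2 "A - V"] by (auto simp: a_def)
    have "P \<inter> A = P" using P by auto
    then have "2 \<le> card (P \<inter> K)" if "K \<in> \<K>" "K \<subseteq> V \<union> U" "\<not> K \<subseteq> V" for K
      using uniq[of K] that UA P(2) by simp
    moreover have "finite P" "P \<subseteq> U - V" using P UA AK(4) by (auto intro: finite_subset)
    ultimately show ?thesis using P \<beta> by (intro exI[of _ "{P}"]) (simp add: disjoint_def)
  qed
  then obtain \<C> where "disjoint \<C>" "\<forall>B\<in>\<C>. finite B \<and> card B \<le> \<beta> \<and> B \<subseteq> U - V"
    "\<forall>K\<in>\<K>. K \<subseteq> V \<union> U \<and> \<not> K \<subseteq> V \<longrightarrow> (\<exists>B\<in>\<C>. 2 \<le> card (B \<inter> K))" by blast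
  then have "covered_inside \<beta> (V \<union> U)"
    by (intro covered_inside_extend[OF V(3), of \<C>]) auto
  then show ?thesis using sub U dec by blast
qed

theorem cliques_coverable:
  assumes "4 \<le> k \<and> 2 \<le> \<beta> \<or> 3 \<le> \<beta>"
  shows "coverable \<beta> \<K>"
proof -
  have \<beta>: "2 \<le> \<beta>" "k \<le> \<beta> * (k - 2)"
  proof -
    show "2 \<le> \<beta>" using assms by auto
    have "2 * (k - 2) \<le> \<beta> * (k - 2)" using \<open>2 \<le> \<beta>\<close> by simp
    moreover have "3 * (k - 2) \<le> \<beta> * (k - 2)" if "3 \<le> \<beta>" using that by simp
    ultimately show "k \<le> \<beta> * (k - 2)" using assms k3 by linarith
  qed
  obtain A W where W: "A \<in> \<K>" "generated A W" "good W" "closed W"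
    and max: "\<And>A' U. A' \<in> \<K> \<Longrightarrow> generated A' U \<Longrightarrow> card U \<le> card W"
    using maximal_generated by metis
  have finW: "finite W" using good_finite W by auto
  define s0 where "s0 = card W - k"
  have cW: "card W = k + s0" "phi W \<le> int k - (int k - 2) * int s0"
    using generated_bounds[OF W(2,1)] by (auto simp: s0_def of_nat_diff)
  have "(int k - 2) * int s0 \<le> int k" using cW phi_nonneg[OF W(3)] by linarith
  \<comment> \<open>The budget gives \<open>(k - 2) s0 \<le> k\<close>: for triangles at most 6
    vertices against \<open>2 \<beta> \<ge> 6\<close>, otherwise at most \<open>k + 2\<close>
    against \<open>2 (k - 1)\<close>. With \<open>k - 1\<close> blocks every \<open>k\<close>-clique
    in \<open>W\<close> has a collision.\<close>
  have "card W \<le> \<beta> * (k - 1)"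
  proof (cases "k = 3")
    case True
    then have "s0 \<le> 3" "3 \<le> \<beta>" using \<open>(int k - 2) * int s0 \<le> int k\<close> assms by auto
    then show ?thesis using cW True by simp
  next
    case False
    then have k4: "4 \<le> k" using k3 by simp
    have "s0 \<le> 2"
    proof (rule ccontr)
      assume "\<not> s0 \<le> 2"
      then have "(int k - 2) * 3 \<le> (int k - 2) * int s0" using k4 by (intro mult_left_mono) auto
      then have "(int k - 2) * 3 \<le> int k" using \<open>(int k - 2) * int s0 \<le> int k\<close> by (rule order_trans)
      then show False using k4 by simp
    qed
    have "2 * (k - 1) \<le> \<beta> * (k - 1)" using \<beta>(1) by simp
    then show ?thesis using cW \<open>s0 \<le> 2\<close> k4 by linarith
  qed
  from pigeonhole_blocks[OF finW this] obtain \<B> where B: "disjoint \<B>"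
    "\<forall>B\<in>\<B>. finite B \<and> card B \<le> \<beta> \<and> B \<subseteq> W"
    "\<forall>T. T \<subseteq> W \<and> k - 1 < card T \<longrightarrow> (\<exists>B\<in>\<B>. 2 \<le> card (B \<inter> T))" by auto
  have cov0: "covered_inside \<beta> W"
    unfolding covered_inside_def
  proof (intro exI[of _ \<B>] conjI ballI)
    fix K assume "K \<in> inside W"
    then show "\<exists>B\<in>\<B>. 2 \<le> card (B \<inter> K)" using B(3) clique[of K] k3 by (auto simp: inside_def)
  qed (use B in auto)
  define Q where "Q V \<longleftrightarrow> good V \<and> closed V \<and> covered_inside \<beta> V \<and> phi V \<le> phi W" for V
  have "finite (\<Union>\<K>)" using finite_family clique by auto
  moreover have "V \<subseteq> \<Union>\<K>" if "Q V" for V using that by (auto simp: Q_def good_def inside_def)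
  ultimately have "finite {V. Q V}" by (intro finite_subset[of "{V. Q V}" "Pow (\<Union>\<K>)"]) auto
  moreover have "{V. Q V} \<noteq> {}" using W cov0 by (auto simp: Q_def)
  ultimately obtain V where V: "Q V" and maxV: "\<And>V'. Q V' \<Longrightarrow> V \<subseteq> V' \<Longrightarrow> V = V'"
    using finite_has_maximal[of "{V. Q V}"] by auto
  have "\<forall>A\<in>\<K>. A \<subseteq> V"
  proof (rule ccontr)
    assume "\<not> ?thesis"
    then have "\<exists>V'. V \<subset> V' \<and> good V' \<and> closed V' \<and> covered_inside \<beta> V' \<and> phi V' \<le> phi V"
      using V cW max by (intro covered_extension[OF \<beta>, of _ s0]) (auto simp: Q_def)
    then show False using maxV V unfolding Q_def by (metis order_trans psubset_eq)
  qed
  then have "inside V = \<K>" by (auto simp: inside_def)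
  then show ?thesis using V unfolding Q_def covered_inside_def coverable_def by auto
qed

end

section \<open>Families of cycles\<close>

text \<open>Induction on the number of indices. A critical proper subset is matched first and its
  values are removed from the other sets; if there is none, the condition has slack one on proper
  subsets, so any value of one index can be fixed and deleted.\<close>

lemma hall_marriage:
  fixes A :: "'i \<Rightarrow> 'a set"
  assumes "finite I" "\<And>i. i \<in> I \<Longrightarrow> finite (A i)"
    and "\<And>S. S \<subseteq> I \<Longrightarrow> card S \<le> card (\<Union>(A ` S))"
  shows "\<exists>R. inj_on R I \<and> (\<forall>i\<in>I. R i \<in> A i)"
  using assms
proof (induction "card I" arbitrary: I A rule: less_induct)
  case less
  show ?case
  proof (cases "I = {}")
    case True
    then show ?thesis by simp
  next
    case Ine: False
    show ?thesis
    proof (cases "\<exists>S. S \<subset> I \<and> S \<noteq> {} \<and> card (\<Union>(A ` S)) = card S")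
      case True
      then obtain S where S: "S \<subset> I" "S \<noteq> {}" "card (\<Union>(A ` S)) = card S" by blast
      have finS: "finite S" using S(1) less.prems(1) finite_subset by blast
      have finU: "finite (\<Union>(A ` S))" using finS S(1) less.prems(2) by auto
      have "card S < card I" using S(1) less.prems(1) by (simp add: psubset_card_mono)
      then have "\<exists>R. inj_on R S \<and> (\<forall>i\<in>S. R i \<in> A i)"
        using less.prems S(1) finS by (intro less.hyps) auto
      then obtain R1 where R1: "inj_on R1 S" "\<forall>i\<in>S. R1 i \<in> A i" by blast
      define B where "B i = A i - \<Union>(A ` S)" for i
      have "\<exists>R. inj_on R (I - S) \<and> (\<forall>i\<in>I - S. R i \<in> B i)"
      proof (rule less.hyps)
        show "card (I - S) < card I" using S less.prems(1) by (intro psubset_card_mono) auto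
        fix T assume T: "T \<subseteq> I - S"
        have finT: "finite T" using T less.prems(1) finite_subset by blast
        have "card S + card T = card (S \<union> T)" using T finS finT by (subst card_Un_disjoint) auto
        also have "\<dots> \<le> card (\<Union>(A ` (S \<union> T)))" using T S(1) by (intro less.prems(3)) auto
        also have "\<Union>(A ` (S \<union> T)) = \<Union>(A ` S) \<union> \<Union>(B ` T)" by (auto simp: B_def)
        also have "card \<dots> \<le> card (\<Union>(A ` S)) + card (\<Union>(B ` T))" by (rule card_Un_le)
        finally show "card T \<le> card (\<Union>(B ` T))" using S(3) by simp
      qed (use less.prems in \<open>auto simp: B_def\<close>)
      then obtain R2 where R2: "inj_on R2 (I - S)" "\<forall>i\<in>I - S. R2 i \<in> B i" by blast
      define R where "R i = (if i \<in> S then R1 i else R2 i)" for i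
      have "inj_on R I"
      proof (rule inj_onI)
        fix i j assume ij: "i \<in> I" "j \<in> I" "R i = R j"
        have ne: "R1 x \<noteq> R2 y" if "x \<in> S" "y \<in> I - S" for x y using R1 R2 that by (fastforce simp: B_def)
        then show "i = j" using ij R1(1) R2(1) by (auto simp: R_def inj_on_def split: if_splits) (metis DiffI ne)+
      qed
      moreover have "\<forall>i\<in>I. R i \<in> A i" using R1 R2 by (auto simp: R_def B_def)
      ultimately show ?thesis by blast
    next
      case False
      obtain i where i: "i \<in> I" using Ine by blast
      have "card {i} \<le> card (\<Union>(A ` {i}))" using i by (intro less.prems(3)) auto
      then have "A i \<noteq> {}" by auto
      then obtain x where x: "x \<in> A i" by blast
      define B where "B j = A j - {x}" for j
      have "\<exists>R. inj_on R (I - {i}) \<and> (\<forall>j\<in>I - {i}. R j \<in> B j)"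
      proof (rule less.hyps)
        show "card (I - {i}) < card I" using i less.prems(1) by (meson card_Diff1_less)
        fix T assume T: "T \<subseteq> I - {i}"
        show "card T \<le> card (\<Union>(B ` T))"
        proof (cases "T = {}")
          case False2: False
          have "T \<subset> I" using T i by auto
          then have "card T \<le> card (\<Union>(A ` T))" "card (\<Union>(A ` T)) \<noteq> card T"
            using less.prems(3)[of T] False False2 by auto
          moreover have "\<Union>(B ` T) = \<Union>(A ` T) - {x}" by (auto simp: B_def)
          ultimately show ?thesis using card_Diff_singleton_if[of "\<Union>(A ` T)" x] by auto
        qed simp
      qed (use less.prems in \<open>auto simp: B_def\<close>)
      then obtain R where R: "inj_on R (I - {i})" "\<forall>j\<in>I - {i}. R j \<in> B j" by blast
      have "inj_on (R(i := x)) I"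
        using R by (auto simp: inj_on_def B_def)
      moreover have "\<forall>j\<in>I. (R(i := x)) j \<in> A j" using R(2) x by (auto simp: B_def)
      ultimately show ?thesis by blast
    qed
  qed
qed

text \<open>Each index is duplicated, so Hall's condition for the doubled system asks for
  \<open>2 * card S\<close>, and the two representatives of an index form its pair.\<close>

lemma disjoint_pairs_of_representatives:
  fixes D :: "nat \<Rightarrow> 'a set"
  assumes "\<And>i. i < m \<Longrightarrow> finite (D i)"
    and hall: "\<And>S. S \<subseteq> {..<m} \<Longrightarrow> 2 * card S \<le> card (\<Union>(D ` S))"
  shows "\<exists>P. (\<forall>i<m. P i \<subseteq> D i \<and> card (P i) = 2) \<and> (\<forall>i<m. \<forall>j<m. i \<noteq> j \<longrightarrow> P i \<inter> P j = {})"
proof -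
  define I where "I = {..<m} \<times> (UNIV :: bool set)"
  have "\<exists>R. inj_on R I \<and> (\<forall>i\<in>I. R i \<in> D (fst i))"
  proof (rule hall_marriage)
    fix S assume S: "S \<subseteq> I"
    have "S \<subseteq> fst ` S \<times> UNIV" by force
    moreover have fin: "finite (fst ` S)" using S finite_subset[of S I] by (auto simp: I_def)
    ultimately have "card S \<le> card (fst ` S \<times> (UNIV :: bool set))" by (intro card_mono) auto
    also have "\<dots> = 2 * card (fst ` S)" using fin by (simp add: card_cartesian_product)
    also have "\<dots> \<le> card (\<Union>(D ` (fst ` S)))" using S by (intro hall) (auto simp: I_def)
    finally show "card S \<le> card (\<Union>((\<lambda>i. D (fst i)) ` S))" by (simp add: image_image)
  qed (use assms in \<open>auto simp: I_def\<close>)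
  then obtain R where R: "inj_on R I" "\<forall>i\<in>I. R i \<in> D (fst i)" by blast
  define P where "P i = {R (i, True), R (i, False)}" for i
  have R': "R (i, x) = R (j, y) \<longleftrightarrow> i = j \<and> x = y" if "i < m" "j < m" for i j x y
    using inj_on_eq_iff[OF R(1), of "(i, x)" "(j, y)"] that by (auto simp: I_def)
  have "P i \<subseteq> D i \<and> card (P i) = 2" if "i < m" for i
    using R(2) R'[of i i] that by (auto simp: P_def I_def card_insert_if)
  moreover have "P i \<inter> P j = {}" if "i < m" "j < m" "i \<noteq> j" for i j
    using R' that by (auto simp: P_def)
  ultimately show ?thesis by blast
qed

section \<open>Edge counts in a cycle\<close>

text \<open>A cycle is identified with its edge set; its vertices are recovered as the union.
  Distinct cycles may thus share a vertex set.\<close>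

definition cycle_edges :: "nat \<Rightarrow> 'a set set \<Rightarrow> bool" where
  "cycle_edges k A \<longleftrightarrow> is_cycle_graph k (\<Union>A) A"

lemma cycle_edges_facts:
  assumes "cycle_edges k A"
  shows "finite A" "finite (\<Union>A)" "card (\<Union>A) = k" "card A = k" "3 \<le> k" "\<And>e. e \<in> A \<Longrightarrow> card e = 2"
proof -
  from assms obtain g where k: "k \<ge> 3" and g: "bij_betw g {0..<k} (\<Union>A)"
    and A: "A = {{g i, g ((i + 1) mod k)} | i. i < k}"
    by (auto simp: cycle_edges_def is_cycle_graph_def)
  show "3 \<le> k" by fact
  have inj: "g i = g j \<longleftrightarrow> i = j" if "i < k" "j < k" for i j
    using g that by (auto simp: bij_betw_def inj_on_eq_iff)
  have ne: "(i + 1) mod k \<noteq> i" "(i + 1) mod k < k" if "i < k" for i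
    using that k by (auto simp: mod_Suc)
  show "finite (\<Union>A)" using g bij_betw_finite by blast
  show "card (\<Union>A) = k" using bij_betw_same_card[OF g] by simp
  have A': "A = (\<lambda>i. {g i, g ((i + 1) mod k)}) ` {0..<k}" using A by auto
  then show "finite A" by simp
  \<comment> \<open>Two indices can share an edge only by being successors of each other, which
    \<open>k \<ge> 3\<close> excludes.\<close>
  have "inj_on (\<lambda>i. {g i, g ((i + 1) mod k)}) {0..<k}"
  proof (rule inj_onI)
    fix i j assume ij: "i \<in> {0..<k}" "j \<in> {0..<k}" "{g i, g ((i + 1) mod k)} = {g j, g ((j + 1) mod k)}"
    then have "i = j \<or> (i = (j + 1) mod k \<and> (i + 1) mod k = j)"
      using inj ne by (auto simp: doubleton_eq_iff)
    then show "i = j" using ij k by (auto simp: mod_Suc split: if_splits)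
  qed
  then show "card A = k" unfolding A' by (simp add: card_image)
  fix e assume "e \<in> A"
  then obtain i where "i < k" "e = {g i, g ((i + 1) mod k)}" using A by auto
  then show "card e = 2" using inj[of i "(i + 1) mod k"] ne[of i] by (auto simp: card_insert_if)
qed

text \<open>Orienting the cycle, each vertex of \<open>S\<close> owns its outgoing edge; going
  around, \<open>S\<close> is entered somewhere from outside, and the entering edge is one
  more.\<close>

lemma cycle_incident_edges:
  assumes "cycle_edges k A" "S \<subseteq> \<Union>A" "S \<noteq> {}" "S \<noteq> \<Union>A"
  shows "card S + 1 \<le> card {e \<in> A. e \<inter> S \<noteq> {}}"
proof -
  from assms(1) obtain g where k: "k \<ge> 3" and g: "bij_betw g {0..<k} (\<Union>A)"
    and A: "A = {{g i, g ((i + 1) mod k)} | i. i < k}"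
    by (auto simp: cycle_edges_def is_cycle_graph_def)
  note facts = cycle_edges_facts[OF assms(1)]
  have inj: "g i = g j \<longleftrightarrow> i = j" if "i < k" "j < k" for i j
    using g that by (auto simp: bij_betw_def inj_on_eq_iff)
  have ne: "(i + 1) mod k \<noteq> i" "(i + 1) mod k < k" if "i < k" for i
    using that k by (auto simp: mod_Suc)
  define f where "f i = {g i, g ((i + 1) mod k)}" for i
  have fA: "A = f ` {0..<k}" using A by (auto simp: f_def)
  then have "inj_on f {0..<k}" using facts(4) by (intro eq_card_imp_inj_on) auto
  define T where "T = {i. i < k \<and> g i \<in> S}"
  have "S = g ` T"
    using g assms(2) by (auto simp: T_def bij_betw_def image_iff) (metis (no_types, lifting) assms(2) atLeastLessThan_iff imageE subsetD)
  moreover have "inj_on g T" using inj by (auto simp: inj_on_def T_def)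
  ultimately have cT: "card S = card T" by (simp add: card_image)
  have Tne: "T \<noteq> {}" using \<open>S = g ` T\<close> assms(3) by auto
  have "\<exists>i<k. i \<notin> T"
  proof (rule ccontr)
    assume "\<not> ?thesis"
    then have "T = {0..<k}" by (auto simp: T_def)
    then show False using \<open>S = g ` T\<close> g assms(4) by (auto simp: bij_betw_def)
  qed
  have "\<exists>i<k. i \<notin> T \<and> (i + 1) mod k \<in> T"
  proof (rule ccontr)
    assume no: "\<not> ?thesis"
    obtain i where i: "i < k" "i \<notin> T" using \<open>\<exists>i<k. i \<notin> T\<close> by blast
    \<comment> \<open>If \<open>T\<close> is never entered from outside, a walk starting outside
      stays outside for the whole turn.\<close>
    have "(i + j) mod k \<notin> T" for j
    proof (induction j)
      case (Suc j)
      have "((i + j) mod k + 1) mod k = (i + Suc j) mod k" by (simp add: mod_Suc_eq)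
      then show ?case using Suc no k by (metis bot_nat_0.not_eq_extremum mod_less_divisor not_numeral_le_zero)
    qed (use i in auto)
    moreover obtain t where t: "t \<in> T" using Tne by blast
    moreover have "t < k" using t by (auto simp: T_def)
    then have "(i + (k + t - i)) mod k = t" using i by simp
    ultimately show False by metis
  qed
  then obtain i where i: "i < k" "i \<notin> T" "(i + 1) mod k \<in> T" by blast
  have "f ` (insert i T) \<subseteq> {e \<in> A. e \<inter> S \<noteq> {}}"
    using i ne unfolding fA by (auto simp: f_def T_def)
  then have "card (f ` (insert i T)) \<le> card {e \<in> A. e \<inter> S \<noteq> {}}" using facts(1) by (intro card_mono) auto
  moreover have "insert i T \<subseteq> {0..<k}" using i by (auto simp: T_def)
  then have "card (f ` (insert i T)) = card (insert i T)"
    using \<open>inj_on f {0..<k}\<close> by (intro card_image) (rule inj_on_subset)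
  moreover have "card (insert i T) = card T + 1" using i by (simp add: T_def)
  ultimately show ?thesis using cT by simp
qed

lemma cycle_degree:
  assumes "cycle_edges k A"
  shows "card {e \<in> A. v \<in> e} \<le> 2"
proof (cases "v \<in> \<Union>A")
  case True
  from assms obtain g where k: "k \<ge> 3" and g: "bij_betw g {0..<k} (\<Union>A)"
    and A: "A = {{g i, g ((i + 1) mod k)} | i. i < k}"
    by (auto simp: cycle_edges_def is_cycle_graph_def)
  have inj: "g i = g j \<longleftrightarrow> i = j" if "i < k" "j < k" for i j
    using g that by (auto simp: bij_betw_def inj_on_eq_iff)
  have "v \<in> g ` {0..<k}" using True g by (simp add: bij_betw_def)
  then obtain j where j: "j < k" "v = g j" by auto
  define f where "f i = {g i, g ((i + 1) mod k)}" for i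
  have "{e \<in> A. v \<in> e} \<subseteq> {f j, f ((j + k - 1) mod k)}"
  proof
    fix e assume "e \<in> {e \<in> A. v \<in> e}"
    then obtain i where i: "i < k" "e = f i" "v \<in> f i" using A by (auto simp: f_def)
    have "(i + 1) mod k < k" using k by simp
    then have "j = i \<or> j = (i + 1) mod k" using i j inj[of j i] inj[of j "(i + 1) mod k"] by (auto simp: f_def)
    moreover have "(j + k - 1) mod k = i" if "j = (i + 1) mod k"
    proof (cases "i + 1 = k")
      case True
      then show ?thesis using that k by simp
    next
      case False
      then have "j = i + 1" using that i(1) by simp
      then show ?thesis using i(1) by simp
    qed
    ultimately have "i = j \<or> i = (j + k - 1) mod k" by metis
    then show "e \<in> {f j, f ((j + k - 1) mod k)}" using i by auto
  qed
  then have "card {e \<in> A. v \<in> e} \<le> card {f j, f ((j + k - 1) mod k)}" by (intro card_mono) auto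
  also have "\<dots> \<le> 2" by (simp add: card_insert_if)
  finally show ?thesis .
next
  case False
  then have none: "{e \<in> A. v \<in> e} = {}" by auto
  show ?thesis unfolding none by simp
qed

text \<open>This is the count of incident edges applied to the complement of \<open>S\<close>: a
  proper part of a cycle spans a forest.\<close>

lemma cycle_inner_edges:
  assumes "cycle_edges k A" "S \<subseteq> \<Union>A" "S \<noteq> {}" "S \<noteq> \<Union>A"
  shows "card {e \<in> A. e \<subseteq> S} + 1 \<le> card S"
proof -
  note facts = cycle_edges_facts[OF assms(1)]
  let ?T = "\<Union>A - S"
  have "card ?T + 1 \<le> card {e \<in> A. e \<inter> ?T \<noteq> {}}"
    using assms by (intro cycle_incident_edges) auto
  moreover have "{e \<in> A. e \<inter> ?T \<noteq> {}} = A - {e \<in> A. e \<subseteq> S}" by blast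
  moreover have "card (A - {e \<in> A. e \<subseteq> S}) = k - card {e \<in> A. e \<subseteq> S}"
    using facts by (subst card_Diff_subset) auto
  moreover have "card {e \<in> A. e \<subseteq> S} \<le> card A" using facts by (intro card_mono) auto
  moreover have "finite S" using assms(2) facts finite_subset by blast
  then have "card ?T = k - card S" using assms(2) facts by (subst card_Diff_subset) auto
  moreover have "card S \<le> k" using assms(2) facts by (metis card_mono)
  ultimately have "k - card S + 1 \<le> k - card {e \<in> A. e \<subseteq> S}" "card {e \<in> A. e \<subseteq> S} \<le> k" "card S \<le> k"
    using facts(4) by simp_all
  then show ?thesis by linarith
qed

text \<open>Here \<open>c\<close> is the amount by which \<open>phi\<close> drops when the cycle \<open>A\<close> is added to \<open>F\<close>.  Except when
  \<open>c = k\<close>, the new part of \<open>A\<close> is a single path, and a new cycle must traverse all of it.\<close>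

lemma cycle_step:
  fixes F A :: "'a set set"
  assumes A: "cycle_edges k A" and k: "4 \<le> k" and F: "finite F" "\<And>e. e \<in> F \<Longrightarrow> card e = 2"
    and new: "\<not> A \<subseteq> F" and meet: "\<Union>A \<inter> \<Union>F \<noteq> {}"
    and c: "c = (int k - 1) * int (card (A - F)) - int k * int (card (\<Union>A - \<Union>F))" "c \<le> int k"
  shows "0 \<le> c \<and> (\<exists>D. D \<subseteq> \<Union>A \<and> 2 \<le> card D \<and> int k - 1 - c \<le> int (card (D - \<Union>F)) \<and>
     int k - c \<le> int (card D) \<and> (0 < c \<and> c < int k \<longrightarrow> int k + 1 - c \<le> int (card D)) \<and>
     (\<forall>B. cycle_edges k B \<and> B \<subseteq> F \<union> A \<and> \<not> B \<subseteq> F \<longrightarrow> D \<subseteq> \<Union>B))"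
proof -
  note facts = cycle_edges_facts[OF A]
  define N where "N = \<Union>A - \<Union>F"
  define J where "J = \<Union>A \<inter> \<Union>F"
  define a where "a = card N"
  define I where "I = {e \<in> A. e \<inter> N \<noteq> {}}"
  have finN: "finite N" "finite J" using facts by (auto simp: N_def J_def)
  have NJ: "\<Union>A = N \<union> J" "N \<inter> J = {}" by (auto simp: N_def J_def)
  have "card (N \<union> J) = card N + card J" using finN NJ(2) by (rule card_Un_disjoint)
  then have kaj: "k = a + card J" using NJ(1) facts(3) by (simp add: a_def)
  have "J \<noteq> {}" using meet by (simp add: J_def)
  then have j1: "1 \<le> card J" using finN by (simp add: Suc_leI card_gt_0_iff)
  have Nne: "N \<noteq> \<Union>A" using \<open>J \<noteq> {}\<close> NJ by auto
  have IF: "I \<subseteq> A - F" by (auto simp: I_def N_def)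
  have finAF: "finite (A - F)" using facts by auto
  have IcardN: "a + 1 \<le> card I" if "N \<noteq> {}"
    using cycle_incident_edges[OF A, of N] that Nne NJ by (auto simp: I_def a_def)
  have eA: "a + 1 \<le> card (A - F)"
  proof (cases "N = {}")
    case True
    then show ?thesis using new finAF by (auto simp: a_def Suc_le_eq card_gt_0_iff)
  next
    case False
    then show ?thesis using IcardN card_mono[OF finAF IF] by linarith
  qed
  have c': "c = (int k - 1) * int (card (A - F)) - int k * int a" using c by (simp add: a_def N_def)
  have clo: "(int k - 1) * int m - int k * int a \<le> c" if "m \<le> card (A - F)" for m
    unfolding c' using that k by (auto intro!: mult_left_mono)
  have c1: "int k - 1 - int a \<le> c" using clo[OF eA] by (simp add: algebra_simps)
  have c0: "0 \<le> c" using c1 kaj j1 by linarith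
  \<comment> \<open>At a new vertex only edges of \<open>A\<close> are available, at most two of
    them, and a cycle needs two; so any cycle through it takes all edges of \<open>A\<close>
    there.\<close>
  have nbr: "e \<subseteq> \<Union>B" if B: "cycle_edges k B" "B \<subseteq> F \<union> A" and v: "v \<in> N" "v \<in> \<Union>B" and e: "e \<in> A" "v \<in> e" for B v e
  proof -
    have "\<Union>B \<noteq> {v}" using cycle_edges_facts(3)[OF B(1)] k by auto
    then have "card {v} + 1 \<le> card {e \<in> B. e \<inter> {v} \<noteq> {}}"
      using v by (intro cycle_incident_edges[OF B(1)]) auto
    moreover have sub: "{e \<in> B. e \<inter> {v} \<noteq> {}} \<subseteq> {e \<in> A. v \<in> e}" using B(2) v by (auto simp: N_def)
    moreover note cycle_degree[OF A, of v]
    moreover have "card {e \<in> B. e \<inter> {v} \<noteq> {}} \<le> card {e \<in> A. v \<in> e}"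
      using sub facts(1) by (intro card_mono) auto
    ultimately have "{e \<in> B. e \<inter> {v} \<noteq> {}} = {e \<in> A. v \<in> e}"
      using facts(1) by (intro card_subset_eq) auto
    then show ?thesis using e by auto
  qed
  show ?thesis
  \<comment> \<open>At least \<open>a + 2\<close> new edges cost at least
    \<open>2 k - 2 - a\<close>, which the bound \<open>c \<le> k\<close> admits only for
    \<open>a = k - 2\<close>. Then \<open>c = k\<close>, and the two old vertices of
    \<open>A\<close> serve as \<open>D\<close>.\<close>
  proof (cases "a + 2 \<le> card (A - F)")
    case True
    have "2 * int k - 2 - int a \<le> c" using clo[OF True] by (simp add: algebra_simps)
    then have ak: "k \<le> a + 2" using c(2) by linarith
    have "card (A - F) \<le> k" using card_mono[of A "A - F"] facts by auto
    then have a: "a + 2 = k" using ak True by linarith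
    then have J2: "card J = 2" using kaj by simp
    have ck: "c = int k" using \<open>2 * int k - 2 - int a \<le> c\<close> a c(2) by linarith
    have "J \<subseteq> \<Union>B" if B: "cycle_edges k B" "B \<subseteq> F \<union> A" "\<not> B \<subseteq> F" for B
    proof (cases "N \<inter> \<Union>B = {}")
      case True
      obtain e where e: "e \<in> B" "e \<in> A" using B by blast
      then have "e \<subseteq> J" using True NJ by auto
      then have "e = J" using facts(6)[OF e(2)] J2 finN by (intro card_subset_eq) auto
      then show ?thesis using e by auto
    next
      case False
      define N' where "N' = N \<inter> \<Union>B"
      define S where "S = \<Union>A \<inter> \<Union>B"
      show ?thesis
      proof (cases "S = \<Union>A")
        case True
        then show ?thesis by (auto simp: S_def J_def)
      next
        case SA: False
        have N': "N' \<noteq> {}" "N' \<subseteq> \<Union>A" "N' \<noteq> \<Union>A" using False Nne by (auto simp: N'_def N_def)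
        \<comment> \<open>All edges of \<open>A\<close> at \<open>N'\<close> lie in
          \<open>S\<close>, and a proper part of a cycle has fewer edges than vertices; so
          \<open>S\<close> exceeds \<open>N'\<close> by at least two, which must be both old
          vertices.\<close>
        have "card N' + 1 \<le> card {e \<in> A. e \<inter> N' \<noteq> {}}"
          using cycle_incident_edges[OF A N'(2,1,3)] .
        also have "{e \<in> A. e \<inter> N' \<noteq> {}} \<subseteq> {e \<in> A. e \<subseteq> S}"
          using nbr[OF B(1,2)] by (auto simp: N'_def S_def)
        then have "card {e \<in> A. e \<inter> N' \<noteq> {}} \<le> card {e \<in> A. e \<subseteq> S}"
          using facts(1) by (intro card_mono) auto
        finally have "card N' + 1 \<le> card {e \<in> A. e \<subseteq> S}" .
        moreover have "S \<subseteq> \<Union>A" "S \<noteq> {}" using N'(1,2) by (auto simp: S_def N'_def)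
        then have "card {e \<in> A. e \<subseteq> S} + 1 \<le> card S" using SA by (intro cycle_inner_edges[OF A])
        ultimately have "card N' + 2 \<le> card S" by linarith
        moreover have "S = N' \<union> (J \<inter> \<Union>B)" by (auto simp: S_def N'_def J_def N_def)
        then have "card S \<le> card N' + card (J \<inter> \<Union>B)" using card_Un_le by metis
        ultimately have "card J \<le> card (J \<inter> \<Union>B)" using J2 by linarith
        then have "J \<inter> \<Union>B = J" using finN by (intro card_seteq) auto
        then show ?thesis by auto
      qed
    qed
    then show ?thesis using c0 J2 ck by (intro conjI exI[of _ J]) (auto simp: J_def)
  next
    case False
    then have AF: "card (A - F) = a + 1" using eA by linarith
    have ca: "c = int k - 1 - int a" unfolding c' AF by (simp add: algebra_simps)
    show ?thesis
    proof (cases "N = {}")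
      case True
      then have "a = 0" by (simp add: a_def)
      then obtain e where e: "A - F = {e}" using AF by (auto simp: card_1_singleton_iff)
      then have "e \<in> A" by auto
      have "e \<subseteq> \<Union>B" if "B \<subseteq> F \<union> A" "\<not> B \<subseteq> F" for B using that e by auto
      then show ?thesis using c0 ca \<open>a = 0\<close> \<open>e \<in> A\<close> facts(6)[of e]
        by (intro conjI exI[of _ e]) auto
    next
      case Ne: False
      have IAF: "I = A - F" using IF finAF IcardN[OF Ne] AF card_mono[OF finAF IF] by (intro card_subset_eq) auto
      \<comment> \<open>The new path together with its end vertices: \<open>a + 2\<close> vertices,
        or all \<open>k\<close> when both ends are the same old vertex.\<close>
      define D where "D = \<Union>I"
      have DA: "D \<subseteq> \<Union>A" by (auto simp: D_def I_def)
      then have finD: "finite D" using facts finite_subset by blast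
      have ND: "N \<subseteq> D" by (auto simp: D_def I_def N_def)
      then have "N \<subseteq> D - \<Union>F" by (auto simp: N_def)
      then have aD: "a \<le> card (D - \<Union>F)" unfolding a_def using finD by (intro card_mono) auto
      have a1: "1 \<le> a" using Ne finN by (simp add: a_def Suc_leI card_gt_0_iff)
      have Dcard: "k \<le> card D \<or> a + 2 \<le> card D"
      proof (cases "D = \<Union>A")
        case False
        have T: "\<Union>A - D \<noteq> {}" "\<Union>A - D \<subseteq> \<Union>A" "\<Union>A - D \<noteq> \<Union>A" using False DA ND Ne by auto
        have "card (\<Union>A - D) + 1 \<le> card {e \<in> A. e \<inter> (\<Union>A - D) \<noteq> {}}"
          using cycle_incident_edges[OF A T(2,1,3)] .
        moreover have "I \<inter> {e \<in> A. e \<inter> (\<Union>A - D) \<noteq> {}} = {}" by (auto simp: D_def)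
        then have "card I + card {e \<in> A. e \<inter> (\<Union>A - D) \<noteq> {}} = card (I \<union> {e \<in> A. e \<inter> (\<Union>A - D) \<noteq> {}})"
          using facts(1) by (subst card_Un_disjoint) (auto simp: I_def)
        moreover have "\<dots> \<le> card A" using facts(1) by (intro card_mono) (auto simp: I_def)
        moreover have "card (\<Union>A - D) = k - card D" using facts DA finD by (subst card_Diff_subset) auto
        moreover have "card I = a + 1" using IAF AF by simp
        ultimately have "a + 2 \<le> card D" using facts(4) by linarith
        then show ?thesis by simp
      qed (use facts in simp)
      have kD: "int k - c \<le> int (card D)" "0 < c \<longrightarrow> int k + 1 - c \<le> int (card D)" "2 \<le> card D"
      proof -
        show "int k - c \<le> int (card D)" "2 \<le> card D" using Dcard ca c0 a1 k by linarith+
        show "0 < c \<longrightarrow> int k + 1 - c \<le> int (card D)" using Dcard ca by linarith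
      qed
      have new': "D \<subseteq> \<Union>B" if B: "cycle_edges k B" "B \<subseteq> F \<union> A" "\<not> B \<subseteq> F" for B
      proof -
        obtain e0 where "e0 \<in> B" "e0 \<in> I" using B IAF by auto
        then have N'ne: "N \<inter> \<Union>B \<noteq> {}" by (auto simp: I_def)
        \<comment> \<open>Otherwise the traversed and the avoided new vertices would have disjoint
          sets of incident edges, at least \<open>a + 2\<close> in total, against only
          \<open>a + 1\<close> new edges.\<close>
        have "N \<subseteq> \<Union>B"
        proof (rule ccontr)
          assume "\<not> N \<subseteq> \<Union>B"
          then have N''ne: "N - \<Union>B \<noteq> {}" by auto
          have "card (N \<inter> \<Union>B) + 1 \<le> card {e \<in> A. e \<inter> (N \<inter> \<Union>B) \<noteq> {}}"
            using N'ne Nne NJ by (intro cycle_incident_edges[OF A]) auto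
          moreover have "card (N - \<Union>B) + 1 \<le> card {e \<in> A. e \<inter> (N - \<Union>B) \<noteq> {}}"
            using N''ne Nne NJ by (intro cycle_incident_edges[OF A]) auto
          moreover have "{e \<in> A. e \<inter> (N \<inter> \<Union>B) \<noteq> {}} \<inter> {e \<in> A. e \<inter> (N - \<Union>B) \<noteq> {}} = {}"
            using nbr[OF B(1,2)] by blast
          then have "card {e \<in> A. e \<inter> (N \<inter> \<Union>B) \<noteq> {}} + card {e \<in> A. e \<inter> (N - \<Union>B) \<noteq> {}} =
            card ({e \<in> A. e \<inter> (N \<inter> \<Union>B) \<noteq> {}} \<union> {e \<in> A. e \<inter> (N - \<Union>B) \<noteq> {}})"
            using facts(1) by (subst card_Un_disjoint) auto
          moreover have "\<dots> \<le> card I" using facts(1) by (intro card_mono) (auto simp: I_def)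
          moreover have "card (N \<inter> \<Union>B) + card (N - \<Union>B) = a"
            unfolding a_def using finN(1) by (rule card_Int_Diff[symmetric])
          moreover have "card I = a + 1" using IAF AF by simp
          ultimately show False by linarith
        qed
        then show ?thesis using nbr[OF B(1,2)] by (auto simp: D_def I_def)
      qed
      show ?thesis using c0 kD new' DA aD ca by (intro conjI exI[of _ D]) auto
    qed
  qed
qed

text \<open>Every cycle seen so far contains one of the sets \<open>D i\<close>, whose costs
  \<open>c i\<close> sum to at most \<open>k\<close>. A small \<open>D i\<close> is paid for by a
  large cost, which is how sparsity turns into Hall's condition for disjoint pairs inside the
  \<open>D i\<close>.\<close>

theorem cycles_coverable:
  fixes \<F> :: "'a set set set"
  assumes finite_family: "finite \<F>" and cycles: "\<And>A. A \<in> \<F> \<Longrightarrow> cycle_edges k A" and k4: "4 \<le> k"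
    and conn: "linked Union \<F>" and ne: "\<F> \<noteq> {}"
    and sparse: "\<And>\<G>. \<G> \<subseteq> \<F> \<Longrightarrow> \<G> \<noteq> {} \<Longrightarrow> linked Union \<G> \<Longrightarrow> (k - 1) * card (\<Union>\<G>) \<le> k * card (\<Union>(\<Union>\<G>))"
  shows "coverable 2 (Union ` \<F>)"
proof -
  define inn where "inn F = {A \<in> \<F>. A \<subseteq> F}" for F
  define phi where "phi F = int k * int (card (\<Union>F)) - (int k - 1) * int (card F)" for F :: "'a set set"
  define good where "good F \<longleftrightarrow> F = \<Union>(inn F) \<and> inn F \<noteq> {} \<and> linked Union (inn F)" for F
  \<comment> \<open>In the lower bound for unions every set contributes \<open>k - 1 - c i\<close>
    fresh vertices, and the earliest one more. For two sets and \<open>k = 4\<close> this may yield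
    only 3, so the bound 4 for pairs is carried along separately.\<close>
  define St where "St F m D c \<longleftrightarrow> good F \<and>
    (\<forall>i<m. 0 \<le> c i \<and> finite (D i) \<and> D i \<subseteq> \<Union>F \<and> 2 \<le> card (D i) \<and> int k - c i \<le> int (card (D i)) \<and>
        (0 < c i \<and> c i < int k \<longrightarrow> int k + 1 - c i \<le> int (card (D i)))) \<and>
    (\<Sum>i<m. c i) = int k - phi F \<and>
    (\<forall>S. S \<subseteq> {..<m} \<and> S \<noteq> {} \<longrightarrow> 1 + (int k - 1) * int (card S) - (\<Sum>i\<in>S. c i) \<le> int (card (\<Union>(D ` S)))) \<and>
    (\<forall>i<m. \<forall>j<m. i \<noteq> j \<longrightarrow> 4 \<le> card (D i \<union> D j)) \<and>
    (\<forall>A\<in>inn F. \<exists>i<m. D i \<subseteq> \<Union>A)"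
    for F m and D :: "nat \<Rightarrow> 'a set" and c :: "nat \<Rightarrow> int"
  note facts = cycle_edges_facts[OF cycles]
  have fin_inn: "finite (inn F)" for F using finite_family by (simp add: inn_def)
  have inn_facts: "finite F \<and> finite (\<Union>F) \<and> (\<forall>e\<in>F. card e = 2) \<and> 0 \<le> phi F" if "good F" for F
  proof -
    have F: "F = \<Union>(inn F)" "inn F \<noteq> {}" "linked Union (inn F)" using that by (auto simp: good_def)
    have "finite F" using F(1) fin_inn[of F] facts(1) by (metis (no_types, lifting) finite_Union inn_def mem_Collect_eq)
    have card2: "\<forall>e\<in>F. card e = 2"
    proof
      fix e assume "e \<in> F"
      then obtain A where "A \<in> inn F" "e \<in> A" using F(1) by auto
      then show "card e = 2" using facts(6) by (auto simp: inn_def)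
    qed
    then have "finite e" if "e \<in> F" for e using that card.infinite by force
    then have "finite (\<Union>F)" using \<open>finite F\<close> by auto
    have "(k - 1) * card (\<Union>(inn F)) \<le> k * card (\<Union>(\<Union>(inn F)))"
      using F by (intro sparse) (auto simp: inn_def)
    then have "(k - 1) * card F \<le> k * card (\<Union>F)" using F(1) by simp
    then have "int ((k - 1) * card F) \<le> int (k * card (\<Union>F))" by (rule of_nat_mono)
    then have "0 \<le> phi F" using k4 by (simp add: phi_def of_nat_diff)
    then show ?thesis using \<open>finite F\<close> \<open>finite (\<Union>F)\<close> card2 by auto
  qed
  obtain A0 where A0: "A0 \<in> \<F>" using ne by auto
  have inn0: "inn A0 = {A0}"
  proof -
    have "A = A0" if "A \<in> \<F>" "A \<subseteq> A0" for A
      using that facts(1,4) A0 by (intro card_subset_eq) auto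
    then show ?thesis using A0 by (auto simp: inn_def)
  qed
  have "St A0 1 (\<lambda>_. \<Union>A0) (\<lambda>_. 0)"
  proof -
    have "card S = 1" if "S \<subseteq> {..<1::nat}" "S \<noteq> {}" for S
    proof -
      have "S = {0}" using that by auto
      then show ?thesis by simp
    qed
    moreover have "\<Union>((\<lambda>_. \<Union>A0) ` S) = \<Union>A0" if "S \<noteq> {}" for S :: "nat set" using that by auto
    moreover have "phi A0 = int k" using facts[OF A0] by (simp add: phi_def algebra_simps)
    moreover have "good A0" by (auto simp: good_def inn0 linked_singleton)
    ultimately show ?thesis using facts[OF A0] k4 inn0 by (auto simp: St_def)
  qed
  moreover have step: "\<exists>F' D' c'. F \<subset> F' \<and> St F' (Suc m) D' c'" if St: "St F m D c" and nF: "\<not> \<Union>\<F> \<subseteq> F" for F m D c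
  proof -
    have gF: "good F" using St by (simp add: St_def)
    then have F: "F = \<Union>(inn F)" "inn F \<noteq> {}" "linked Union (inn F)" by (auto simp: good_def)
    note iF = inn_facts[OF gF]
    have "inn F \<subset> \<F>" using nF F(1) by (auto simp: inn_def)
    then have "\<exists>A\<in>\<F> - inn F. \<Union>A \<inter> \<Union>(Union ` inn F) \<noteq> {}"
      using conn F(2) unfolding linked_def by meson
    moreover have "\<Union>(Union ` inn F) = \<Union>F"
    proof -
      have "\<Union>(Union ` inn F) = \<Union>(\<Union>(inn F))" by auto
      then show ?thesis using F(1) by simp
    qed
    ultimately obtain A where A: "A \<in> \<F>" "\<not> A \<subseteq> F" "\<Union>A \<inter> \<Union>F \<noteq> {}" by (auto simp: inn_def)
    note fA = facts[OF A(1)]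
    define F' where "F' = F \<union> A"
    have sub: "F \<subset> F'" using A(2) by (auto simp: F'_def)
    have gF': "good F'"
    proof -
      have "inn F \<subseteq> inn F'" "A \<in> inn F'" using A by (auto simp: inn_def F'_def)
      then have "F' \<subseteq> \<Union>(inn F')" using F(1) unfolding F'_def by blast
      then have 1: "F' = \<Union>(inn F')" by (auto simp: inn_def)
      have l: "linked Union (insert A (inn F))"
        using linked_insert[OF F(3), of A] A(3) \<open>\<Union>(Union ` inn F) = \<Union>F\<close> by simp
      have "linked Union (insert A (inn F) \<union> inn F')"
      proof (rule linked_Un_meeting[OF l fin_inn])
        fix B assume "B \<in> inn F'"
        then have B: "B \<in> \<F>" "B \<subseteq> F \<union> A" by (auto simp: inn_def F'_def)
        have "\<Union>(Union ` insert A (inn F)) = \<Union>F \<union> \<Union>A" using \<open>\<Union>(Union ` inn F) = \<Union>F\<close> by auto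
        moreover have "\<Union>B \<subseteq> \<Union>F \<union> \<Union>A" using B(2) by auto
        moreover have "card (\<Union>B) \<noteq> 0" using facts(3)[OF B(1)] k4 by simp
        then have "\<Union>B \<noteq> {}" by (metis card.empty)
        ultimately show "\<Union>B \<inter> \<Union>(Union ` insert A (inn F)) \<noteq> {}" by (metis Int_absorb2)
      qed
      moreover have "insert A (inn F) \<union> inn F' = inn F'" using \<open>inn F \<subseteq> inn F'\<close> \<open>A \<in> inn F'\<close> by auto
      ultimately show ?thesis using 1 \<open>A \<in> inn F'\<close> by (auto simp: good_def)
    qed
    define cm where "cm = phi F - phi F'"
    have cm: "cm = (int k - 1) * int (card (A - F)) - int k * int (card (\<Union>A - \<Union>F))"
    proof -
      have "card F' = card F + card (A - F)" unfolding F'_def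
        using iF fA by (metis Un_Diff_cancel card_Un_disjoint Diff_disjoint finite_Diff)
      moreover have "card (\<Union>F') = card (\<Union>F) + card (\<Union>A - \<Union>F)"
        using iF fA card_Un_disjoint[of "\<Union>F" "\<Union>A - \<Union>F"] by (simp add: F'_def)
      ultimately show ?thesis by (simp add: cm_def phi_def algebra_simps)
    qed
    have c_nonneg: "0 \<le> c i" if "i < m" for i using St that by (simp add: St_def)
    have csum: "(\<Sum>i<m. c i) = int k - phi F" using St by (simp add: St_def)
    have tot: "(\<Sum>i<m. c i) + cm \<le> int k" using csum inn_facts[OF gF'] by (simp add: cm_def)
    have "0 \<le> (\<Sum>i<m. c i)" using c_nonneg by (intro sum_nonneg) auto
    then have cmk: "cm \<le> int k" using tot by linarith
    have ci: "c i + cm \<le> int k" if "i < m" for i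
      using member_le_sum[of i "{..<m}" c] c_nonneg that tot by auto
    from cycle_step[OF cycles[OF A(1)] k4 _ _ A(2,3) cm cmk] iF obtain Dm where
      cm0: "0 \<le> cm" and Dm: "Dm \<subseteq> \<Union>A" "2 \<le> card Dm" "int k - 1 - cm \<le> int (card (Dm - \<Union>F))"
        "int k - cm \<le> int (card Dm)" "0 < cm \<and> cm < int k \<longrightarrow> int k + 1 - cm \<le> int (card Dm)"
      and Dnew: "\<forall>B. cycle_edges k B \<and> B \<subseteq> F \<union> A \<and> \<not> B \<subseteq> F \<longrightarrow> Dm \<subseteq> \<Union>B" by blast
    have finDm: "finite Dm" using Dm(1) fA finite_subset by blast
    define D' where "D' = D(m := Dm)"
    define c' where "c' = c(m := cm)"
    have D_i: "finite (D i)" "D i \<subseteq> \<Union>F" "2 \<le> card (D i)" "int k - c i \<le> int (card (D i))"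
      "0 < c i \<and> c i < int k \<longrightarrow> int k + 1 - c i \<le> int (card (D i))" if "i < m" for i
      using St that by (auto simp: St_def)
    have grow: "card X + card (Dm - \<Union>F) \<le> card (X \<union> Dm)" if "X \<subseteq> \<Union>F" for X
    proof -
      have fX: "finite X" using that iF finite_subset by blast
      have "card X + card (Dm - \<Union>F) = card (X \<union> (Dm - \<Union>F))"
        using that fX finDm by (subst card_Un_disjoint) auto
      also have "\<dots> \<le> card (X \<union> Dm)" using fX finDm by (intro card_mono) auto
      finally show ?thesis .
    qed
    \<comment> \<open>If \<open>cm = 0\<close>, the new set brings \<open>k - 1\<close> fresh
      vertices to the at least 2 of \<open>D i\<close>; if \<open>c i = 0\<close>,
      \<open>D i\<close> alone has \<open>k\<close>; otherwise the strict bound for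
      \<open>D i\<close> gives at least \<open>2 k - c i - cm \<ge> k\<close>.\<close>
    have four: "4 \<le> card (D i \<union> Dm)" if i: "i < m" for i
    proof -
      have g: "int (card (D i)) + int (card (Dm - \<Union>F)) \<le> int (card (D i \<union> Dm))"
        using grow[OF D_i(2)[OF i]] by linarith
      note d = D_i(3-5)[OF i] c_nonneg[OF i] ci[OF i] cm0 Dm(3) k4 g
      consider "cm = 0" | "c i = 0" | "0 < cm" "0 < c i" "c i < int k" using cm0 c_nonneg[OF i] ci[OF i] by linarith
      then have "4 \<le> int (card (D i \<union> Dm))"
      proof cases
        case 3
        then have "int k + 1 - c i \<le> int (card (D i))" using d by blast
        then show ?thesis using d(4-) by linarith
      qed (use d in linarith)+
      then show ?thesis by simp
    qed
    have hall: "1 + (int k - 1) * int (card S) - (\<Sum>i\<in>S. c' i) \<le> int (card (\<Union>(D' ` S)))"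
      if S: "S \<subseteq> {..<Suc m}" "S \<noteq> {}" for S
    proof (cases "m \<in> S")
      case False
      then have S': "S \<subseteq> {..<m}" using S by (auto simp: less_Suc_eq)
      then have "(\<Sum>i\<in>S. c' i) = (\<Sum>i\<in>S. c i)" "D' ` S = D ` S"
        using False by (auto simp: c'_def D'_def intro!: sum.cong)
      then show ?thesis using St S' S(2) by (simp add: St_def)
    next
      case True
      define S' where "S' = S - {m}"
      have S': "S = insert m S'" "m \<notin> S'" "S' \<subseteq> {..<m}" "finite S'"
        using True S finite_subset[OF S(1)] by (auto simp: S'_def less_Suc_eq)
      have eq: "(\<Sum>i\<in>S'. c' i) = (\<Sum>i\<in>S'. c i)" "D' ` S' = D ` S'"
        using S' by (auto simp: c'_def D'_def intro!: sum.cong)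
      have sum: "(\<Sum>i\<in>S. c' i) = cm + (\<Sum>i\<in>S'. c i)" using S' eq by (simp add: c'_def)
      have un: "\<Union>(D' ` S) = \<Union>(D ` S') \<union> Dm" using S'(1) eq(2) by (auto simp: D'_def)
      show ?thesis
      proof (cases "S' = {}")
        case True
        then show ?thesis using sum un S' Dm(4) by simp
      next
        case False
        then have "1 + (int k - 1) * int (card S') - (\<Sum>i\<in>S'. c i) \<le> int (card (\<Union>(D ` S')))"
          using St S' by (simp add: St_def)
        moreover have "int (card (\<Union>(D ` S'))) + int (card (Dm - \<Union>F)) \<le> int (card (\<Union>(D' ` S)))"
        proof -
          have "D i \<subseteq> \<Union>F" if "i \<in> S'" for i using D_i(2)[of i] S'(3) that by auto
          then have "\<Union>(D ` S') \<subseteq> \<Union>F" by (rule UN_least)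
          from grow[OF this] show ?thesis unfolding un by linarith
        qed
        moreover have "(int k - 1) * int (card S) = (int k - 1) * int (card S') + int k - 1"
          using S' by (simp add: algebra_simps)
        ultimately show ?thesis unfolding sum using Dm(3) by linarith
      qed
    qed
    have "St F' (Suc m) D' c'"
      unfolding St_def
    proof (intro conjI gF')
      show "\<forall>i<Suc m. 0 \<le> c' i \<and> finite (D' i) \<and> D' i \<subseteq> \<Union>F' \<and> 2 \<le> card (D' i) \<and> int k - c' i \<le> int (card (D' i)) \<and>
        (0 < c' i \<and> c' i < int k \<longrightarrow> int k + 1 - c' i \<le> int (card (D' i)))"
      proof (intro allI impI)
        fix i assume "i < Suc m"
        show "0 \<le> c' i \<and> finite (D' i) \<and> D' i \<subseteq> \<Union>F' \<and> 2 \<le> card (D' i) \<and> int k - c' i \<le> int (card (D' i)) \<and>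
          (0 < c' i \<and> c' i < int k \<longrightarrow> int k + 1 - c' i \<le> int (card (D' i)))"
        proof (cases "i = m")
          case True
          then show ?thesis using cm0 finDm Dm by (auto simp: c'_def D'_def F'_def)
        next
          case False
          then have "i < m" using \<open>i < Suc m\<close> by simp
          then show ?thesis using D_i[of i] c_nonneg[of i] False by (auto simp: c'_def D'_def F'_def)
        qed
      qed
      show "(\<Sum>i<Suc m. c' i) = int k - phi F'" using csum by (simp add: c'_def cm_def)
      show "\<forall>S. S \<subseteq> {..<Suc m} \<and> S \<noteq> {} \<longrightarrow> 1 + (int k - 1) * int (card S) - (\<Sum>i\<in>S. c' i) \<le> int (card (\<Union>(D' ` S)))"
        using hall by blast
      show "\<forall>i<Suc m. \<forall>j<Suc m. i \<noteq> j \<longrightarrow> 4 \<le> card (D' i \<union> D' j)"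
        using St four by (auto simp: St_def D'_def less_Suc_eq Un_commute)
      show "\<forall>B\<in>inn F'. \<exists>i<Suc m. D' i \<subseteq> \<Union>B"
      proof
        fix B assume B: "B \<in> inn F'"
        show "\<exists>i<Suc m. D' i \<subseteq> \<Union>B"
        proof (cases "B \<subseteq> F")
          case True
          then have "B \<in> inn F" using B by (simp add: inn_def)
          then obtain i where "i < m" "D i \<subseteq> \<Union>B" using St unfolding St_def by blast
          then show ?thesis by (intro exI[of _ i]) (auto simp: D'_def)
        next
          case False
          then have "Dm \<subseteq> \<Union>B" using Dnew B cycles by (auto simp: inn_def F'_def)
          then show ?thesis by (intro exI[of _ m]) (auto simp: D'_def)
        qed
      qed
    qed
    then show ?thesis using sub by blast
  qed
  define Q where "Q = {F. \<exists>m D c. St F m D c}"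
  have "F \<subseteq> \<Union>\<F>" if "F \<in> Q" for F
  proof -
    have "good F" using that unfolding Q_def St_def by blast
    then have "F = \<Union>(inn F)" by (simp add: good_def)
    then show ?thesis by (auto simp: inn_def)
  qed
  then have "Q \<subseteq> Pow (\<Union>\<F>)" by blast
  moreover have "finite (\<Union>\<F>)" using finite_family facts(1) by auto
  ultimately have "finite Q" by (meson finite_Pow_iff finite_subset)
  moreover have "Q \<noteq> {}" using calculation(1) \<open>St A0 1 (\<lambda>_. \<Union>A0) (\<lambda>_. 0)\<close> by (auto simp: Q_def)
  ultimately obtain F where F: "F \<in> Q" and maxF: "\<And>F'. F' \<in> Q \<Longrightarrow> F \<subseteq> F' \<Longrightarrow> F = F'"
    by (meson finite_has_maximal)
  then obtain m D c where St: "St F m D c" by (auto simp: Q_def)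
  have full: "\<Union>\<F> \<subseteq> F"
  proof (rule ccontr)
    assume "\<not> ?thesis"
    then obtain F' D' c' where "F \<subset> F'" "St F' (Suc m) D' c'" using step[OF St] by blast
    then show False using maxF[of F'] by (auto simp: Q_def)
  qed
  then have innF: "inn F = \<F>" by (auto simp: inn_def)
  have c_nonneg: "0 \<le> c i" if "i < m" for i using St that by (simp add: St_def)
  have "(\<Sum>i<m. c i) \<le> int k" using St inn_facts[of F] by (auto simp: St_def)
  \<comment> \<open>Sizes 1 and 2 are part of the state. From 3 on,
    \<open>1 + (k - 1) * card S - k \<ge> 2 * card S\<close>, because
    \<open>3 (k - 3) \<ge> k - 1\<close> for \<open>k \<ge> 4\<close>.\<close>
  have hall: "2 * card S \<le> card (\<Union>(D ` S))" if S: "S \<subseteq> {..<m}" for S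
  proof -
    have finS: "finite S" using S finite_subset by blast
    consider "card S = 0" | "card S = 1" | "card S = 2" | "3 \<le> card S" by linarith
    then show ?thesis
    proof cases
      case 2
      then obtain i where "S = {i}" by (auto simp: card_1_singleton_iff)
      then show ?thesis using S St by (simp add: St_def)
    next
      case 3
      then obtain i j where ij: "S = {i, j}" "i \<noteq> j" by (auto simp: card_2_iff)
      then have "4 \<le> card (D i \<union> D j)" using S St by (simp add: St_def)
      then show ?thesis using ij by simp
    next
      case 4
      then have "S \<noteq> {}" by auto
      then have "1 + (int k - 1) * int (card S) - (\<Sum>i\<in>S. c i) \<le> int (card (\<Union>(D ` S)))"
        using St S by (simp add: St_def)
      moreover have "(\<Sum>i\<in>S. c i) \<le> (\<Sum>i<m. c i)" using S c_nonneg by (intro sum_mono2) auto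
      moreover have "(int k - 3) * 3 \<le> (int k - 3) * int (card S)" using 4 k4 by (intro mult_left_mono) auto
      then have "2 * int (card S) + (3 * int k - 9) \<le> (int k - 1) * int (card S)" by (simp add: algebra_simps)
      ultimately have "2 * int (card S) \<le> int (card (\<Union>(D ` S)))"
        using \<open>(\<Sum>i<m. c i) \<le> int k\<close> k4 by linarith
      then show ?thesis by linarith
    qed (use finS in simp)
  qed
  have "finite (D i)" if "i < m" for i using St that by (simp add: St_def)
  then have "\<exists>P. (\<forall>i<m. P i \<subseteq> D i \<and> card (P i) = 2) \<and> (\<forall>i<m. \<forall>j<m. i \<noteq> j \<longrightarrow> P i \<inter> P j = {})"
    using hall by (rule disjoint_pairs_of_representatives)
  then obtain P where P: "\<forall>i<m. P i \<subseteq> D i \<and> card (P i) = 2" "\<forall>i<m. \<forall>j<m. i \<noteq> j \<longrightarrow> P i \<inter> P j = {}"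
    by (elim exE conjE)
  show ?thesis
    unfolding coverable_def
  proof (intro exI[of _ "P ` {..<m}"] conjI ballI)
    show "disjoint (P ` {..<m})"
    proof (rule disjointI)
      fix a b assume "a \<in> P ` {..<m}" "b \<in> P ` {..<m}" "a \<noteq> b"
      then obtain i j where "i < m" "j < m" "a = P i" "b = P j" by auto
      then show "a \<inter> b = {}" using P(2) \<open>a \<noteq> b\<close> by auto
    qed
  next
    fix B assume "B \<in> P ` {..<m}"
    then have B2: "card B = 2" using P(1) by auto
    then show "card B \<le> 2" by simp
    show "finite B" using B2 by (metis card.infinite zero_neq_numeral)
  next
    fix K assume "K \<in> Union ` \<F>"
    then obtain A where A: "A \<in> inn F" "K = \<Union>A" using innF by auto
    then obtain i where i: "i < m" "D i \<subseteq> K" using St unfolding St_def by blast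
    then have "P i \<inter> K = P i" "card (P i) = 2" using P(1) by auto
    then show "\<exists>B\<in>P ` {..<m}. 2 \<le> card (B \<inter> K)" using i(1) by (intro bexI[of _ "P i"]) auto
  qed
qed

section \<open>Bernoulli subsets: Harris and Janson inequalities\<close>

definition bern :: "'x set \<Rightarrow> real \<Rightarrow> ('x set \<Rightarrow> real) \<Rightarrow> real" where
  "bern X p h = (\<Sum>E\<in>Pow X. p ^ card E * (1 - p) ^ (card X - card E) * h E)"

lemma bern_empty [simp]: "bern {} p h = h {}"
  by (simp add: bern_def)

lemma bern_insert:
  assumes "finite X" "x \<notin> X"
  shows "bern (insert x X) p h = p * bern X p (\<lambda>E. h (insert x E)) + (1 - p) * bern X p h"
proof -
  let ?w = "\<lambda>E. p ^ card E * (1 - p) ^ (card (insert x X) - card E) * h E"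
  have inj: "inj_on (insert x) (Pow X)" using assms(2) by (auto simp: inj_on_def)
  have dis: "Pow X \<inter> insert x ` Pow X = {}" using assms(2) by auto
  have "bern (insert x X) p h = (\<Sum>E\<in>Pow X. ?w E) + (\<Sum>E\<in>Pow X. ?w (insert x E))"
    using assms dis inj by (simp add: bern_def Pow_insert sum.union_disjoint sum.reindex)
  moreover have "?w E = (1 - p) * (p ^ card E * (1 - p) ^ (card X - card E) * h E)" if "E \<in> Pow X" for E
  proof -
    have "card E \<le> card X" using that assms by (auto intro: card_mono)
    then have "card (insert x X) - card E = Suc (card X - card E)" using assms by (simp add: Suc_diff_le)
    then show ?thesis by simp
  qed
  moreover have "?w (insert x E) = p * (p ^ card E * (1 - p) ^ (card X - card E) * h (insert x E))" if "E \<in> Pow X" for E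
  proof -
    have "finite E" "x \<notin> E" using that assms by (auto intro: finite_subset)
    then show ?thesis using assms by simp
  qed
  ultimately show ?thesis by (simp add: bern_def sum_distrib_left)
qed

lemma bern_cong: "(\<And>E. E \<subseteq> X \<Longrightarrow> h E = g E) \<Longrightarrow> bern X p h = bern X p g"
  unfolding bern_def by (intro sum.cong) auto

lemma bern_mono:
  assumes "0 \<le> p" "p \<le> 1" "\<And>E. E \<subseteq> X \<Longrightarrow> h E \<le> g E"
  shows "bern X p h \<le> bern X p g"
  unfolding bern_def using assms by (intro sum_mono mult_left_mono) auto

lemma bern_const: "finite X \<Longrightarrow> bern X p (\<lambda>_. c) = c"
  by (induction X rule: finite_induct) (auto simp: bern_insert algebra_simps)

lemma bern_nonneg: "0 \<le> p \<Longrightarrow> p \<le> 1 \<Longrightarrow> (\<And>E. E \<subseteq> X \<Longrightarrow> 0 \<le> h E) \<Longrightarrow> 0 \<le> bern X p h"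
  unfolding bern_def by (intro sum_nonneg mult_nonneg_nonneg) auto

lemma bern_diff: "bern X p (\<lambda>E. h E - g E) = bern X p h - bern X p g"
  unfolding bern_def by (simp add: algebra_simps sum_subtractf)

lemma bern_add: "bern X p (\<lambda>E. h E + g E) = bern X p h + bern X p g"
  unfolding bern_def by (simp add: algebra_simps sum.distrib)

lemma bern_cmult: "bern X p (\<lambda>E. c * h E) = c * bern X p h"
  unfolding bern_def by (simp add: algebra_simps sum_distrib_left)

lemma bern_sum: "bern X p (\<lambda>E. \<Sum>i\<in>I. h i E) = (\<Sum>i\<in>I. bern X p (h i))"
  unfolding bern_def by (simp add: sum_distrib_left sum.swap[of _ I])

lemma bern_independent:
  assumes "finite X" "B \<subseteq> X" "\<And>E. E \<subseteq> X \<Longrightarrow> g E = g (E - B)"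
  shows "bern X p (\<lambda>E. of_bool (B \<subseteq> E) * g E) = p ^ card B * bern X p g"
  using assms
proof (induction X arbitrary: B g rule: finite_induct)
  case (insert x X)
  show ?case
  proof (cases "x \<in> B")
    case True
    define B' where "B' = B - {x}"
    have B': "B = insert x B'" "x \<notin> B'" "B' \<subseteq> X" using True insert.hyps insert.prems(1) by (auto simp: B'_def)
    have finB': "finite B'" using B' insert.hyps insert.prems(1) finite_subset by blast
    have gx: "g (insert x E) = g E" if "E \<subseteq> X" for E
    proof -
      have "g (insert x E) = g (insert x E - B)" using that by (intro insert.prems(2)) auto
      also have "insert x E - B = E - B" using True by auto
      also have "g (E - B) = g E" using that by (intro insert.prems(2)[symmetric]) auto
      finally show ?thesis .
    qed
    have gB: "g E = g (E - B')" if "E \<subseteq> X" for E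
    proof -
      have "E - B = E - B'" using that B' insert.hyps insert.prems(1) by auto
      then show ?thesis using insert.prems(2)[of E] that by auto
    qed
    have "bern (insert x X) p (\<lambda>E. of_bool (B \<subseteq> E) * g E) =
        p * bern X p (\<lambda>E. of_bool (B \<subseteq> insert x E) * g (insert x E)) + (1 - p) * bern X p (\<lambda>E. of_bool (B \<subseteq> E) * g E)"
      using insert.hyps insert.prems(1) by (simp add: bern_insert)
    also have "bern X p (\<lambda>E. of_bool (B \<subseteq> E) * g E) = bern X p (\<lambda>_. 0)"
      using True insert.hyps insert.prems(1) by (intro bern_cong) auto
    also have "bern X p (\<lambda>E. of_bool (B \<subseteq> insert x E) * g (insert x E)) = bern X p (\<lambda>E. of_bool (B' \<subseteq> E) * g E)"
      using B' gx by (intro bern_cong) (auto simp: subset_insert)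
    also have "\<dots> = p ^ card B' * bern X p g" using B' gB by (intro insert.IH) auto
    also have "bern X p g = bern (insert x X) p g"
    proof -
      have "bern X p (\<lambda>E. g (insert x E)) = bern X p g" by (intro bern_cong gx)
      then show ?thesis using insert.hyps insert.prems(1) by (simp add: bern_insert algebra_simps)
    qed
    finally show ?thesis using B' finB' insert.hyps insert.prems(1) by (simp add: bern_const)
  next
    case False
    then have B: "B \<subseteq> X" using insert.hyps insert.prems(1) by auto
    have g1: "g (insert x E) = g (insert x (E - B))" if "E \<subseteq> X" for E
      using insert.prems(2)[of "insert x E"] that False by (auto simp: insert_Diff_if)
    have "B \<subseteq> insert x E \<longleftrightarrow> B \<subseteq> E" for E using False by auto
    then have "bern X p (\<lambda>E. of_bool (B \<subseteq> insert x E) * g (insert x E)) = p ^ card B * bern X p (\<lambda>E. g (insert x E))"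
      using insert.IH[of B "\<lambda>E. g (insert x E)"] B g1 by simp
    moreover have "bern X p (\<lambda>E. of_bool (B \<subseteq> E) * g E) = p ^ card B * bern X p g"
    proof (rule insert.IH[OF B])
      fix E assume "E \<subseteq> X"
      then show "g E = g (E - B)" by (intro insert.prems(2)) auto
    qed
    ultimately show ?thesis using insert.hyps insert.prems(1) by (simp add: bern_insert algebra_simps)
  qed
qed simp

lemma bern_superset: "finite X \<Longrightarrow> B \<subseteq> X \<Longrightarrow> bern X p (\<lambda>E. of_bool (B \<subseteq> E)) = p ^ card B"
  using bern_independent[of X B "\<lambda>_. 1" p] by (simp add: bern_const)

text \<open>Splitting off one element of the ground set leaves the two-point inequality, whose
  defect \<open>p (1 - p) (H1 - H0) (G0 - G1)\<close> is a product of nonnegative factors. One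
  function increases and the other decreases, hence the negative correlation.\<close>

lemma harris:
  fixes h g :: "'x set \<Rightarrow> real"
  assumes "finite X" "0 \<le> p" "p \<le> 1"
    and "\<And>E E'. E \<subseteq> E' \<Longrightarrow> E' \<subseteq> X \<Longrightarrow> h E \<le> h E'" "\<And>E E'. E \<subseteq> E' \<Longrightarrow> E' \<subseteq> X \<Longrightarrow> g E' \<le> g E"
  shows "bern X p (\<lambda>E. h E * g E) \<le> bern X p h * bern X p g"
  using assms(1,4,5)
proof (induction X arbitrary: h g rule: finite_induct)
  case (insert x X)
  let ?h1 = "\<lambda>E. h (insert x E)" and ?g1 = "\<lambda>E. g (insert x E)"
  define H1 H0 G1 G0 where "H1 = bern X p ?h1" and "H0 = bern X p h" and "G1 = bern X p ?g1" and "G0 = bern X p g"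
  have "H0 \<le> H1" unfolding H0_def H1_def using assms(2,3) by (intro bern_mono insert.prems(1)) auto
  have "G1 \<le> G0" unfolding G0_def G1_def using assms(2,3) by (intro bern_mono insert.prems(2)) auto
  have "bern X p (\<lambda>E. ?h1 E * ?g1 E) \<le> H1 * G1" unfolding H1_def G1_def
    by (intro insert.IH insert.prems) auto
  moreover have "bern X p (\<lambda>E. h E * g E) \<le> H0 * G0" unfolding H0_def G0_def
    by (intro insert.IH insert.prems) auto
  ultimately have "bern (insert x X) p (\<lambda>E. h E * g E) \<le> p * (H1 * G1) + (1 - p) * (H0 * G0)"
    using insert assms(2,3) by (simp add: bern_insert) (intro add_mono mult_left_mono, auto)
  also have "\<dots> = (p * H1 + (1 - p) * H0) * (p * G1 + (1 - p) * G0) - p * (1 - p) * ((H1 - H0) * (G0 - G1))"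
    by (simp add: algebra_simps)
  also have "\<dots> \<le> (p * H1 + (1 - p) * H0) * (p * G1 + (1 - p) * G0)"
    using \<open>H0 \<le> H1\<close> \<open>G1 \<le> G0\<close> assms(2,3) by simp
  also have "\<dots> = bern (insert x X) p h * bern (insert x X) p g"
    using insert by (simp add: bern_insert H1_def H0_def G1_def G0_def)
  finally show ?case .
qed simp

section \<open>Janson's inequality\<close>

text \<open>Events are added one at a time. Given that the earlier ones fail, the next holds with
  probability at least \<open>x\<close>: events on disjoint sets are handled by independence, the
  others by a union bound with Harris. Then \<open>1 - x \<le> exp (- x)\<close>. Products replace
  conditional probabilities, so nothing is divided by a possibly zero probability.\<close>

lemma janson_nat:
  fixes B :: "nat \<Rightarrow> 'x set"
  assumes X: "finite X" and p: "0 \<le> p" "p \<le> 1" and B: "\<And>i. i < m \<Longrightarrow> B i \<subseteq> X"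
  shows "bern X p (\<lambda>E. of_bool (\<forall>i<m. \<not> B i \<subseteq> E)) \<le>
    exp (- (\<Sum>i<m. p ^ card (B i)) + (\<Sum>i<m. \<Sum>j\<in>{j. j < i \<and> B j \<inter> B i \<noteq> {}}. p ^ card (B j \<union> B i)))"
  using B
proof (induction m)
  case 0
  then show ?case using X by (simp add: bern_const)
next
  case (Suc m)
  define near where "near = {j. j < m \<and> B j \<inter> B m \<noteq> {}}"
  define none where "none J E = (of_bool (\<forall>i\<in>J. \<not> B i \<subseteq> E) :: real)" for J E
  define x where "x = p ^ card (B m) - (\<Sum>j\<in>near. p ^ card (B j \<union> B m))"
  have nn: "0 \<le> none J E" "none J E \<le> 1" for J E by (auto simp: none_def)
  let ?far = "{..<m} - near"
  have key: "x * bern X p (none {..<m}) \<le> bern X p (\<lambda>E. of_bool (B m \<subseteq> E) * none {..<m} E)"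
  proof (cases "x \<le> 0")
    case True
    then have "x * bern X p (none {..<m}) \<le> 0"
      using p nn by (intro mult_nonpos_nonneg bern_nonneg) auto
    also have "0 \<le> bern X p (\<lambda>E. of_bool (B m \<subseteq> E) * none {..<m} E)"
      using p nn by (intro bern_nonneg) auto
    finally show ?thesis .
  next
    case False
    have "bern X p (none {..<m}) \<le> bern X p (none ?far)"
      using p by (intro bern_mono) (auto simp: none_def)
    then have "x * bern X p (none {..<m}) \<le> x * bern X p (none ?far)" using False by simp
    also have "\<dots> = p ^ card (B m) * bern X p (none ?far) - (\<Sum>j\<in>near. p ^ card (B j \<union> B m) * bern X p (none ?far))"
      by (simp add: x_def left_diff_distrib sum_distrib_right)
    also have "\<dots> \<le> bern X p (\<lambda>E. of_bool (B m \<subseteq> E) * none ?far E) -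
        (\<Sum>j\<in>near. bern X p (\<lambda>E. of_bool (B j \<union> B m \<subseteq> E) * none ?far E))"
    proof (intro diff_mono sum_mono)
      have "none ?far E = none ?far (E - B m)" for E
      proof -
        have "B i \<subseteq> E \<longleftrightarrow> B i \<subseteq> E - B m" if "i \<in> ?far" for i using that by (auto simp: near_def)
        then show ?thesis by (auto simp: none_def)
      qed
      then show "p ^ card (B m) * bern X p (none ?far) \<le> bern X p (\<lambda>E. of_bool (B m \<subseteq> E) * none ?far E)"
        using Suc.prems X by (subst bern_independent) auto
      fix j assume j: "j \<in> near"
      have "bern X p (\<lambda>E. of_bool (B j \<union> B m \<subseteq> E) * none ?far E) \<le>
        bern X p (\<lambda>E. of_bool (B j \<union> B m \<subseteq> E)) * bern X p (none ?far)"
      proof (rule harris[OF X p])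
        fix E E' :: "'x set" assume "E \<subseteq> E'"
        then show "(of_bool (B j \<union> B m \<subseteq> E) :: real) \<le> of_bool (B j \<union> B m \<subseteq> E')" by auto
        show "none ?far E' \<le> none ?far E" using \<open>E \<subseteq> E'\<close> by (auto simp: none_def)
      qed
      also have "bern X p (\<lambda>E. of_bool (B j \<union> B m \<subseteq> E)) = p ^ card (B j \<union> B m)"
        using Suc.prems X j by (intro bern_superset) (auto simp: near_def)
      finally show "bern X p (\<lambda>E. of_bool (B j \<union> B m \<subseteq> E) * none ?far E) \<le> p ^ card (B j \<union> B m) * bern X p (none ?far)" .
    qed
    also have "\<dots> = bern X p (\<lambda>E. of_bool (B m \<subseteq> E) * none ?far E - (\<Sum>j\<in>near. of_bool (B j \<union> B m \<subseteq> E) * none ?far E))"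
      by (simp add: bern_diff bern_sum)
    \<comment> \<open>Pointwise: if all far events fail but some earlier event holds, that event is
      near, and its term in the sum cancels the first one.\<close>
    also have "\<dots> \<le> bern X p (\<lambda>E. of_bool (B m \<subseteq> E) * none {..<m} E)"
    proof (rule bern_mono[OF p])
      fix E assume "E \<subseteq> X"
      have fin: "finite near" by (simp add: near_def)
      show "of_bool (B m \<subseteq> E) * none ?far E - (\<Sum>j\<in>near. of_bool (B j \<union> B m \<subseteq> E) * none ?far E)
          \<le> of_bool (B m \<subseteq> E) * none {..<m} E"
      proof (cases "B m \<subseteq> E \<and> none ?far E = 1 \<and> none {..<m} E = 0")
        case True
        then obtain j where j: "j < m" "B j \<subseteq> E" by (auto simp: none_def)
        then have "j \<in> near" using True by (auto simp: none_def)
        then have "of_bool (B j \<union> B m \<subseteq> E) * none ?far E \<le> (\<Sum>j\<in>near. of_bool (B j \<union> B m \<subseteq> E) * none ?far E)"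
          using fin nn by (intro member_le_sum) auto
        then show ?thesis using True j by simp
      next
        case False
        have "0 \<le> (\<Sum>j\<in>near. of_bool (B j \<union> B m \<subseteq> E) * none ?far E)" using nn by (intro sum_nonneg) auto
        moreover have "of_bool (B m \<subseteq> E) * none ?far E \<le> of_bool (B m \<subseteq> E) * none {..<m} E"
          using False by (auto simp: none_def)
        ultimately show ?thesis by linarith
      qed
    qed
    finally show ?thesis .
  qed
  have "bern X p (\<lambda>E. of_bool (\<forall>i<Suc m. \<not> B i \<subseteq> E)) = bern X p (\<lambda>E. none {..<m} E - of_bool (B m \<subseteq> E) * none {..<m} E)"
    by (intro bern_cong) (auto simp: none_def less_Suc_eq)
  also have "\<dots> = bern X p (none {..<m}) - bern X p (\<lambda>E. of_bool (B m \<subseteq> E) * none {..<m} E)"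
    by (simp add: bern_diff)
  also have "\<dots> \<le> (1 - x) * bern X p (none {..<m})" using key by (simp add: algebra_simps)
  also have "\<dots> \<le> exp (- x) * bern X p (none {..<m})"
    using exp_ge_add_one_self[of "- x"] p nn by (intro mult_right_mono bern_nonneg) auto
  also have "bern X p (none {..<m}) = bern X p (\<lambda>E. of_bool (\<forall>i<m. \<not> B i \<subseteq> E))"
    by (intro bern_cong) (auto simp: none_def)
  also have "exp (- x) * \<dots> \<le> exp (- x) * exp (- (\<Sum>i<m. p ^ card (B i)) + (\<Sum>i<m. \<Sum>j\<in>{j. j < i \<and> B j \<inter> B i \<noteq> {}}. p ^ card (B j \<union> B i)))"
    using Suc by (intro mult_left_mono) auto
  also have "\<dots> = exp (- (\<Sum>i<Suc m. p ^ card (B i)) + (\<Sum>i<Suc m. \<Sum>j\<in>{j. j < i \<and> B j \<inter> B i \<noteq> {}}. p ^ card (B j \<union> B i)))"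
    by (simp add: x_def near_def flip: exp_add)
  finally show ?case .
qed

lemma janson:
  fixes B :: "'i \<Rightarrow> 'x set"
  assumes X: "finite X" and p: "0 \<le> p" "p \<le> 1" and I: "finite I" and B: "\<And>i. i \<in> I \<Longrightarrow> B i \<subseteq> X"
  shows "bern X p (\<lambda>E. of_bool (\<forall>i\<in>I. \<not> B i \<subseteq> E)) \<le>
    exp (- (\<Sum>i\<in>I. p ^ card (B i)) + (\<Sum>i\<in>I. \<Sum>j\<in>{j\<in>I. j \<noteq> i \<and> B j \<inter> B i \<noteq> {}}. p ^ card (B j \<union> B i)))"
proof -
  obtain f :: "nat \<Rightarrow> 'i" where f: "bij_betw f {..<card I} I"
    using ex_bij_betw_nat_finite[OF I] by (auto simp: atLeast0LessThan)
  let ?m = "card I" and ?B = "\<lambda>i. B (f i)"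
  have "bern X p (\<lambda>E. of_bool (\<forall>i\<in>I. \<not> B i \<subseteq> E)) = bern X p (\<lambda>E. of_bool (\<forall>i<?m. \<not> ?B i \<subseteq> E))"
  proof -
    have "(\<forall>i\<in>f ` {..<?m}. \<not> B i \<subseteq> E) \<longleftrightarrow> (\<forall>i<?m. \<not> ?B i \<subseteq> E)" for E by auto
    then show ?thesis unfolding bij_betw_imp_surj_on[OF f] by simp
  qed
  also have "\<dots> \<le> exp (- (\<Sum>i<?m. p ^ card (?B i)) + (\<Sum>i<?m. \<Sum>j\<in>{j. j < i \<and> ?B j \<inter> ?B i \<noteq> {}}. p ^ card (?B j \<union> ?B i)))"
    using B bij_betwE[OF f] by (intro janson_nat X p) auto
  also have "(\<Sum>i<?m. p ^ card (?B i)) = (\<Sum>i\<in>I. p ^ card (B i))"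
    by (rule sum.reindex_bij_betw[OF f])
  \<comment> \<open>Each overlapping pair is counted once on the left and twice on the right, which
    frees the bound from the enumeration.\<close>
  also have "(\<Sum>i<?m. \<Sum>j\<in>{j. j < i \<and> ?B j \<inter> ?B i \<noteq> {}}. p ^ card (?B j \<union> ?B i)) \<le>
     (\<Sum>i<?m. \<Sum>j\<in>{j\<in>I. j \<noteq> f i \<and> B j \<inter> ?B i \<noteq> {}}. p ^ card (B j \<union> ?B i))"
  proof (rule sum_mono)
    fix i assume i: "i \<in> {..<?m}"
    have inj: "inj_on f {j. j < i \<and> ?B j \<inter> ?B i \<noteq> {}}"
      using f i by (auto simp: bij_betw_def intro: inj_on_subset)
    have "(\<Sum>j\<in>{j. j < i \<and> ?B j \<inter> ?B i \<noteq> {}}. p ^ card (?B j \<union> ?B i)) =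
        (\<Sum>j\<in>f ` {j. j < i \<and> ?B j \<inter> ?B i \<noteq> {}}. p ^ card (B j \<union> ?B i))"
      using inj by (simp add: sum.reindex)
    also have "\<dots> \<le> (\<Sum>j\<in>{j\<in>I. j \<noteq> f i \<and> B j \<inter> ?B i \<noteq> {}}. p ^ card (B j \<union> ?B i))"
      using I i p bij_betwE[OF f] inj_on_eq_iff[OF bij_betw_imp_inj_on[OF f]]
      by (intro sum_mono2) auto
    finally show "(\<Sum>j\<in>{j. j < i \<and> ?B j \<inter> ?B i \<noteq> {}}. p ^ card (?B j \<union> ?B i)) \<le>
       (\<Sum>j\<in>{j\<in>I. j \<noteq> f i \<and> B j \<inter> ?B i \<noteq> {}}. p ^ card (B j \<union> ?B i))" .
  qed
  also have "(\<Sum>i<?m. \<Sum>j\<in>{j\<in>I. j \<noteq> f i \<and> B j \<inter> ?B i \<noteq> {}}. p ^ card (B j \<union> ?B i)) =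
     (\<Sum>i\<in>I. \<Sum>j\<in>{j\<in>I. j \<noteq> i \<and> B j \<inter> B i \<noteq> {}}. p ^ card (B j \<union> B i))"
    by (rule sum.reindex_bij_betw[OF f])
  finally show ?thesis by simp
qed

text \<open>Applying Janson's inequality to a random subfamily of the events, in which each event is kept
  with probability \<open>q\<close>, scales the two sums by \<open>q\<close> and \<open>q\<^sup>2\<close>.\<close>

lemma janson_sampled:
  fixes B :: "'i \<Rightarrow> 'x set"
  assumes X: "finite X" and p: "0 \<le> p" "p \<le> 1" and I: "finite I" and B: "\<And>i. i \<in> I \<Longrightarrow> B i \<subseteq> X"
    and q: "0 \<le> q" "q \<le> 1"
  shows "bern X p (\<lambda>E. of_bool (\<forall>i\<in>I. \<not> B i \<subseteq> E)) \<le>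
    exp (- q * (\<Sum>i\<in>I. p ^ card (B i)) + q\<^sup>2 * (\<Sum>i\<in>I. \<Sum>j\<in>{j\<in>I. j \<noteq> i \<and> B j \<inter> B i \<noteq> {}}. p ^ card (B j \<union> B i)))"
    (is "?P \<le> exp ?avg")
proof (cases "?P \<le> 0")
  case True
  then show ?thesis using exp_gt_zero[of ?avg] by linarith
next
  case False
  define v where "v J = - (\<Sum>i\<in>J. p ^ card (B i)) + (\<Sum>i\<in>J. \<Sum>j\<in>{j\<in>J. j \<noteq> i \<and> B j \<inter> B i \<noteq> {}}. p ^ card (B j \<union> B i))" for J
  \<comment> \<open>After taking logarithms the bounds for all subfamilies can be averaged: the left
    side is constant, so it is at most the mean of \<open>v J\<close> over a random
    \<open>J\<close>.\<close>
  have ln: "ln ?P \<le> v J" if J: "J \<subseteq> I" for J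
  proof -
    have "?P \<le> bern X p (\<lambda>E. of_bool (\<forall>i\<in>J. \<not> B i \<subseteq> E))" using J p by (intro bern_mono) auto
    also have "\<dots> \<le> exp (v J)" unfolding v_def using J I B by (intro janson X p) (auto intro: finite_subset)
    finally have "ln ?P \<le> ln (exp (v J))" using False by (intro ln_mono) auto
    then show ?thesis by simp
  qed
  have v_eq: "v J = - (\<Sum>i\<in>I. p ^ card (B i) * of_bool ({i} \<subseteq> J)) +
      (\<Sum>i\<in>I. \<Sum>j\<in>{j\<in>I. j \<noteq> i \<and> B j \<inter> B i \<noteq> {}}. p ^ card (B j \<union> B i) * of_bool ({i, j} \<subseteq> J))" if J: "J \<subseteq> I" for J
  proof -
    have 1: "(\<Sum>i\<in>J. p ^ card (B i)) = (\<Sum>i\<in>I. p ^ card (B i) * of_bool ({i} \<subseteq> J))"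
      using J I by (intro sum.mono_neutral_cong_left) auto
    have "(\<Sum>i\<in>J. \<Sum>j\<in>{j\<in>J. j \<noteq> i \<and> B j \<inter> B i \<noteq> {}}. p ^ card (B j \<union> B i)) =
        (\<Sum>i\<in>J. \<Sum>j\<in>{j\<in>I. j \<noteq> i \<and> B j \<inter> B i \<noteq> {}}. p ^ card (B j \<union> B i) * of_bool ({i, j} \<subseteq> J))"
      using J I by (intro sum.cong refl sum.mono_neutral_cong_left) auto
    also have "\<dots> = (\<Sum>i\<in>I. \<Sum>j\<in>{j\<in>I. j \<noteq> i \<and> B j \<inter> B i \<noteq> {}}. p ^ card (B j \<union> B i) * of_bool ({i, j} \<subseteq> J))"
      using J I by (intro sum.mono_neutral_left) auto
    finally show ?thesis using 1 by (simp add: v_def)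
  qed
  have "ln ?P = bern I q (\<lambda>_. ln ?P)" using I by (simp add: bern_const)
  also have "\<dots> \<le> bern I q v" using ln q by (intro bern_mono) auto
  also have "\<dots> = bern I q (\<lambda>J. - (\<Sum>i\<in>I. p ^ card (B i) * of_bool ({i} \<subseteq> J)) +
      (\<Sum>i\<in>I. \<Sum>j\<in>{j\<in>I. j \<noteq> i \<and> B j \<inter> B i \<noteq> {}}. p ^ card (B j \<union> B i) * of_bool ({i, j} \<subseteq> J)))"
    by (intro bern_cong v_eq)
  also have "\<dots> = bern I q (\<lambda>J. (-1) * (\<Sum>i\<in>I. p ^ card (B i) * of_bool ({i} \<subseteq> J)) +
      (\<Sum>i\<in>I. \<Sum>j\<in>{j\<in>I. j \<noteq> i \<and> B j \<inter> B i \<noteq> {}}. p ^ card (B j \<union> B i) * of_bool ({i, j} \<subseteq> J)))" by simp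
  also have "\<dots> = - (\<Sum>i\<in>I. p ^ card (B i) * bern I q (\<lambda>J. of_bool ({i} \<subseteq> J))) +
      (\<Sum>i\<in>I. \<Sum>j\<in>{j\<in>I. j \<noteq> i \<and> B j \<inter> B i \<noteq> {}}. p ^ card (B j \<union> B i) * bern I q (\<lambda>J. of_bool ({i, j} \<subseteq> J)))"
    unfolding bern_add bern_cmult bern_sum by simp
  also have "\<dots> = - (\<Sum>i\<in>I. p ^ card (B i) * q) +
      (\<Sum>i\<in>I. \<Sum>j\<in>{j\<in>I. j \<noteq> i \<and> B j \<inter> B i \<noteq> {}}. p ^ card (B j \<union> B i) * q\<^sup>2)"
  proof -
    have a: "bern I q (\<lambda>J. of_bool ({i} \<subseteq> J)) = q" if "i \<in> I" for i
      using bern_superset[OF I, of "{i}" q] that by simp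
    have b: "bern I q (\<lambda>J. of_bool ({i, j} \<subseteq> J)) = q\<^sup>2" if "i \<in> I" "j \<in> I" "j \<noteq> i" for i j
      using bern_superset[OF I, of "{i, j}" q] that by (simp add: card_insert_if power2_eq_square)
    show ?thesis using a b by (intro arg_cong2[where f = "(+)"] arg_cong[where f = uminus] sum.cong refl) auto
  qed
  also have "\<dots> = ?avg"
    by (simp add: sum_distrib_left sum_distrib_right mult.commute sum_negf)
  finally have "ln ?P \<le> ?avg" .
  then have "exp (ln ?P) \<le> exp ?avg" by (rule exp_mono)
  moreover have "exp (ln ?P) = ?P" using False by (intro exp_ln) linarith
  ultimately show ?thesis by linarith
qed

lemma gnp_prob_bern: "gnp_prob n p P = bern (all_edges n) p (\<lambda>E. of_bool (P E))"
proof -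
  have fin: "finite (all_edges n)" by (auto simp: all_edges_def)
  have "bern (all_edges n) p (\<lambda>E. of_bool (P E)) =
    (\<Sum>E\<in>{E. E \<subseteq> all_edges n \<and> P E}. p ^ card E * (1 - p) ^ (card (all_edges n) - card E))"
    unfolding bern_def using fin by (intro sum.mono_neutral_cong_right) auto
  then show ?thesis by (simp add: gnp_prob_def)
qed

section \<open>The 1-statement\<close>

text \<open>Mapping each vertex of \<open>H\<close> into its own part makes every such map
  injective, and the number of maps an exact power of \<open>t\<close>.\<close>

lemma disjoint_parts_exist:
  assumes "finite V" "finite S" "card V * t \<le> card S"
  shows "\<exists>part. (\<forall>v\<in>V. part v \<subseteq> S \<and> card (part v) = t) \<and> (\<forall>v\<in>V. \<forall>w\<in>V. v \<noteq> w \<longrightarrow> part v \<inter> part w = {})"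
  using assms
proof (induction V arbitrary: S rule: finite_induct)
  case (insert x V)
  have "t \<le> card S" using insert by (simp add: trans_le_add1)
  then obtain T where T: "T \<subseteq> S" "card T = t" "finite T" by (rule obtain_subset_with_card_n)
  have "card V * t \<le> card (S - T)" using insert T by (simp add: card_Diff_subset)
  then obtain part where part: "\<forall>v\<in>V. part v \<subseteq> S - T \<and> card (part v) = t"
    "\<forall>v\<in>V. \<forall>w\<in>V. v \<noteq> w \<longrightarrow> part v \<inter> part w = {}"
    using insert.IH[of "S - T"] insert.prems(1) by blast
  have "part v \<inter> T = {}" if "v \<in> V" for v using part(1) that by auto
  then show ?case using part T insert.hyps
    by (intro exI[of _ "part(x := T)"]) auto
qed simp

lemma card_le_m1:
  assumes "is_graph VH EH" "W \<subseteq> VH" "D \<subseteq> EH" "\<forall>e\<in>D. e \<subseteq> W" "2 \<le> card W"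
  shows "real (card D) \<le> m1 VH EH * (real (card W) - 1)"
proof -
  have fin: "finite VH" "EH \<subseteq> Pow VH" using assms(1) by (auto simp: is_graph_def)
  then have "finite EH" by (meson finite_Pow_iff finite_subset)
  have "subgraphs2 VH EH \<subseteq> Pow VH \<times> Pow EH" by (auto simp: subgraphs2_def)
  then have "finite (subgraphs2 VH EH)" using fin(1) \<open>finite EH\<close> by (meson finite_Pow_iff finite_SigmaI finite_subset)
  moreover have "(W, D) \<in> subgraphs2 VH EH" using assms by (auto simp: subgraphs2_def)
  then have "d1 W D \<in> (\<lambda>(V', E'). d1 V' E') ` subgraphs2 VH EH" by force
  ultimately have "d1 W D \<le> m1 VH EH" unfolding m1_def by (intro Max_ge) auto
  then show ?thesis using assms(5) by (simp add: d1_def field_simps)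
qed

text \<open>\<open>\<kappa>\<close> accounts for the share of \<open>n\<close> left to each of the
  \<open>h\<close> parts of \<open>S\<close>, and \<open>K\<close> for the ways in which two
  embeddings can overlap. The exponent \<open>2 n\<close> is there to beat the at most
  \<open>2 ^ n\<close> sets \<open>S\<close>.\<close>

lemma no_copy_bound:
  fixes VH :: "'h set" and b :: nat
  assumes graph: "is_graph VH EH" and ne: "EH \<noteq> {}" and m: "0 < m1 VH EH"
  defines "h \<equiv> card VH" and "K \<equiv> 2 ^ card EH * real (card VH) ^ card VH"
    and "\<kappa> \<equiv> (1 / (2 * real (card VH) * (real b + 1))) ^ card VH"
  assumes C: "C = 8 * K / \<kappa>\<^sup>2" and p: "C * real n powr (- 1 / m1 VH EH) \<le> p" "p \<le> 1"
    and S: "S \<subseteq> {0..<n}" "n \<le> (b + 1) * card S" and n: "(b + 1) * h \<le> n" "0 < n"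
  shows "bern (all_edges n) p (\<lambda>E. of_bool (\<not> has_copy_in VH EH E S)) \<le> exp (- 2 * real n)"
proof -
  have finH: "finite VH" and edge: "\<And>e. e \<in> EH \<Longrightarrow> e \<subseteq> VH \<and> card e = 2" using graph by (auto simp: is_graph_def)
  have finE: "finite EH" using edge finH by (meson PowI finite_Pow_iff finite_subset subsetI)
  obtain e0 where e0: "e0 \<in> EH" using ne by auto
  have h2: "2 \<le> h" using edge[OF e0] finH card_mono[of VH e0] by (simp add: h_def)
  have finS: "finite S" using S finite_subset by blast
  have finX: "finite (all_edges n)" by (auto simp: all_edges_def)
  let ?e = "card EH" and ?m = "m1 VH EH"
  have K1: "1 \<le> K"
  proof -
    have "1 * 1 \<le> (2::real) ^ card EH * real h ^ h" using h2 by (intro mult_mono one_le_power) auto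
    then show ?thesis by (simp add: K_def h_def)
  qed
  have \<kappa>0: "0 < \<kappa>" using h2 by (simp add: \<kappa>_def h_def)
  have \<kappa>1: "\<kappa> \<le> 1"
  proof -
    have "1 * 1 \<le> 2 * real h * (real b + 1)" using h2 by (intro mult_mono) auto
    then show ?thesis unfolding \<kappa>_def h_def by (intro power_le_one) (auto simp: field_simps)
  qed
  have C1: "1 \<le> C"
  proof -
    have "\<kappa>\<^sup>2 \<le> 1" using \<kappa>0 \<kappa>1 by (simp add: power_le_one)
    then have "1 * \<kappa>\<^sup>2 \<le> 8 * K" using K1 by simp
    then show ?thesis unfolding C using \<kappa>0 by (simp add: field_simps)
  qed
  have n1: "1 \<le> real n" using n by simp
  have p0: "0 < p" using p(1) C1 n by (smt (verit) mult_pos_pos powr_gt_zero of_nat_0_less_iff)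
  \<comment> \<open>\<open>m1\<close> bounds \<open>card D\<close> by
    \<open>m1 * (card W - 1)\<close>, and \<open>C \<le> C ^ card D\<close>; so every subgraph with
    an edge occurs, in expectation and up to constants, at least \<open>C n\<close> times. This
    controls all overlaps.\<close>
  have dense: "C * real n \<le> real n ^ card W * p ^ card D"
    if DW: "D \<subseteq> EH" "D \<noteq> {}" "W \<subseteq> VH" "\<forall>e\<in>D. e \<subseteq> W" for D W
  proof -
    have finD: "finite D" using DW finE finite_subset by blast
    have finW: "finite W" using DW finH finite_subset by blast
    obtain e where e: "e \<in> D" using DW by auto
    then have "card e \<le> card W" using DW finW by (intro card_mono) auto
    then have W2: "2 \<le> card W" using e DW edge by auto
    have D1: "1 \<le> card D" using DW finD by (simp add: Suc_leI card_gt_0_iff)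
    have le: "real (card D) / ?m \<le> real (card W) - 1"
      using card_le_m1[OF graph DW(3,1,4) W2] m by (simp add: field_simps)
    have "C * real n powr (- (real (card W) - 1)) \<le> C ^ card D * real n powr (- (real (card D) / ?m))"
    proof (intro mult_mono)
      show "C \<le> C ^ card D" using C1 D1 by (metis power_increasing power_one_right)
      show "real n powr - (real (card W) - 1) \<le> real n powr - (real (card D) / ?m)"
        using le n1 by (intro powr_mono) auto
    qed (use C1 in auto)
    also have "real n powr (- (real (card D) / ?m)) = (real n powr (- 1 / ?m)) ^ card D"
      using n by (simp add: powr_powr flip: powr_realpow)
    also have "C ^ card D * \<dots> = (C * real n powr (- 1 / ?m)) ^ card D" by (simp add: power_mult_distrib)
    also have "\<dots> \<le> p ^ card D" using p(1) C1 by (intro power_mono) auto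
    finally have "real n ^ card W * (C * real n powr (- (real (card W) - 1))) \<le> real n ^ card W * p ^ card D"
      using n1 by (intro mult_left_mono) auto
    moreover have "real n ^ card W * real n powr (- (real (card W) - 1)) = real n"
      using n by (simp flip: powr_realpow powr_add)
    ultimately show ?thesis by (simp add: algebra_simps)
  qed
  define N where "N = real n ^ h * p ^ ?e"
  have N: "C * real n \<le> N" unfolding N_def h_def using ne edge by (intro dense) auto
  have N0: "0 < N" using N C1 n1 by (smt (verit) mult_pos_pos)
  define t where "t = card S div h"
  have "h * t \<le> card S" by (simp add: t_def)
  then obtain part where part: "\<forall>v\<in>VH. part v \<subseteq> S \<and> card (part v) = t"
    "\<forall>v\<in>VH. \<forall>w\<in>VH. v \<noteq> w \<longrightarrow> part v \<inter> part w = {}"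
    using disjoint_parts_exist[OF finH finS, of t] by (auto simp: h_def)
  define I where "I = PiE VH part"
  define B where "B f = (\<lambda>e. f ` e) ` EH" for f :: "'h \<Rightarrow> nat"
  have finpart: "finite (part v)" if "v \<in> VH" for v using part(1) that finS finite_subset by blast
  have finI: "finite I" unfolding I_def using finH finpart by (intro finite_PiE) auto
  have cardI: "card I = t ^ h" unfolding I_def using finH part by (simp add: card_PiE h_def)
  have inj: "inj_on f VH" if f: "f \<in> I" for f
  proof (rule inj_onI)
    fix x y assume xy: "x \<in> VH" "y \<in> VH" "f x = f y"
    then have "f x \<in> part x" "f x \<in> part y" using f by (auto simp: I_def PiE_def Pi_def)
    then show "x = y" using part(2) xy by blast
  qed
  have fS: "f ` VH \<subseteq> S" if "f \<in> I" for f
  proof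
    fix y assume "y \<in> f ` VH"
    then obtain v where "v \<in> VH" "y = f v" by auto
    then show "y \<in> S" using that part(1) by (auto simp: I_def PiE_def Pi_def)
  qed
  have fsub: "f ` e \<subseteq> S" "card (f ` e) = 2" if "f \<in> I" "e \<in> EH" for f e
    using fS[OF that(1)] edge[OF that(2)] inj[OF that(1)] by (auto simp: card_image inj_on_subset)
  have BX: "B f \<subseteq> all_edges n" if "f \<in> I" for f
    using fsub[OF that] S(1) by (auto simp: B_def all_edges_def)
  have injB: "inj_on (\<lambda>e. f ` e) EH" if "f \<in> I" for f
    using inj[OF that] edge by (intro inj_onI) (metis inj_on_image_eq_iff)
  have cardB: "card (B f) = ?e" if "f \<in> I" for f unfolding B_def using injB[OF that] by (rule card_image)
  have finB: "finite (B f)" for f using finE by (simp add: B_def)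
  \<comment> \<open>Rounding down in \<open>card S div h\<close> loses at most a factor 2 because
    \<open>t \<ge> 1\<close>; this is the 2 in \<open>\<kappa>\<close>.\<close>
  have tn: "real n / (2 * real h * (real b + 1)) \<le> real t"
  proof -
    have sh: "h \<le> card S"
    proof (rule ccontr)
      assume "\<not> h \<le> card S"
      then have "(b + 1) * card S < (b + 1) * h" by (intro mult_strict_left_mono) auto
      then show False using S(2) n(1) by linarith
    qed
    have "card S < h * (t + 1)" unfolding t_def using h2 by (metis add.commute dividend_less_times_div less_le_trans mult_Suc_right plus_1_eq_Suc zero_less_numeral add_mult_distrib2 mult_1_right)
    moreover have "1 \<le> t" unfolding t_def using sh h2 by (simp add: Suc_leI div_greater_zero_iff)
    ultimately have "card S \<le> 2 * h * t" by (smt (verit) One_nat_def Suc_eq_plus1 add_mult_distrib2 le_trans less_imp_le_nat mult.assoc mult.commute mult_2 mult_le_mono2 nat_add_left_cancel_le)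
    then have "n \<le> (b + 1) * (2 * h * t)" using S(2) by (meson le_trans mult_le_mono2)
    then have "real n \<le> real ((b + 1) * (2 * h * t))" by (rule of_nat_mono)
    then have "real n \<le> real t * (2 * real h * (real b + 1))" by (simp add: algebra_simps)
    moreover have "0 < 2 * real h * (real b + 1)" using h2 by (intro mult_pos_pos) auto
    ultimately show ?thesis by (simp add: pos_divide_le_eq)
  qed
  define \<mu> where "\<mu> = (\<Sum>f\<in>I. p ^ card (B f))"
  define \<Delta> where "\<Delta> = (\<Sum>f\<in>I. \<Sum>g\<in>{g\<in>I. g \<noteq> f \<and> B g \<inter> B f \<noteq> {}}. p ^ card (B g \<union> B f))"
  have \<mu>: "\<kappa> * N \<le> \<mu>"
  proof -
    have "\<kappa> * real n ^ h = (real n / (2 * real h * (real b + 1))) ^ h"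
      unfolding \<kappa>_def h_def by (simp add: power_divide power_mult_distrib)
    also have "\<dots> \<le> real t ^ h" using tn by (intro power_mono) auto
    finally have "\<kappa> * real n ^ h * p ^ ?e \<le> real t ^ h * p ^ ?e" using p0 by (intro mult_right_mono) auto
    moreover have "\<mu> = real t ^ h * p ^ ?e" unfolding \<mu>_def using cardB cardI by simp
    ultimately show ?thesis by (simp add: N_def)
  qed
  have inner: "(\<Sum>g\<in>{g\<in>I. g \<noteq> f \<and> B g \<inter> B f \<noteq> {}}. p ^ card (B g \<union> B f)) \<le> K * p ^ ?e * N / (C * real n)" if f: "f \<in> I" for f
  proof -
    \<comment> \<open>Overlapping embeddings \<open>g\<close> are sorted by the set \<open>D\<close>
      of edges that land on the copy given by \<open>f\<close>. The vertices of \<open>D\<close>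
      have at most \<open>h\<close> images each, the others at most \<open>n\<close>, and the union
      has \<open>2 * card EH - card D\<close> edges.\<close>
    define Dg where "Dg g = {e\<in>EH. g ` e \<in> B f}" for g
    define G where "G D = {g \<in> I. Dg g = D}" for D
    have "(\<Sum>g\<in>{g\<in>I. g \<noteq> f \<and> B g \<inter> B f \<noteq> {}}. p ^ card (B g \<union> B f)) \<le> (\<Sum>g\<in>(\<Union>D\<in>Pow EH - {{}}. G D). p ^ card (B g \<union> B f))"
    proof (rule sum_mono2)
      show "finite (\<Union>D\<in>Pow EH - {{}}. G D)" using finI by (auto simp: G_def intro: finite_subset[of _ I])
      show "{g\<in>I. g \<noteq> f \<and> B g \<inter> B f \<noteq> {}} \<subseteq> (\<Union>D\<in>Pow EH - {{}}. G D)"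
      proof
        fix g assume "g \<in> {g\<in>I. g \<noteq> f \<and> B g \<inter> B f \<noteq> {}}"
        then have "g \<in> G (Dg g)" "Dg g \<noteq> {}" by (auto simp: G_def Dg_def B_def)
        moreover have "Dg g \<subseteq> EH" by (auto simp: Dg_def)
        ultimately show "g \<in> (\<Union>D\<in>Pow EH - {{}}. G D)" by blast
      qed
    qed (use p0 in auto)
    also have "\<dots> = (\<Sum>D\<in>Pow EH - {{}}. \<Sum>g\<in>G D. p ^ card (B g \<union> B f))"
      using finE finI by (intro sum.UNION_disjoint) (auto simp: G_def)
    also have "\<dots> \<le> (\<Sum>D\<in>Pow EH - {{}}. real h ^ h * (p ^ ?e * N / (C * real n)))"
    proof (rule sum_mono)
      fix D assume "D \<in> Pow EH - {{}}"
      then have D: "D \<subseteq> EH" "D \<noteq> {}" by auto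
      define W where "W = \<Union>D"
      have W: "W \<subseteq> VH" using D edge by (auto simp: W_def)
      have finW: "finite W" using W finH finite_subset by blast
      have cW: "card W \<le> h" unfolding h_def using W finH by (intro card_mono)
      have cD: "card D \<le> ?e" using D finE by (intro card_mono)
      have cu: "card (B g \<union> B f) = 2 * ?e - card D" if "g \<in> G D" for g
      proof -
        have gI: "g \<in> I" using that by (simp add: G_def)
        have "B g \<inter> B f = (\<lambda>e. g ` e) ` D" using that by (auto simp: G_def Dg_def B_def)
        then have "card (B g \<inter> B f) = card D" using injB[OF gI] D by (simp add: card_image inj_on_subset)
        then show ?thesis using card_Un_Int[OF finB finB, of g f] cardB[OF gI] cardB[OF f] by simp
      qed
      have "G D \<subseteq> PiE VH (\<lambda>v. if v \<in> W then f ` VH else {0..<n})"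
      proof
        fix g assume g: "g \<in> G D"
        then have gI: "g \<in> I" by (simp add: G_def)
        have "g v \<in> f ` VH" if v: "v \<in> W" for v
        proof -
          obtain e where e: "e \<in> D" "v \<in> e" using v by (auto simp: W_def)
          then have "g ` e \<in> B f" using g by (auto simp: G_def Dg_def)
          then obtain e' where "e' \<in> EH" "g ` e = f ` e'" by (auto simp: B_def)
          then show ?thesis using e edge by blast
        qed
        moreover have "g v \<in> {0..<n}" if "v \<in> VH" for v using fS[OF gI] S(1) that by blast
        ultimately show "g \<in> PiE VH (\<lambda>v. if v \<in> W then f ` VH else {0..<n})"
          using gI by (auto simp: I_def PiE_def)
      qed
      then have "card (G D) \<le> card (PiE VH (\<lambda>v. if v \<in> W then f ` VH else {0..<n}))"
        using finH by (intro card_mono finite_PiE) auto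
      also have "\<dots> = (\<Prod>v\<in>VH. if v \<in> W then h else n)"
        using finH inj[OF f] by (simp add: card_PiE if_distrib card_image h_def cong: if_cong)
      also have "\<dots> = h ^ card W * n ^ (h - card W)"
      proof -
        have VHW: "VH \<inter> W = W" "VH \<inter> - W = VH - W" using W by auto
        show ?thesis using finH finW W by (simp add: prod.If_cases VHW card_Diff_subset h_def)
      qed
      also have "\<dots> \<le> h ^ h * n ^ (h - card W)" using cW h2 by (intro mult_right_mono power_increasing) auto
      finally have cG: "real (card (G D)) \<le> real h ^ h * real n ^ (h - card W)"
        by (metis of_nat_le_iff of_nat_mult of_nat_power)
      have den: "C * real n \<le> real n ^ card W * p ^ card D" using D W by (intro dense) (auto simp: W_def)
      have "(\<Sum>g\<in>G D. p ^ card (B g \<union> B f)) = real (card (G D)) * p ^ (2 * ?e - card D)" using cu by simp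
      also have "\<dots> \<le> real h ^ h * real n ^ (h - card W) * p ^ (2 * ?e - card D)"
        using cG p0 by (intro mult_right_mono) auto
      also have "\<dots> = real h ^ h * (p ^ ?e * (real n ^ (h - card W) * p ^ (?e - card D)))"
      proof -
        have "2 * ?e - card D = ?e + (?e - card D)" using cD by simp
        then show ?thesis by (simp add: power_add)
      qed
      also have "real n ^ (h - card W) * p ^ (?e - card D) = N / (real n ^ card W * p ^ card D)"
        using cW cD n p0 by (simp add: N_def power_diff)
      also have "real h ^ h * (p ^ ?e * (N / (real n ^ card W * p ^ card D))) \<le> real h ^ h * (p ^ ?e * (N / (C * real n)))"
        using den N0 p0 C1 n1 by (intro mult_left_mono divide_left_mono) (auto intro!: mult_pos_pos)
      finally show "(\<Sum>g\<in>G D. p ^ card (B g \<union> B f)) \<le> real h ^ h * (p ^ ?e * N / (C * real n))" by simp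
    qed
    also have "\<dots> = real (card (Pow EH - {{}})) * (real h ^ h * (p ^ ?e * N / (C * real n)))" by simp
    also have "\<dots> \<le> 2 ^ ?e * (real h ^ h * (p ^ ?e * N / (C * real n)))"
    proof (intro mult_right_mono)
      have "card (Pow EH - {{}}) \<le> card (Pow EH)" using finE by (intro card_mono) auto
      then show "real (card (Pow EH - {{}})) \<le> 2 ^ ?e" using finE by (simp add: card_Pow) 
    qed (use N0 p0 C1 n1 in auto)
    finally show ?thesis by (simp add: K_def h_def)
  qed
  have \<Delta>: "\<Delta> \<le> K * N\<^sup>2 / (C * real n)"
  proof -
    have "\<Delta> \<le> (\<Sum>f\<in>I. K * p ^ ?e * N / (C * real n))" unfolding \<Delta>_def using inner by (rule sum_mono)
    also have "\<dots> = real (card I) * (K * p ^ ?e * N / (C * real n))" by simp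
    also have "\<dots> \<le> real n ^ h * (K * p ^ ?e * N / (C * real n))"
    proof (rule mult_right_mono)
      have "t \<le> card S" by (simp add: t_def)
      also have "card S \<le> n" using S(1) card_mono[of "{0..<n}" S] by simp
      finally have "real t ^ h \<le> real n ^ h" by (intro power_mono) auto
      then show "real (card I) \<le> real n ^ h" using cardI by simp
      show "0 \<le> K * p ^ ?e * N / (C * real n)" using K1 p0 N0 C1 n1 by (intro divide_nonneg_nonneg mult_nonneg_nonneg) auto
    qed
    finally show ?thesis by (simp add: N_def power2_eq_square algebra_simps)
  qed
  \<comment> \<open>The minimiser of \<open>- q \<kappa> N + q^2 K N^2 / (C n)\<close>. The minimum
    is \<open>- \<kappa>^2 C n / (4 K)\<close>, which the choice of \<open>C\<close> turns into
    \<open>- 2 n\<close>; \<open>q \<le> 1\<close> follows from \<open>N \<ge> C n\<close>.\<close>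
  define q where "q = \<kappa> * C * real n / (2 * K * N)"
  have q0: "0 \<le> q" using \<kappa>0 C1 n1 K1 N0 by (simp add: q_def)
  have q1: "q \<le> 1"
  proof -
    have "\<kappa> * (C * real n) \<le> (2 * K) * N" using \<kappa>0 \<kappa>1 N K1 N0 C1 n1 by (intro mult_mono) auto
    then show ?thesis unfolding q_def using K1 N0 by (simp add: divide_le_eq mult.assoc)
  qed
  have "bern (all_edges n) p (\<lambda>E. of_bool (\<not> has_copy_in VH EH E S)) \<le> bern (all_edges n) p (\<lambda>E. of_bool (\<forall>f\<in>I. \<not> B f \<subseteq> E))"
  proof (rule bern_mono)
    fix E
    have "has_copy_in VH EH E S" if "f \<in> I" "B f \<subseteq> E" for f
      unfolding has_copy_in_def using inj[OF that(1)] fS[OF that(1)] that(2) by (intro exI[of _ f]) (auto simp: B_def)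
    then show "(of_bool (\<not> has_copy_in VH EH E S) :: real) \<le> of_bool (\<forall>f\<in>I. \<not> B f \<subseteq> E)" by auto
  qed (use p p0 in auto)
  also have "\<dots> \<le> exp (- q * \<mu> + q\<^sup>2 * \<Delta>)"
    unfolding \<mu>_def \<Delta>_def using finX p0 p(2) finI BX q0 q1 by (intro janson_sampled) auto
  also have "\<dots> \<le> exp (- 2 * real n)"
  proof -
    have "- q * \<mu> \<le> - q * (\<kappa> * N)" using \<mu> q0 by (simp add: mult_left_mono)
    moreover have "q\<^sup>2 * \<Delta> \<le> q\<^sup>2 * (K * N\<^sup>2 / (C * real n))" using \<Delta> by (intro mult_left_mono) auto
    moreover have "q * (\<kappa> * N) = \<kappa>\<^sup>2 * C * real n / (2 * K)"
      unfolding q_def using N0 by (simp add: power2_eq_square field_simps)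
    moreover have "q\<^sup>2 * (K * N\<^sup>2 / (C * real n)) = \<kappa>\<^sup>2 * C * real n / (4 * K)"
      unfolding q_def using N0 K1 C1 n1 by (simp add: power2_eq_square field_simps)
    moreover have "\<kappa>\<^sup>2 * C * real n / (2 * K) = 4 * real n" "\<kappa>\<^sup>2 * C * real n / (4 * K) = 2 * real n"
      unfolding C using K1 \<kappa>0 by (auto simp: field_simps)
    ultimately show ?thesis by simp
  qed
  finally show ?thesis .
qed

lemma gnp_prob_bounds: "0 \<le> p \<Longrightarrow> p \<le> 1 \<Longrightarrow> 0 \<le> gnp_prob n p P \<and> gnp_prob n p P \<le> 1"
proof -
  assume p: "0 \<le> p" "p \<le> 1"
  have "bern (all_edges n) p (\<lambda>E. of_bool (P E)) \<le> bern (all_edges n) p (\<lambda>E. 1)" using p by (intro bern_mono) auto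
  then show ?thesis unfolding gnp_prob_bern using p bern_const[of "all_edges n" p 1]
    by (auto intro!: bern_nonneg simp: all_edges_def)
qed

theorem client_win_one_statement:
  assumes graph: "is_graph VH EH" and ne: "EH \<noteq> {}" and m: "0 < m1 VH EH"
  shows "\<exists>C>0. \<forall>p :: nat \<Rightarrow> real. (\<forall>n. 0 \<le> p n \<and> p n \<le> 1) \<longrightarrow>
    eventually (\<lambda>n. p n \<ge> C * real n powr (- 1 / m1 VH EH)) sequentially \<longrightarrow>
    (\<lambda>n. gnp_prob n (p n) (client_win VH EH b n)) \<longlonglongrightarrow> 1"
proof -
  define K where "K = 2 ^ card EH * real (card VH) ^ card VH"
  define \<kappa> where "\<kappa> = (1 / (2 * real (card VH) * (real b + 1))) ^ card VH"
  define C where "C = 8 * K / \<kappa>\<^sup>2"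
  have "finite VH" using graph by (simp add: is_graph_def)
  moreover have "VH \<noteq> {}" using graph ne by (auto simp: is_graph_def)
  ultimately have "0 < real (card VH)" by (simp add: card_gt_0_iff)
  then have C0: "0 < C" by (simp add: C_def K_def \<kappa>_def)
  show ?thesis
  proof (intro exI[of _ C] conjI C0 allI impI)
    fix p :: "nat \<Rightarrow> real"
    assume p01: "\<forall>n. 0 \<le> p n \<and> p n \<le> 1" and ev: "eventually (\<lambda>n. p n \<ge> C * real n powr (- 1 / m1 VH EH)) sequentially"
    have low: "eventually (\<lambda>n. 1 - (2 * exp (- 2)) ^ n \<le> gnp_prob n (p n) (client_win VH EH b n)) sequentially"
      using ev eventually_ge_at_top[of "max 1 ((b + 1) * card VH)"]
    proof eventually_elim
      case (elim n)
      let ?X = "all_edges n" and ?\<S> = "{S. S \<subseteq> {0..<n} \<and> n \<le> (b + 1) * card S}"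
      have finX: "finite ?X" by (auto simp: all_edges_def)
      have fin\<S>: "finite ?\<S>" by (rule finite_subset[of _ "Pow {0..<n}"]) auto
      have pn: "0 \<le> p n" "p n \<le> 1" using p01 by auto
      \<comment> \<open>A position that is not a win for Client is charged to some copy-free set
        among those he could end with.\<close>
      have "1 - of_bool (client_win VH EH b n E) \<le> (\<Sum>S\<in>?\<S>. of_bool (\<not> has_copy_in VH EH E S) :: real)" for E
      proof (cases "\<exists>S\<in>?\<S>. \<not> has_copy_in VH EH E S")
        case True
        then obtain S where S: "S \<in> ?\<S>" "\<not> has_copy_in VH EH E S" by blast
        have "1 = (of_bool (\<not> has_copy_in VH EH E S) :: real)" using S(2) by simp
        also have "\<dots> \<le> (\<Sum>S\<in>?\<S>. of_bool (\<not> has_copy_in VH EH E S))" using S(1) fin\<S> by (intro member_le_sum) auto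
        finally show ?thesis by (simp add: of_bool_def)
      next
        case False
        then have "client_win VH EH b n E"
          unfolding client_win_def by (intro client_wins_from_large_sets[of _ _ n]) auto
        then show ?thesis by (simp add: sum_nonneg)
      qed
      then have "bern ?X (p n) (\<lambda>E. 1 - of_bool (client_win VH EH b n E)) \<le>
          bern ?X (p n) (\<lambda>E. \<Sum>S\<in>?\<S>. of_bool (\<not> has_copy_in VH EH E S))"
        using pn by (intro bern_mono)
      also have "\<dots> = (\<Sum>S\<in>?\<S>. bern ?X (p n) (\<lambda>E. of_bool (\<not> has_copy_in VH EH E S)))" by (rule bern_sum)
      also have "\<dots> \<le> (\<Sum>S\<in>?\<S>. exp (- 2 * real n))"
      proof (rule sum_mono)
        fix S assume "S \<in> ?\<S>"
        then show "bern ?X (p n) (\<lambda>E. of_bool (\<not> has_copy_in VH EH E S)) \<le> exp (- 2 * real n)"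
          using elim pn by (intro no_copy_bound[OF graph ne m C_def[unfolded K_def \<kappa>_def]]) auto
      qed
      also have "\<dots> \<le> 2 ^ n * exp (- 2 * real n)"
      proof -
        have "card ?\<S> \<le> card (Pow {0..<n})" by (intro card_mono) auto
        then have "real (card ?\<S>) \<le> 2 ^ n" by (simp add: card_Pow)
        then show ?thesis by (simp add: mult_right_mono)
      qed
      also have "\<dots> = (2 * exp (- 2)) ^ n"
        by (simp add: power_mult_distrib exp_of_nat2_mult flip: exp_of_nat_mult)
      finally show ?case using bern_const[OF finX, of "p n" 1] by (simp add: bern_diff gnp_prob_bern)
    qed
    have "(\<lambda>n. 1 - (2 * exp (- 2 :: real)) ^ n) \<longlonglongrightarrow> 1 - 0"
    proof (intro tendsto_diff tendsto_const LIMSEQ_power_zero)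
      have "(2::real) < exp 2" using exp_ge_add_one_self[of "2::real"] by linarith
      then show "norm (2 * exp (- 2 :: real)) < 1" by (simp add: exp_minus field_simps)
    qed
    then have lim: "(\<lambda>n. 1 - (2 * exp (- 2 :: real)) ^ n) \<longlonglongrightarrow> 1" by simp
    have "gnp_prob n (p n) (client_win VH EH b n) \<le> 1" for n using p01 gnp_prob_bounds by blast
    then have up: "eventually (\<lambda>n. gnp_prob n (p n) (client_win VH EH b n) \<le> 1) sequentially" by simp
    show "(\<lambda>n. gnp_prob n (p n) (client_win VH EH b n)) \<longlonglongrightarrow> 1"
      by (rule tendsto_sandwich[OF low up lim tendsto_const])
  qed
qed

section \<open>Exploring dense unions of copies\<close>

lemma sum_UN_le:
  fixes f :: "'b \<Rightarrow> real"
  assumes "finite I" "\<And>i. i \<in> I \<Longrightarrow> finite (A i)" "\<And>x. 0 \<le> f x"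
  shows "sum f (\<Union>i\<in>I. A i) \<le> (\<Sum>i\<in>I. sum f (A i))"
  using assms(1,2)
proof (induction I rule: finite_induct)
  case (insert i I)
  have "sum f (\<Union>i\<in>insert i I. A i) = sum f (A i \<union> (\<Union>i\<in>I. A i))" by simp
  also have "\<dots> \<le> sum f (A i) + sum f (\<Union>i\<in>I. A i)"
    using insert assms(3) by (subst sum_Un) (auto intro!: sum_nonneg)
  also have "\<dots> \<le> sum f (A i) + (\<Sum>i\<in>I. sum f (A i))" using insert by simp
  finally show ?case using insert by simp
qed simp

text \<open>The shape is a graph on \<open>{0..<k}\<close> that is strictly balanced with respect to
  \<open>e / (v - 1)\<close> and has \<open>m1 = k / q\<close>; it is \<open>K_k\<close> for \<open>q = 2\<close> and \<open>C_k\<close> for \<open>q = k - 1\<close>.\<close>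

locale copy_shape =
  fixes k q :: nat and D0 :: "nat set set"
  assumes k2: "2 \<le> k" and q1: "1 \<le> q"
    and shape_edge: "e \<in> D0 \<Longrightarrow> e \<subseteq> {0..<k} \<and> card e = 2"
    and shape_vertices: "\<Union>D0 = {0..<k}"
    and shape_card: "q * card D0 = k * (k - 1)"
    and shape_balanced: "J \<subset> {0..<k} \<Longrightarrow> 2 \<le> card J \<Longrightarrow> q * card {e \<in> D0. e \<subseteq> J} < k * (card J - 1)"
begin

definition embeddings :: "nat \<Rightarrow> (nat \<Rightarrow> nat) set" where
  "embeddings n = {g \<in> PiE {0..<k} (\<lambda>_. {0..<n}). inj_on g {0..<k}}"

definition copy :: "(nat \<Rightarrow> nat) \<Rightarrow> nat set set" where
  "copy g = (\<lambda>e. g ` e) ` D0"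

definition copies :: "nat \<Rightarrow> nat set set set" where
  "copies n = copy ` embeddings n"

definition phi :: "nat set set \<Rightarrow> int" where
  "phi F = int k * int (card (\<Union>F)) - int q * int (card F)"

lemma finite_D0: "finite D0"
  using shape_edge by (meson PowI finite_Pow_iff finite_atLeastLessThan finite_subset subsetI)

lemma finite_embeddings: "finite (embeddings n)"
  unfolding embeddings_def by (rule finite_subset[of _ "PiE {0..<k} (\<lambda>_. {0..<n})"]) (auto intro: finite_PiE)

lemma finite_copies: "finite (copies n)"
  by (simp add: copies_def finite_embeddings)

lemma Union_copy: "\<Union>(copy g) = g ` {0..<k}"
  unfolding copy_def using shape_vertices by blast

lemma copy_facts:
  assumes "A \<in> copies n"
  shows "finite A" "finite (\<Union>A)" "card (\<Union>A) = k" "q * card A = k * (k - 1)" "A \<subseteq> all_edges n"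
    "\<Union>A \<subseteq> {0..<n}" "\<And>e. e \<in> A \<Longrightarrow> card e = 2" "A \<noteq> {}"
    "\<And>J. J \<subset> \<Union>A \<Longrightarrow> 2 \<le> card J \<Longrightarrow> q * card {e \<in> A. e \<subseteq> J} < k * (card J - 1)"
proof -
  obtain g where g: "g \<in> embeddings n" "A = copy g" using assms by (auto simp: copies_def)
  have inj: "inj_on g {0..<k}" using g by (simp add: embeddings_def)
  show "finite A" using g finite_D0 by (simp add: copy_def)
  show "finite (\<Union>A)" "card (\<Union>A) = k" using g Union_copy inj by (simp_all add: card_image)
  show sub: "\<Union>A \<subseteq> {0..<n}" using g Union_copy by (auto simp: embeddings_def PiE_def Pi_def)
  have injD: "inj_on (\<lambda>e. g ` e) D0"
    using inj shape_edge by (intro inj_onI) (metis inj_on_image_eq_iff)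
  then have "card A = card D0" using g by (simp add: copy_def card_image)
  then show "q * card A = k * (k - 1)" using shape_card by simp
  show edge: "card e = 2" if "e \<in> A" for e
    using that g shape_edge inj by (auto simp: copy_def card_image inj_on_subset)
  then show "A \<subseteq> all_edges n" using sub by (auto simp: all_edges_def)
  have "D0 \<noteq> {}" using shape_vertices k2 by auto
  then show "A \<noteq> {}" using g by (simp add: copy_def)
  fix J assume J: "J \<subset> \<Union>A" "2 \<le> card J"
  define J' where "J' = {i \<in> {0..<k}. g i \<in> J}"
  have J': "g ` J' = J" using J(1) g Union_copy by (auto simp: J'_def)
  have injJ: "inj_on g J'" using inj by (rule inj_on_subset) (auto simp: J'_def)
  have cJ: "card J' = card J" using card_image[OF injJ] J' by simp
  have "J' \<noteq> {0..<k}" using J' J(1) g Union_copy by auto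
  then have "J' \<subset> {0..<k}" by (auto simp: J'_def)
  then have "q * card {e \<in> D0. e \<subseteq> J'} < k * (card J - 1)" using shape_balanced[of J'] cJ J(2) by simp
  moreover have "{e \<in> A. e \<subseteq> J} \<subseteq> (\<lambda>e. g ` e) ` {e \<in> D0. e \<subseteq> J'}"
  proof
    fix e assume "e \<in> {e \<in> A. e \<subseteq> J}"
    then obtain e' where e': "e' \<in> D0" "e = g ` e'" "g ` e' \<subseteq> J" using g by (auto simp: copy_def)
    then have "e' \<subseteq> J'" using shape_edge[OF e'(1)] by (auto simp: J'_def)
    then show "e \<in> (\<lambda>e. g ` e) ` {e \<in> D0. e \<subseteq> J'}" using e' by auto
  qed
  then have "card {e \<in> A. e \<subseteq> J} \<le> card {e \<in> D0. e \<subseteq> J'}"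
    using finite_D0 by (intro surj_card_le) auto
  ultimately show "q * card {e \<in> A. e \<subseteq> J} < k * (card J - 1)" by (meson le_less_trans mult_le_mono2)
qed

lemma card_copy_int:
  assumes "A \<in> copies n"
  shows "int q * int (card A) = int k * (int k - 1)"
proof -
  have "int (q * card A) = int (k * (k - 1))" using copy_facts(4)[OF assms] by simp
  then show ?thesis using k2 by (simp add: of_nat_diff)
qed

lemma phi_copy: "A \<in> copies n \<Longrightarrow> phi A = int k"
  using copy_facts(3)[of A n] card_copy_int[of A n] by (simp add: phi_def algebra_simps)

text \<open>Old edges of the copy lie inside the overlap \<open>J\<close>, and strict balance makes
  the remaining edges outweigh the new vertices as soon as a proper overlap \<open>J\<close> has two
  vertices. If \<open>J\<close> is the whole copy, no vertex is new and the missing edge decides. As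
  \<open>phi\<close> is an integer, a strict drop is at least 1.\<close>

lemma phi_drop:
  assumes A: "A \<in> copies n" "\<not> A \<subseteq> F" and F: "finite F" "\<And>e. e \<in> F \<Longrightarrow> card e = 2" "\<Union>A \<inter> \<Union>F \<noteq> {}"
  shows "phi (F \<union> A) \<le> phi F - of_bool (card (\<Union>A \<inter> \<Union>F) \<noteq> 1)"
proof -
  note facts = copy_facts[OF A(1)]
  define J where "J = \<Union>A \<inter> \<Union>F"
  have "finite e" if "e \<in> F" for e using F(2)[OF that] by (metis card.infinite zero_neq_numeral)
  then have finUF: "finite (\<Union>F)" using F(1) by blast
  have finJ: "finite J" using facts by (simp add: J_def)
  have j1: "1 \<le> card J" using F(3) finJ by (simp add: J_def Suc_leI card_gt_0_iff)
  have jk: "card J \<le> k" using facts(2,3) card_mono[of "\<Union>A" J] by (auto simp: J_def)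
  have cF: "card (F \<union> A) = card F + card (A - F)"
    using F facts by (metis Un_Diff_cancel card_Un_disjoint Diff_disjoint finite_Diff)
  have "card (\<Union>(F \<union> A)) = card (\<Union>F) + card (\<Union>A - \<Union>F)"
    using finUF facts card_Un_disjoint[of "\<Union>F" "\<Union>A - \<Union>F"] by simp
  moreover have "card (\<Union>A - \<Union>F) = k - card J"
    using facts finUF by (simp add: J_def card_Diff_subset_Int)
  ultimately have cU: "int (card (\<Union>(F \<union> A))) = int (card (\<Union>F)) + int k - int (card J)" using jk by simp
  have ph: "phi (F \<union> A) = phi F + int k * (int k - int (card J)) - int q * int (card (A - F))"
    unfolding phi_def cU cF by (simp add: algebra_simps)
  have qA: "int q * int (card A) = int k * (int k - 1)"
    using A(1) by (rule card_copy_int)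
  have AF: "int (card A) - int (card {e \<in> A. e \<subseteq> J}) \<le> int (card (A - F))"
  proof -
    have "A - F \<supseteq> A - {e \<in> A. e \<subseteq> J}" by (auto simp: J_def)
    then have "card (A - {e \<in> A. e \<subseteq> J}) \<le> card (A - F)" using facts by (intro card_mono) auto
    moreover have "card (A - {e \<in> A. e \<subseteq> J}) = card A - card {e \<in> A. e \<subseteq> J}" using facts by (intro card_Diff_subset) auto
    ultimately show ?thesis by linarith
  qed
  have qAF: "int k * (int k - 1) - int q * int (card {e \<in> A. e \<subseteq> J}) \<le> int q * int (card (A - F))"
  proof -
    have "int q * (int (card A) - int (card {e \<in> A. e \<subseteq> J})) \<le> int q * int (card (A - F))"
      using AF by (intro mult_left_mono) auto
    then show ?thesis using qA by (simp add: algebra_simps)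
  qed
  show ?thesis
  proof (cases "card J = 1")
    case True
    have "\<not> e \<subseteq> J" if "e \<in> A" for e using facts(7)[OF that] True finJ card_mono[of J e] by auto
    then have none: "{e \<in> A. e \<subseteq> J} = {}" by auto
    have "int k * (int k - 1) \<le> int q * int (card (A - F))" using qAF unfolding none by simp
    then show ?thesis unfolding ph using True by (simp add: J_def)
  next
    case False
    then have j2: "2 \<le> card J" using j1 by linarith
    have "phi (F \<union> A) \<le> phi F - 1"
    proof (cases "J = \<Union>A")
      case True
      have "card (A - F) \<noteq> 0" using A(2) facts by auto
      then have "1 * 1 \<le> int q * int (card (A - F))" using q1 by (intro mult_mono) auto
      then show ?thesis unfolding ph using True facts(3) by simp
    next
      case False
      then have "J \<subset> \<Union>A" by (auto simp: J_def)
      then have "q * card {e \<in> A. e \<subseteq> J} < k * (card J - 1)" using j2 facts(9) by blast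
      then have "int (q * card {e \<in> A. e \<subseteq> J}) < int (k * (card J - 1))" by (rule of_nat_less_iff[THEN iffD2])
      then have "int q * int (card {e \<in> A. e \<subseteq> J}) < int k * (int (card J) - 1)" using j1 by (simp add: of_nat_diff)
      then show ?thesis unfolding ph using qAF by (simp add: algebra_simps)
    qed
    then show ?thesis using False by (simp add: J_def)
  qed
qed

text \<open>A state of the exploration records the vertices in order of discovery, the edges seen, the
  index of the vertex being processed, and the number of copies added that met the explored part
  in more than one vertex.  The index never decreases, which keeps the number of states of a given
  size exponential rather than factorial.\<close>

type_synonym state = "nat list \<times> nat set set \<times> nat \<times> nat"

definition next_state :: "state \<Rightarrow> nat \<Rightarrow> nat set set \<Rightarrow> state" where
  "next_state = (\<lambda>(vs, F, a, t) a' A. (vs @ sorted_list_of_set (\<Union>A - set vs), F \<union> A, a',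
      t + of_bool (card (\<Union>A \<inter> set vs) \<noteq> 1)))"

definition moves :: "nat \<Rightarrow> state \<Rightarrow> (nat \<times> nat set set) set" where
  "moves n = (\<lambda>(vs, F, a, t). {(a', A). a \<le> a' \<and> a' < length vs \<and> A \<in> copies n \<and> \<not> A \<subseteq> F \<and> vs ! a' \<in> \<Union>A})"

primrec states :: "nat \<Rightarrow> nat \<Rightarrow> state set" where
  "states n 0 = (\<lambda>A. (sorted_list_of_set (\<Union>A), A, 0, 0)) ` copies n"
| "states n (Suc s) = (\<Union>\<sigma>\<in>states n s. (\<lambda>(a', A). next_state \<sigma> a' A) ` moves n \<sigma>)"

lemma finite_moves: "finite (moves n \<sigma>)"
proof -
  obtain vs F a t where s: "\<sigma> = (vs, F, a, t)" by (cases \<sigma>)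
  have "moves n \<sigma> \<subseteq> {..<length vs} \<times> copies n" unfolding s by (auto simp: moves_def)
  then show ?thesis using finite_copies by (meson finite_SigmaI finite_lessThan finite_subset)
qed

lemma finite_states: "finite (states n s)"
  by (induction s) (auto simp: finite_copies finite_moves)

lemma states_invariant:
  assumes "(vs, F, a, t) \<in> states n s"
  shows "distinct vs \<and> set vs = \<Union>F \<and> length vs \<le> k * (s + 1) \<and> F \<subseteq> all_edges n \<and> a < length vs"
  using assms
proof (induction s arbitrary: vs F a t)
  case 0
  then obtain A where A: "A \<in> copies n" "vs = sorted_list_of_set (\<Union>A)" "F = A" "a = 0" by auto
  then show ?case using copy_facts[OF A(1)] k2 by auto
next
  case (Suc s)
  then obtain vs' F' a' t' A where st: "(vs', F', a', t') \<in> states n s" and mv: "(a, A) \<in> moves n (vs', F', a', t')"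
    and eq: "(vs, F, a, t) = next_state (vs', F', a', t') a A"
    by (auto simp: next_state_def)
  note IH = Suc.IH[OF st]
  have A: "A \<in> copies n" "a < length vs'" using mv by (auto simp: moves_def)
  note facts = copy_facts[OF A(1)]
  have "card (\<Union>A - set vs') \<le> k" using facts(2,3) card_mono[of "\<Union>A" "\<Union>A - set vs'"] by auto
  then show ?case using IH eq facts A by (auto simp: next_state_def)
qed

section \<open>Weighted counting of exploration states\<close>

text \<open>The summand is a product over the \<open>k\<close> positions of an embedding: an image
  in \<open>L\<close> counts 1, any other \<open>1 / n\<close>, so each position sums to at most
  \<open>card L + 1\<close>. All overlap patterns are covered at once.\<close>

lemma sum_copies_new_vertices:
  assumes n: "1 \<le> n" and L: "finite L"
  shows "(\<Sum>A\<in>copies n. (1 / real n) ^ card (\<Union>A - L)) \<le> (real (card L) + 1) ^ k"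
proof -
  let ?w = "\<lambda>v. if v \<in> L then 1 else 1 / real n"
  have "(\<Sum>A\<in>copies n. (1 / real n) ^ card (\<Union>A - L)) \<le> (\<Sum>g\<in>embeddings n. (1 / real n) ^ card (\<Union>(copy g) - L))"
    unfolding copies_def using finite_embeddings by (intro order_trans[OF sum_image_le]) auto
  also have "\<dots> = (\<Sum>g\<in>embeddings n. \<Prod>i\<in>{0..<k}. ?w (g i))"
  proof (rule sum.cong[OF refl])
    fix g assume "g \<in> embeddings n"
    then have inj: "inj_on g {0..<k}" by (simp add: embeddings_def)
    have "\<Union>(copy g) - L = g ` {i \<in> {0..<k}. g i \<notin> L}" unfolding Union_copy by auto
    then have c: "card (\<Union>(copy g) - L) = card {i \<in> {0..<k}. g i \<notin> L}"
      using inj by (simp add: card_image inj_on_def)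
    have "{0..<k} \<inter> - {i. g i \<in> L} = {i \<in> {0..<k}. g i \<notin> L}" by auto
    then show "(1 / real n) ^ card (\<Union>(copy g) - L) = (\<Prod>i\<in>{0..<k}. ?w (g i))"
      unfolding c by (simp add: prod.If_cases)
  qed
  also have "\<dots> \<le> (\<Sum>g\<in>PiE {0..<k} (\<lambda>_. {0..<n}). \<Prod>i\<in>{0..<k}. ?w (g i))"
    by (intro sum_mono2 finite_PiE prod_nonneg) (auto simp: embeddings_def)
  also have "\<dots> = (\<Prod>i\<in>{0..<k}. \<Sum>v\<in>{0..<n}. ?w v)"
    by (rule prod_sum_PiE[symmetric]) auto
  also have "\<dots> = (\<Sum>v\<in>{0..<n}. ?w v) ^ k" by simp
  also have "\<dots> \<le> (real (card L) + 1) ^ k"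
  proof (intro power_mono sum_nonneg)
    have "(\<Sum>v\<in>{0..<n}. ?w v) \<le> (\<Sum>v\<in>{0..<n}. of_bool (v \<in> L) + 1 / real n)" by (intro sum_mono) auto
    also have "\<dots> = real (card ({0..<n} \<inter> L)) + 1" using n by (simp add: sum.distrib of_bool_def sum.If_cases)
    also have "\<dots> \<le> real (card L) + 1" using L by (simp add: card_mono)
    finally show "(\<Sum>v\<in>{0..<n}. ?w v) \<le> real (card L) + 1" .
  qed auto
  finally show ?thesis .
qed

lemma card_copies_through: "card {A \<in> copies n. v \<in> \<Union>A} \<le> k * n ^ (k - 1)"
proof -
  define P where "P i = PiE {0..<k} (\<lambda>j. if j = i then {v} else {0..<n})" for i
  have finP: "finite (P i)" for i unfolding P_def by (intro finite_PiE) auto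
  have "{A \<in> copies n. v \<in> \<Union>A} \<subseteq> (\<Union>i\<in>{0..<k}. copy ` P i)"
  proof
    fix A assume "A \<in> {A \<in> copies n. v \<in> \<Union>A}"
    then obtain g where g: "g \<in> embeddings n" "A = copy g" and "v \<in> \<Union>A"
      by (auto simp: copies_def)
    then have "v \<in> g ` {0..<k}" by (simp only: Union_copy)
    then obtain i where i: "i < k" "v = g i" by auto
    then have "g \<in> P i" using g by (auto simp: P_def embeddings_def PiE_def Pi_def)
    then show "A \<in> (\<Union>i\<in>{0..<k}. copy ` P i)" using i g by auto
  qed
  then have "card {A \<in> copies n. v \<in> \<Union>A} \<le> card (\<Union>i\<in>{0..<k}. copy ` P i)"
    using finP by (intro card_mono) auto
  also have "\<dots> \<le> (\<Sum>i\<in>{0..<k}. card (copy ` P i))" by (intro card_UN_le) auto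
  also have "\<dots> \<le> (\<Sum>i\<in>{0..<k}. n ^ (k - 1))"
  proof (rule sum_mono)
    fix i assume i: "i \<in> {0..<k}"
    have "card (copy ` P i) \<le> card (P i)" using finP by (rule card_image_le)
    also have "card (P i) = (\<Prod>j\<in>{0..<k}. if j = i then 1 else n)"
      by (simp add: P_def card_PiE if_distrib cong: if_cong)
    also have "\<dots> = n ^ (k - 1)"
      using i by (subst prod.remove[of _ i]) (auto simp: prod.If_cases)
    finally show "card (copy ` P i) \<le> n ^ (k - 1)" .
  qed
  finally show ?thesis by simp
qed

text \<open>Besides the first-moment factor \<open>c ^ e * n ^ (- v)\<close>, dense attachments are
  discounted by \<open>y\<close>, to absorb a number of choices polynomial in the explored size, and
  the processing index by \<open>1 / 2\<close>, so that summing over all admissible next indices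
  costs only a factor 2.\<close>

definition weight :: "real \<Rightarrow> real \<Rightarrow> nat \<Rightarrow> state \<Rightarrow> real" where
  "weight c y n = (\<lambda>(vs, F, a, t). c ^ card F * (1 / real n) ^ length vs * y ^ t * (1 / 2) ^ a)"

lemma weight_nonneg: "0 \<le> c \<Longrightarrow> 0 \<le> y \<Longrightarrow> 0 \<le> weight c y n \<sigma>"
  by (cases \<sigma>) (simp add: weight_def)

lemma sum_half_powers: "(\<Sum>i\<in>{a..<m}. (1 / 2 :: real) ^ (i - a)) \<le> 2"
proof (cases "a \<le> m")
  case True
  have "(\<Sum>i\<in>{a..<m}. (1 / 2 :: real) ^ (i - a)) = (\<Sum>j<m - a. (1 / 2) ^ j)"
    using True by (intro sum.reindex_bij_witness[of _ "\<lambda>j. j + a" "\<lambda>i. i - a"]) auto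
  also have "\<dots> = 2 * (1 - (1 / 2) ^ (m - a))" by (subst sum_gp_strict) (auto simp: field_simps)
  also have "\<dots> \<le> 2" by simp
  finally show ?thesis .
qed simp

text \<open>Attachments along one vertex: at most \<open>k n ^ (k - 1)\<close> copies pass through
  the processed vertex, each contributing at most \<open>c n ^ (- (k - 1))\<close>. All others
  together contribute at most \<open>c\<close>, because \<open>y\<close> cancels the sum over
  overlaps. The geometric series over the next index gives the 2.\<close>

lemma weight_moves:
  assumes st: "(vs, F, a, t) \<in> states n s" and n: "1 \<le> n" and c: "0 < c" "c \<le> 1" and y: "0 < y"
    and y1: "y * (real (k * (s + 1)) + 1) ^ k \<le> 1"
  shows "(\<Sum>(a', A)\<in>moves n (vs, F, a, t). weight c y n (next_state (vs, F, a, t) a' A))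
    \<le> 2 * ((real k + 1) * c) * weight c y n (vs, F, a, t)"
proof -
  note inv = states_invariant[OF st]
  have finF: "finite F" using inv finite_subset[of F "all_edges n"] by (auto simp: all_edges_def)
  define M where "M a' = {A \<in> copies n. \<not> A \<subseteq> F \<and> vs ! a' \<in> \<Union>A}" for a'
  define x where "x A = c ^ card (A - F) * (1 / real n) ^ card (\<Union>A - set vs) * y ^ of_bool (card (\<Union>A \<inter> set vs) \<noteq> 1)" for A :: "nat set set"
  let ?W = "weight c y n (vs, F, a, t)"
  have W0: "0 \<le> ?W" using c y by (intro weight_nonneg) auto
  have finM: "finite (M a')" for a' using finite_copies by (simp add: M_def)
  have mv: "moves n (vs, F, a, t) = (SIGMA a':{a..<length vs}. M a')" by (auto simp: moves_def M_def)
  have nxt: "weight c y n (next_state (vs, F, a, t) a' A) = ?W * ((1 / 2) ^ (a' - a) * x A)"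
    if "a' \<in> {a..<length vs}" "A \<in> M a'" for a' A
  proof -
    have A: "A \<in> copies n" using that by (simp add: M_def)
    have "card (F \<union> A) = card F + card (A - F)"
      using finF copy_facts(1)[OF A] by (metis Un_Diff_cancel card_Un_disjoint Diff_disjoint finite_Diff)
    moreover have "(1 / 2 :: real) ^ a' = (1 / 2) ^ a * (1 / 2) ^ (a' - a)" using that by (simp flip: power_add)
    ultimately show ?thesis by (simp add: next_state_def weight_def x_def power_add)
  qed
  have xsum: "(\<Sum>A\<in>M a'. x A) \<le> (real k + 1) * c" if a': "a' < length vs" for a'
  proof -
    have "(\<Sum>A\<in>M a'. x A) \<le> (\<Sum>A\<in>M a'. c * (1 / real n) ^ (k - 1) + c * y * (1 / real n) ^ card (\<Union>A - set vs))"
    proof (rule sum_mono)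
      fix A assume "A \<in> M a'"
      then have A: "A \<in> copies n" "\<not> A \<subseteq> F" by (auto simp: M_def)
      note facts = copy_facts[OF A(1)]
      have "card (A - F) \<noteq> 0" using A facts by auto
      then have cF: "c ^ card (A - F) \<le> c" using c power_decreasing[of 1 "card (A - F)" c] by simp
      show "x A \<le> c * (1 / real n) ^ (k - 1) + c * y * (1 / real n) ^ card (\<Union>A - set vs)"
      proof (cases "card (\<Union>A \<inter> set vs) = 1")
        case True
        then have "card (\<Union>A - set vs) = k - 1" using facts by (simp add: card_Diff_subset_Int)
        then have "x A \<le> c * (1 / real n) ^ (k - 1)" using cF True by (simp add: x_def mult_right_mono divide_right_mono)
        moreover have "0 \<le> c * y * (1 / real n) ^ card (\<Union>A - set vs)" using c y by simp
        ultimately show ?thesis by linarith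
      next
        case False
        then have "x A = c ^ card (A - F) * (y * (1 / real n) ^ card (\<Union>A - set vs))" by (simp add: x_def)
        also have "\<dots> \<le> c * (y * (1 / real n) ^ card (\<Union>A - set vs))" using cF y by (intro mult_right_mono) auto
        finally show ?thesis using c by (simp add: mult.assoc add_increasing)
      qed
    qed
    also have "\<dots> = real (card (M a')) * (c * (1 / real n) ^ (k - 1)) + c * y * (\<Sum>A\<in>M a'. (1 / real n) ^ card (\<Union>A - set vs))"
      by (simp add: sum.distrib sum_distrib_left)
    also have "\<dots> \<le> real (k * n ^ (k - 1)) * (c * (1 / real n) ^ (k - 1)) + c * y * (\<Sum>A\<in>copies n. (1 / real n) ^ card (\<Union>A - set vs))"
    proof (intro add_mono mult_right_mono mult_left_mono)
      have "card (M a') \<le> card {A \<in> copies n. vs ! a' \<in> \<Union>A}" using finite_copies by (intro card_mono) (auto simp: M_def)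
      also have "\<dots> \<le> k * n ^ (k - 1)" by (rule card_copies_through)
      finally show "real (card (M a')) \<le> real (k * n ^ (k - 1))" by (rule of_nat_mono)
      show "(\<Sum>A\<in>M a'. (1 / real n) ^ card (\<Union>A - set vs)) \<le> (\<Sum>A\<in>copies n. (1 / real n) ^ card (\<Union>A - set vs))"
        using finite_copies by (intro sum_mono2) (auto simp: M_def)
    qed (use c y in auto)
    also have "real (k * n ^ (k - 1)) * (c * (1 / real n) ^ (k - 1)) = real k * c"
      using n by (simp add: power_divide)
    also have "(\<Sum>A\<in>copies n. (1 / real n) ^ card (\<Union>A - set vs)) \<le> (real (k * (s + 1)) + 1) ^ k"
    proof -
      have "card (set vs) \<le> k * (s + 1)" using inv distinct_card[of vs] by auto
      then have "(real (card (set vs)) + 1) ^ k \<le> (real (k * (s + 1)) + 1) ^ k"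
        by (intro power_mono add_right_mono of_nat_mono) auto
      then show ?thesis using sum_copies_new_vertices[OF n, of "set vs"] by simp
    qed
    also have "real k * c + c * y * (real (k * (s + 1)) + 1) ^ k \<le> real k * c + c * 1"
      using y1 c by (simp only: mult.assoc) (intro add_left_mono mult_left_mono, auto)
    finally show ?thesis using c y by (simp add: algebra_simps)
  qed
  have "(\<Sum>(a', A)\<in>moves n (vs, F, a, t). weight c y n (next_state (vs, F, a, t) a' A)) =
    (\<Sum>a'\<in>{a..<length vs}. \<Sum>A\<in>M a'. weight c y n (next_state (vs, F, a, t) a' A))"
    unfolding mv using finM by (intro sum.Sigma[symmetric]) auto
  also have "\<dots> = (\<Sum>a'\<in>{a..<length vs}. \<Sum>A\<in>M a'. ?W * ((1 / 2) ^ (a' - a) * x A))"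
    using nxt by (intro sum.cong refl) auto
  also have "\<dots> = (\<Sum>a'\<in>{a..<length vs}. (?W * (1 / 2) ^ (a' - a)) * (\<Sum>A\<in>M a'. x A))"
    by (simp add: sum_distrib_left mult.assoc)
  also have "\<dots> \<le> (\<Sum>a'\<in>{a..<length vs}. (?W * (1 / 2) ^ (a' - a)) * ((real k + 1) * c))"
    using xsum W0 by (intro sum_mono mult_left_mono) auto
  also have "\<dots> = (\<Sum>a'\<in>{a..<length vs}. (1 / 2) ^ (a' - a)) * (?W * ((real k + 1) * c))"
    unfolding sum_distrib_right by (intro sum.cong refl) (simp only: ac_simps)
  also have "\<dots> \<le> 2 * (?W * ((real k + 1) * c))"
    using sum_half_powers W0 c by (intro mult_right_mono) auto
  finally show ?thesis by (simp add: algebra_simps)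
qed

lemma total_weight:
  assumes n: "1 \<le> n" and c: "0 < c" "c \<le> 1" and y: "0 < y" "y \<le> 1"
    and y1: "y * (real (k * (s0 + 1)) + 1) ^ k \<le> 1" and "s \<le> s0"
  shows "(\<Sum>\<sigma>\<in>states n s. weight c y n \<sigma>) \<le> (2 * ((real k + 1) * c)) ^ s"
  using \<open>s \<le> s0\<close>
proof (induction s)
  case 0
  have "(\<Sum>\<sigma>\<in>states n 0. weight c y n \<sigma>) \<le> (\<Sum>A\<in>copies n. weight c y n (sorted_list_of_set (\<Union>A), A, 0, 0))"
    unfolding states.simps using finite_copies c y
    by (intro order_trans[OF sum_image_le]) (auto simp: weight_nonneg)
  also have "\<dots> \<le> (\<Sum>A\<in>copies n. (1 / real n) ^ card (\<Union>A - {}))"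
  proof (rule sum_mono)
    fix A assume "A \<in> copies n"
    have "c ^ card A * (1 / real n) ^ card (\<Union>A) \<le> 1 * (1 / real n) ^ card (\<Union>A)"
      using c by (intro mult_right_mono power_le_one) auto
    then show "weight c y n (sorted_list_of_set (\<Union>A), A, 0, 0) \<le> (1 / real n) ^ card (\<Union>A - {})"
      by (simp add: weight_def)
  qed
  also have "\<dots> \<le> (real (card ({} :: nat set)) + 1) ^ k" using n by (intro sum_copies_new_vertices) auto
  finally show ?case by simp
next
  case (Suc s)
  have y1': "y * (real (k * (s + 1)) + 1) ^ k \<le> 1"
  proof -
    have "(real (k * (s + 1)) + 1) ^ k \<le> (real (k * (s0 + 1)) + 1) ^ k"
      using Suc.prems by (intro power_mono add_right_mono of_nat_mono mult_le_mono) auto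
    then have "y * (real (k * (s + 1)) + 1) ^ k \<le> y * (real (k * (s0 + 1)) + 1) ^ k" using y by (intro mult_left_mono) auto
    then show ?thesis using y1 by linarith
  qed
  have "(\<Sum>\<sigma>\<in>states n (Suc s). weight c y n \<sigma>) \<le>
    (\<Sum>\<sigma>\<in>states n s. \<Sum>\<sigma>'\<in>(\<lambda>(a', A). next_state \<sigma> a' A) ` moves n \<sigma>. weight c y n \<sigma>')"
    unfolding states.simps using finite_states finite_moves c y by (intro sum_UN_le) (auto simp: weight_nonneg)
  also have "\<dots> \<le> (\<Sum>\<sigma>\<in>states n s. 2 * ((real k + 1) * c) * weight c y n \<sigma>)"
  proof (rule sum_mono)
    fix \<sigma> assume \<sigma>: "\<sigma> \<in> states n s"
    obtain vs F a t where eq: "\<sigma> = (vs, F, a, t)" by (cases \<sigma>)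
    have "(\<Sum>\<sigma>'\<in>(\<lambda>(a', A). next_state \<sigma> a' A) ` moves n \<sigma>. weight c y n \<sigma>') \<le>
        (\<Sum>m\<in>moves n \<sigma>. weight c y n ((\<lambda>(a', A). next_state \<sigma> a' A) m))"
      using finite_moves c y by (intro order_trans[OF sum_image_le]) (auto simp: weight_nonneg)
    also have "\<dots> = (\<Sum>(a', A)\<in>moves n \<sigma>. weight c y n (next_state \<sigma> a' A))"
      by (intro sum.cong) auto
    also have "\<dots> \<le> 2 * ((real k + 1) * c) * weight c y n \<sigma>"
      unfolding eq using \<sigma> eq n c y y1' by (intro weight_moves) auto
    finally show "(\<Sum>\<sigma>'\<in>(\<lambda>(a', A). next_state \<sigma> a' A) ` moves n \<sigma>. weight c y n \<sigma>') \<le> 2 * ((real k + 1) * c) * weight c y n \<sigma>" .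
  qed
  also have "\<dots> = 2 * ((real k + 1) * c) * (\<Sum>\<sigma>\<in>states n s. weight c y n \<sigma>)" by (simp add: sum_distrib_left)
  also have "\<dots> \<le> 2 * ((real k + 1) * c) * (2 * ((real k + 1) * c)) ^ s"
    using Suc c by (intro mult_left_mono) auto
  finally show ?case by simp
qed

text \<open>Removing the artificial discounts costs \<open>y ^ (- T)\<close> and
  \<open>2 ^ a\<close>, where \<open>a\<close> is below the number of explored vertices, itself at
  most \<open>k (s + 1)\<close>. The latter cost is exponential in \<open>s\<close>, so a small
  enough \<open>c\<close> absorbs it.\<close>

lemma sum_states:
  assumes n: "1 \<le> n" and c: "0 < c" "c \<le> 1" and y: "0 < y" "y \<le> 1"
    and y1: "y * (real (k * (s0 + 1)) + 1) ^ k \<le> 1" and "s \<le> s0"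
  shows "(\<Sum>(vs, F, a, t)\<in>{(vs, F, a, t) \<in> states n s. t \<le> T}. c ^ card F * (1 / real n) ^ card (\<Union>F))
    \<le> (1 / y) ^ T * 2 ^ k * (2 ^ (k + 1) * ((real k + 1) * c)) ^ s"
proof -
  have le: "c ^ card F * (1 / real n) ^ card (\<Union>F) \<le> (1 / y) ^ T * 2 ^ (k * (s + 1)) * weight c y n (vs, F, a, t)"
    if st: "(vs, F, a, t) \<in> states n s" "t \<le> T" for vs F a t
  proof -
    note inv = states_invariant[OF st(1)]
    have len: "length vs = card (\<Union>F)" using inv distinct_card by metis
    have "y ^ T \<le> y ^ t" using y st by (intro power_decreasing) auto
    then have "1 \<le> (1 / y) ^ T * y ^ t" using y by (simp add: power_divide field_simps)
    moreover have "(2::real) ^ a \<le> 2 ^ (k * (s + 1))" using inv by (intro power_increasing) auto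
    then have "1 \<le> 2 ^ (k * (s + 1)) * (1 / 2 :: real) ^ a" by (simp add: power_divide field_simps)
    ultimately have "1 * 1 \<le> ((1 / y) ^ T * y ^ t) * (2 ^ (k * (s + 1)) * (1 / 2) ^ a)" by (intro mult_mono) auto
    then have "c ^ card F * (1 / real n) ^ length vs * 1 \<le> c ^ card F * (1 / real n) ^ length vs * (((1 / y) ^ T * y ^ t) * (2 ^ (k * (s + 1)) * (1 / 2) ^ a))"
      using c by (intro mult_left_mono) auto
    then show ?thesis by (simp only: weight_def len prod.case mult_1_right ac_simps)
  qed
  have "(\<Sum>(vs, F, a, t)\<in>{(vs, F, a, t) \<in> states n s. t \<le> T}. c ^ card F * (1 / real n) ^ card (\<Union>F)) \<le>
    (\<Sum>\<sigma>\<in>{(vs, F, a, t) \<in> states n s. t \<le> T}. (1 / y) ^ T * 2 ^ (k * (s + 1)) * weight c y n \<sigma>)"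
    using le by (intro sum_mono) auto
  also have "\<dots> \<le> (\<Sum>\<sigma>\<in>states n s. (1 / y) ^ T * 2 ^ (k * (s + 1)) * weight c y n \<sigma>)"
    using finite_states c y by (intro sum_mono2) (auto intro!: mult_nonneg_nonneg simp: weight_nonneg)
  also have "\<dots> = (1 / y) ^ T * 2 ^ (k * (s + 1)) * (\<Sum>\<sigma>\<in>states n s. weight c y n \<sigma>)" by (simp add: sum_distrib_left)
  also have "\<dots> \<le> (1 / y) ^ T * 2 ^ (k * (s + 1)) * (2 * ((real k + 1) * c)) ^ s"
    using total_weight[OF assms] y by (intro mult_left_mono) auto
  also have "\<dots> = (1 / y) ^ T * 2 ^ k * (2 ^ (k + 1) * ((real k + 1) * c)) ^ s"
    by (simp add: power_mult_distrib power_add power_mult flip: power_mult)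
  finally show ?thesis .
qed

section \<open>From dense families to dense states\<close>

text \<open>While \<open>phi \<ge> 0\<close> the explored part is not yet everything, so
  connectedness offers another copy, and the first vertex with an unseen copy is processed next. All
  copies through earlier vertices are present already, so the index never decreases. Each dense
  attachment lowers \<open>phi\<close> from its initial value \<open>k\<close>, so at most
  \<open>k + 1\<close> of them occur until \<open>phi\<close> first turns negative.\<close>

lemma exploration_finds_dense_state:
  assumes \<F>: "\<F> \<subseteq> copies n" "\<F> \<noteq> {}" "linked Union \<F>" "phi (\<Union>\<F>) < 0"
  shows "(\<exists>s'\<le>s. \<exists>(vs, F, a, t)\<in>states n s'. F \<subseteq> \<Union>\<F> \<and> t \<le> k + 1 \<and> phi F < 0) \<or>
    (\<exists>(vs, F, a, t)\<in>states n s. F = \<Union>{A \<in> \<F>. A \<subseteq> F} \<and> 0 \<le> phi F \<and> phi F \<le> int k - int t \<and>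
      (\<forall>A\<in>\<F>. A \<subseteq> F \<or> \<Union>A \<inter> set (take a vs) = {}))"
proof (induction s)
  case 0
  obtain A0 where A0: "A0 \<in> \<F>" using \<F>(2) by auto
  then have A0': "A0 \<in> copies n" using \<F>(1) by auto
  have "A0 = \<Union>{A \<in> \<F>. A \<subseteq> A0}" using A0 by auto
  then have "\<exists>(vs, F, a, t)\<in>states n 0. F = \<Union>{A \<in> \<F>. A \<subseteq> F} \<and> 0 \<le> phi F \<and> phi F \<le> int k - int t \<and>
      (\<forall>A\<in>\<F>. A \<subseteq> F \<or> \<Union>A \<inter> set (take a vs) = {})"
    using A0' phi_copy[OF A0'] by (auto intro!: bexI[of _ A0])
  then show ?case by blast
next
  case (Suc s)
  from Suc.IH show ?case
  proof
    assume "\<exists>s'\<le>s. \<exists>(vs, F, a, t)\<in>states n s'. F \<subseteq> \<Union>\<F> \<and> t \<le> k + 1 \<and> phi F < 0"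
    then show ?thesis by (meson le_SucI)
  next
    assume "\<exists>(vs, F, a, t)\<in>states n s. F = \<Union>{A \<in> \<F>. A \<subseteq> F} \<and> 0 \<le> phi F \<and> phi F \<le> int k - int t \<and>
      (\<forall>A\<in>\<F>. A \<subseteq> F \<or> \<Union>A \<inter> set (take a vs) = {})"
    then obtain vs F a t where st: "(vs, F, a, t) \<in> states n s" and F: "F = \<Union>{A \<in> \<F>. A \<subseteq> F}"
      and ph: "0 \<le> phi F" "phi F \<le> int k - int t" and old: "\<forall>A\<in>\<F>. A \<subseteq> F \<or> \<Union>A \<inter> set (take a vs) = {}"
      by auto
    note inv = states_invariant[OF st]
    define \<G> where "\<G> = {A \<in> \<F>. A \<subseteq> F}"
    have "F \<noteq> {}" using inv by auto
    then have "\<G> \<noteq> {}" using F unfolding \<G>_def by (metis Union_empty)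
    moreover have "\<G> \<subset> \<F>"
    proof -
      have "\<Union>\<G> = F" using F by (simp add: \<G>_def)
      then have "\<G> \<noteq> \<F>" using \<F>(4) ph(1) by auto
      then show ?thesis by (auto simp: \<G>_def)
    qed
    ultimately obtain A1 where A1: "A1 \<in> \<F> - \<G>" "\<Union>A1 \<inter> \<Union>(Union ` \<G>) \<noteq> {}"
      using \<F>(3) unfolding linked_def by meson
    have "\<Union>(Union ` \<G>) = \<Union>(\<Union>\<G>)" by auto
    then have "\<Union>(Union ` \<G>) = \<Union>F" using F by (simp add: \<G>_def)
    then obtain x where x: "x \<in> \<Union>A1" "x \<in> set vs" using A1 inv by auto
    then obtain i0 where i0: "i0 < length vs" "vs ! i0 = x" by (auto simp: in_set_conv_nth)
    define hit where "hit i \<longleftrightarrow> i < length vs \<and> (\<exists>A\<in>\<F>. \<not> A \<subseteq> F \<and> vs ! i \<in> \<Union>A)" for i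
    define a' where "a' = (LEAST i. hit i)"
    have "hit i0" using i0 x A1 by (auto simp: hit_def \<G>_def)
    then have hit: "hit a'" unfolding a'_def by (rule LeastI)
    then obtain A where A: "A \<in> \<F>" "\<not> A \<subseteq> F" "vs ! a' \<in> \<Union>A" "a' < length vs" by (auto simp: hit_def)
    have nohit: "\<not> hit i" if "i < a'" for i using that not_less_Least unfolding a'_def by blast
    have "a \<le> a'"
    proof (rule ccontr)
      assume "\<not> a \<le> a'"
      then have "vs ! a' \<in> set (take a vs)" using A(4) by (auto simp: in_set_conv_nth intro!: exI[of _ a'])
      then show False using old A by blast
    qed
    then have mv: "(a', A) \<in> moves n (vs, F, a, t)" using A \<F>(1) by (auto simp: moves_def)
    define vs' F' t' where "vs' = vs @ sorted_list_of_set (\<Union>A - set vs)" and "F' = F \<union> A"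
      and "t' = t + of_bool (card (\<Union>A \<inter> set vs) \<noteq> 1)"
    have "next_state (vs, F, a, t) a' A = (vs', F', a', t')" by (simp add: next_state_def vs'_def F'_def t'_def)
    then have st': "(vs', F', a', t') \<in> states n (Suc s)" using st mv by force
    have AC: "A \<in> copies n" using A \<F>(1) by auto
    have meets: "\<Union>A \<inter> \<Union>F \<noteq> {}"
    proof -
      have "vs ! a' \<in> \<Union>F" using A(4) inv nth_mem by metis
      then show ?thesis using A(3) by blast
    qed
    have finF: "finite F" using inv finite_subset[of F "all_edges n"] by (auto simp: all_edges_def)
    have "phi F' \<le> phi F - of_bool (card (\<Union>A \<inter> \<Union>F) \<noteq> 1)"
      unfolding F'_def using AC A(2) finF meets inv by (intro phi_drop) (auto simp: all_edges_def)
    then have ph': "phi F' \<le> int k - int t'" using ph(2) inv by (auto simp: t'_def of_bool_def split: if_splits)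
    have sub: "F' \<subseteq> \<Union>\<F>" using F A(1) by (auto simp: F'_def)
    show ?thesis
    proof (cases "phi F' < 0")
      case True
      have "t' \<le> k + 1" using ph by (auto simp: t'_def of_bool_def)
      then show ?thesis using True sub st' by blast
    next
      case False
      have "F' = \<Union>{B \<in> \<F>. B \<subseteq> F'}"
      proof
        have "{A \<in> \<F>. A \<subseteq> F} \<subseteq> {B \<in> \<F>. B \<subseteq> F'}" "A \<in> {B \<in> \<F>. B \<subseteq> F'}" using A(1) by (auto simp: F'_def)
        then show "F' \<subseteq> \<Union>{B \<in> \<F>. B \<subseteq> F'}" using F unfolding F'_def by blast
      qed auto
      moreover have "\<forall>B\<in>\<F>. B \<subseteq> F' \<or> \<Union>B \<inter> set (take a' vs') = {}"
      proof (intro ballI disjCI)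
        fix B assume B: "B \<in> \<F>" and ne: "\<Union>B \<inter> set (take a' vs') \<noteq> {}"
        have "take a' vs' = take a' vs" using A(4) by (simp add: vs'_def)
        then obtain x where x: "x \<in> \<Union>B" "x \<in> set (take a' vs)" using ne by auto
        then obtain i where i: "i < a'" "vs ! i = x" using A(4) by (auto simp: in_set_conv_nth)
        then show "B \<subseteq> F'" using nohit[OF i(1)] A(4) B x(1) by (auto simp: hit_def F'_def)
      qed
      ultimately show ?thesis using False ph' st' by (intro disjI2 bexI[OF _ st']) auto
    qed
  qed
qed

definition dense_family :: "nat \<Rightarrow> nat set set \<Rightarrow> bool" where
  "dense_family n E \<longleftrightarrow> (\<exists>\<F>. \<F> \<subseteq> copies n \<and> \<Union>\<F> \<subseteq> E \<and> \<F> \<noteq> {} \<and> linked Union \<F> \<and> phi (\<Union>\<F>) < 0)"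

text \<open>The exponent of \<open>n\<close> in \<open>p ^ e\<close> is
  \<open>- q e / k = - v + phi / k\<close>: at the threshold density the first moment depends on
  \<open>phi\<close> alone, up to powers of \<open>c\<close>.\<close>

lemma edge_power_bound:
  assumes n: "1 \<le> n" and p: "0 \<le> p" "p \<le> c * real n powr (- (real q / real k))" and c: "0 < c"
  shows "p ^ card F \<le> c ^ card F * (1 / real n) ^ card (\<Union>F) * real n powr (real_of_int (phi F) / real k)"
proof -
  have n0: "0 < real n" using n by simp
  have "p ^ card F \<le> (c * real n powr (- (real q / real k))) ^ card F" using p by (intro power_mono) auto
  also have "\<dots> = c ^ card F * (real n powr (- (real q / real k))) ^ card F" by (rule power_mult_distrib)
  also have "(real n powr (- (real q / real k))) ^ card F = real n powr (- (real q / real k) * real (card F))"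
    using n0 by (simp add: powr_powr flip: powr_realpow)
  also have "- (real q / real k) * real (card F) = - real (card (\<Union>F)) + real_of_int (phi F) / real k"
    using k2 by (simp add: phi_def field_simps)
  also have "real n powr \<dots> = (1 / real n) ^ card (\<Union>F) * real n powr (real_of_int (phi F) / real k)"
    using n0 by (simp add: powr_diff powr_realpow power_one_over)
  finally show ?thesis by (simp add: mult.assoc)
qed

text \<open>A state with \<open>phi \<le> - 1\<close> within \<open>s0\<close> steps gains
  \<open>n powr (- 1 / k)\<close>. A state that survives \<open>s0\<close> steps has
  \<open>phi \<le> k\<close>, hence a factor of at most \<open>n\<close>, against a decay of
  \<open>(1 / 4) ^ s0 \<le> n ^ (- 2)\<close>. The polylogarithmic factor comes from undoing
  \<open>y\<close>.\<close>

lemma dense_family_probability: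
  assumes n: "2 \<le> n" and c: "c = 1 / ((real k + 1) * 2 ^ (k + 3))"
    and p: "0 \<le> p" "p \<le> 1" "p \<le> c * real n powr (- (real q / real k))"
  shows "bern (all_edges n) p (\<lambda>E. of_bool (dense_family n E)) \<le>
    3 * 2 ^ k * (real k * (log 2 (real n) + 2) + 1) ^ (k * (k + 1)) * real n powr (- 1 / real k)"
proof -
  define s0 where "s0 = nat \<lceil>log 2 (real n)\<rceil>"
  define y where "y = 1 / (real (k * (s0 + 1)) + 1) ^ k"
  have n0: "0 < real n" "1 \<le> n" using n by auto
  have log0: "0 \<le> log 2 (real n)" using n by simp
  have s0_up: "real s0 \<le> log 2 (real n) + 1" unfolding s0_def using log0 by linarith
  have "log 2 (real n) \<le> real s0" unfolding s0_def using log0 by linarith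
  then have n_le: "real n \<le> 2 ^ s0"
    using n0 by (simp add: log_le_iff powr_realpow)
  have c01: "0 < c" "c \<le> 1"
  proof -
    have "1 * 1 \<le> (real k + 1) * 2 ^ (k + 3)" by (intro mult_mono one_le_power) auto
    then show "0 < c" "c \<le> 1" unfolding c by (auto simp: divide_le_eq)
  qed
  \<comment> \<open>The constant \<open>c\<close> is chosen to make the growth per step
    \<open>1 / 4\<close>, with the factor \<open>2 ^ k\<close> for the processing index
    included.\<close>
  have ratio: "2 ^ (k + 1) * ((real k + 1) * c) = 1 / 4"
  proof -
    have "real k + 1 \<noteq> 0" by linarith
    then have "(real k + 1) * c = 1 / 2 ^ (k + 3)" unfolding c by simp
    then show ?thesis by (simp add: power_add)
  qed
  have y01: "0 < y" "y \<le> 1" "y * (real (k * (s0 + 1)) + 1) ^ k \<le> 1"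
  proof -
    have "1 \<le> (real (k * (s0 + 1)) + 1) ^ k" by (intro one_le_power) auto
    then have "0 < (real (k * (s0 + 1)) + 1) ^ k" by linarith
    then show "0 < y" "y \<le> 1" "y * (real (k * (s0 + 1)) + 1) ^ k \<le> 1"
      unfolding y_def using \<open>1 \<le> (real (k * (s0 + 1)) + 1) ^ k\<close> by (simp_all add: divide_le_eq)
  qed
  define R where "R = (1 / y) ^ (k + 1) * 2 ^ k"
  have R0: "0 \<le> R" using y01 by (simp add: R_def)
  have states_sum: "(\<Sum>(vs, F, a, t)\<in>{(vs, F, a, t) \<in> states n s. t \<le> k + 1}. c ^ card F * (1 / real n) ^ card (\<Union>F)) \<le> R * (1 / 4) ^ s"
    if "s \<le> s0" for s
    using sum_states[OF n0(2) c01 y01 that, of "k + 1"] unfolding ratio R_def .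
  let ?X = "all_edges n"
  have finX: "finite ?X" by (auto simp: all_edges_def)
  define Z where "Z m s = {(vs, F, a, t) \<in> states n s. t \<le> k + 1 \<and> phi F \<le> m}" for m s
  have finZ: "finite (Z m s)" for m s using finite_states[of n s] by (rule rev_finite_subset) (auto simp: Z_def)
  define ind where "ind E \<sigma> = (of_bool (fst (snd \<sigma>) \<subseteq> E) :: real)" for E and \<sigma> :: state
  have ind0: "0 \<le> ind E \<sigma>" for E \<sigma> by (simp add: ind_def)
  have Zsum: "(\<Sum>\<sigma>\<in>Z m s. p ^ card (fst (snd \<sigma>))) \<le> real n powr (real_of_int m / real k) * (R * (1 / 4) ^ s)" if s: "s \<le> s0" for m s
  proof -
    have "(\<Sum>\<sigma>\<in>Z m s. p ^ card (fst (snd \<sigma>))) \<le>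
      (\<Sum>(vs, F, a, t)\<in>Z m s. real n powr (real_of_int m / real k) * (c ^ card F * (1 / real n) ^ card (\<Union>F)))"
    proof (rule sum_mono)
      fix \<sigma> assume \<sigma>: "\<sigma> \<in> Z m s"
      obtain vs F a t where eq: "\<sigma> = (vs, F, a, t)" by (cases \<sigma>)
      have "phi F \<le> m" using \<sigma> eq by (auto simp: Z_def)
      then have "real n powr (real_of_int (phi F) / real k) \<le> real n powr (real_of_int m / real k)"
        using n by (intro powr_mono divide_right_mono) auto
      then have "c ^ card F * (1 / real n) ^ card (\<Union>F) * real n powr (real_of_int (phi F) / real k) \<le>
         c ^ card F * (1 / real n) ^ card (\<Union>F) * real n powr (real_of_int m / real k)"
        using c01 by (intro mult_left_mono) auto
      then show "p ^ card (fst (snd \<sigma>)) \<le> (case \<sigma> of (vs, F, a, t) \<Rightarrow> real n powr (real_of_int m / real k) * (c ^ card F * (1 / real n) ^ card (\<Union>F)))"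
        using edge_power_bound[OF n0(2) p(1,3) c01(1), of F] by (simp add: eq mult.commute)
    qed
    also have "\<dots> \<le> (\<Sum>(vs, F, a, t)\<in>{(vs, F, a, t) \<in> states n s. t \<le> k + 1}. real n powr (real_of_int m / real k) * (c ^ card F * (1 / real n) ^ card (\<Union>F)))"
    proof (rule sum_mono2)
      show "finite {(vs, F, a, t) \<in> states n s. t \<le> k + 1}" using finite_states[of n s] by (rule rev_finite_subset) auto
    qed (use c01 in \<open>auto simp: Z_def\<close>)
    also have "\<dots> = real n powr (real_of_int m / real k) * (\<Sum>(vs, F, a, t)\<in>{(vs, F, a, t) \<in> states n s. t \<le> k + 1}. c ^ card F * (1 / real n) ^ card (\<Union>F))"
      unfolding sum_distrib_left by (intro sum.cong) auto
    also have "\<dots> \<le> real n powr (real_of_int m / real k) * (R * (1 / 4) ^ s)"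
      using states_sum[OF s] by (intro mult_left_mono) auto
    finally show ?thesis .
  qed
  have bernZ: "bern ?X p (\<lambda>E. \<Sum>\<sigma>\<in>Z m s. ind E \<sigma>) = (\<Sum>\<sigma>\<in>Z m s. p ^ card (fst (snd \<sigma>)))" for m s
    unfolding bern_sum
  proof (rule sum.cong[OF refl])
    fix \<sigma> assume \<sigma>: "\<sigma> \<in> Z m s"
    obtain vs F a t where eq: "\<sigma> = (vs, F, a, t)" by (cases \<sigma>)
    have "(vs, F, a, t) \<in> states n s" using \<sigma> eq by (auto simp: Z_def)
    then have "F \<subseteq> ?X" using states_invariant by blast
    then show "bern ?X p (\<lambda>E. ind E \<sigma>) = p ^ card (fst (snd \<sigma>))"
      unfolding ind_def eq using bern_superset[OF finX] by simp
  qed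
  have dom: "of_bool (dense_family n E) \<le> (\<Sum>s\<le>s0. \<Sum>\<sigma>\<in>Z (- 1) s. ind E \<sigma>) + (\<Sum>\<sigma>\<in>Z (int k) s0. ind E \<sigma>)" for E
  proof (cases "dense_family n E")
    case False
    then show ?thesis using ind0 by (simp add: sum_nonneg)
  next
    case True
    then obtain \<F> where \<F>: "\<F> \<subseteq> copies n" "\<Union>\<F> \<subseteq> E" "\<F> \<noteq> {}" "linked Union \<F>" "phi (\<Union>\<F>) < 0"
      by (auto simp: dense_family_def)
    have nn: "0 \<le> (\<Sum>\<sigma>\<in>Z m s. ind E \<sigma>)" for m s using ind0 by (intro sum_nonneg)
    have one: "1 \<le> (\<Sum>\<sigma>\<in>Z m s. ind E \<sigma>)" if "(vs, F, a, t) \<in> Z m s" "F \<subseteq> E" for vs F a t m s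
    proof -
      have "ind E (vs, F, a, t) \<le> (\<Sum>\<sigma>\<in>Z m s. ind E \<sigma>)" using that finZ ind0 by (intro member_le_sum) auto
      then show ?thesis using that by (simp add: ind_def)
    qed
    from exploration_finds_dense_state[OF \<F>(1,3,4,5), of s0] show ?thesis
    proof
      assume "\<exists>s'\<le>s0. \<exists>(vs, F, a, t)\<in>states n s'. F \<subseteq> \<Union>\<F> \<and> t \<le> k + 1 \<and> phi F < 0"
      then obtain s' vs F a t where s': "s' \<le> s0" and st: "(vs, F, a, t) \<in> states n s'"
        and F: "F \<subseteq> \<Union>\<F>" "t \<le> k + 1" "phi F < 0" by auto
      have "(vs, F, a, t) \<in> Z (- 1) s'" using st F by (auto simp: Z_def)
      then have "1 \<le> (\<Sum>\<sigma>\<in>Z (- 1) s'. ind E \<sigma>)" using order_trans[OF F(1) \<F>(2)] by (rule one)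
      also have "\<dots> \<le> (\<Sum>s\<le>s0. \<Sum>\<sigma>\<in>Z (- 1) s. ind E \<sigma>)" using s' nn by (intro member_le_sum) auto
      finally show ?thesis using nn[of "int k" s0] True by simp
    next
      assume "\<exists>(vs, F, a, t)\<in>states n s0. F = \<Union>{A \<in> \<F>. A \<subseteq> F} \<and> 0 \<le> phi F \<and> phi F \<le> int k - int t \<and>
        (\<forall>A\<in>\<F>. A \<subseteq> F \<or> \<Union>A \<inter> set (take a vs) = {})"
      then obtain vs F a t where st: "(vs, F, a, t) \<in> states n s0"
        and F: "F = \<Union>{A \<in> \<F>. A \<subseteq> F}" "0 \<le> phi F" "phi F \<le> int k - int t" by auto
      have "F \<subseteq> \<Union>\<F>"
      proof -
        have "\<Union>{A \<in> \<F>. A \<subseteq> F} \<subseteq> \<Union>\<F>" by auto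
        then show ?thesis using F(1) by simp
      qed
      then have "F \<subseteq> E" using \<F>(2) by (rule order_trans)
      have "(vs, F, a, t) \<in> Z (int k) s0" using st F(2,3) by (auto simp: Z_def)
      then have "1 \<le> (\<Sum>\<sigma>\<in>Z (int k) s0. ind E \<sigma>)" using \<open>F \<subseteq> E\<close> by (rule one)
      moreover have "0 \<le> (\<Sum>s\<le>s0. \<Sum>\<sigma>\<in>Z (- 1) s. ind E \<sigma>)" by (intro sum_nonneg ind0)
      ultimately show ?thesis using True by simp
    qed
  qed
  have "bern ?X p (\<lambda>E. of_bool (dense_family n E)) \<le> bern ?X p (\<lambda>E. (\<Sum>s\<le>s0. \<Sum>\<sigma>\<in>Z (- 1) s. ind E \<sigma>) + (\<Sum>\<sigma>\<in>Z (int k) s0. ind E \<sigma>))"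
    using p dom by (intro bern_mono)
  also have "\<dots> = (\<Sum>s\<le>s0. \<Sum>\<sigma>\<in>Z (- 1) s. p ^ card (fst (snd \<sigma>))) + (\<Sum>\<sigma>\<in>Z (int k) s0. p ^ card (fst (snd \<sigma>)))"
    unfolding bern_add bern_sum[where I = "{..s0}"] bernZ by simp
  also have "\<dots> \<le> (\<Sum>s\<le>s0. real n powr (real_of_int (- 1) / real k) * (R * (1 / 4) ^ s)) + real n powr (real_of_int (int k) / real k) * (R * (1 / 4) ^ s0)"
    by (intro add_mono sum_mono Zsum) (simp_all only: atMost_iff order_refl)
  also have "(\<Sum>s\<le>s0. real n powr (real_of_int (- 1) / real k) * (R * (1 / 4) ^ s)) = real n powr (- 1 / real k) * R * (\<Sum>s\<le>s0. (1 / 4) ^ s)"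
    by (simp add: sum_distrib_left mult.assoc)
  also have "\<dots> \<le> real n powr (- 1 / real k) * R * 2"
  proof (intro mult_left_mono)
    have "(\<Sum>s\<le>s0. (1 / 4 :: real) ^ s) = (1 - (1 / 4) ^ Suc s0) / (1 - 1 / 4)" by (subst sum_gp0) auto
    also have "\<dots> \<le> 2"
    proof -
      have "(1 - z) / (1 - 1 / 4) \<le> 2" if "0 \<le> z" for z :: real using that by simp
      moreover have "0 \<le> (1 / 4 :: real) ^ Suc s0" by (rule zero_le_power) simp
      ultimately show ?thesis by blast
    qed
    finally show "(\<Sum>s\<le>s0. (1 / 4 :: real) ^ s) \<le> 2" .
  qed (use R0 in auto)
  also have "real n powr (real_of_int (int k) / real k) * (R * (1 / 4) ^ s0) \<le> real n powr (- 1 / real k) * R * 1"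
  proof -
    have "(1 / 4 :: real) ^ s0 = 1 / (2 ^ s0 * 2 ^ s0)"
      by (simp add: power_divide flip: power_mult_distrib)
    also have "\<dots> \<le> 1 / (real n * real n)" using n_le n0 by (intro divide_left_mono mult_mono) auto
    finally have "real n * (1 / 4) ^ s0 \<le> real n * (1 / (real n * real n))" using n0 by (intro mult_left_mono) auto
    also have "\<dots> = real n powr (- 1)" using n0 by (simp add: powr_minus inverse_eq_divide)
    also have "\<dots> \<le> real n powr (- 1 / real k)" using n k2 by (intro powr_mono) auto
    finally have "R * (real n * (1 / 4) ^ s0) \<le> R * real n powr (- 1 / real k)" using R0 by (intro mult_left_mono) auto
    then show ?thesis using k2 n0 by (simp add: mult.commute mult.left_commute)
  qed
  finally have "bern ?X p (\<lambda>E. of_bool (dense_family n E)) \<le> 3 * R * real n powr (- 1 / real k)" by simp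
  also have "R \<le> 2 ^ k * (real k * (log 2 (real n) + 2) + 1) ^ (k * (k + 1))"
  proof -
    have "1 / y = (real (k * (s0 + 1)) + 1) ^ k" by (simp add: y_def)
    then have "R = 2 ^ k * (real (k * (s0 + 1)) + 1) ^ (k * (k + 1))"
      unfolding R_def by (simp only: power_mult[symmetric] mult.commute)
    also have "\<dots> \<le> 2 ^ k * (real k * (log 2 (real n) + 2) + 1) ^ (k * (k + 1))"
    proof (intro mult_left_mono power_mono)
      have "real k * (real s0 + 1) \<le> real k * (log 2 (real n) + 2)" using s0_up by (intro mult_left_mono) auto
      then show "real (k * (s0 + 1)) + 1 \<le> real k * (log 2 (real n) + 2) + 1" by (simp add: algebra_simps)
    qed auto
    finally show ?thesis .
  qed
  finally show ?thesis by (simp add: mult.assoc mult_right_mono)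
qed

text \<open>The decaying power of \<open>n\<close> is shared equally among the \<open>M\<close>
  logarithmic factors, so it is enough that a single one tends to 0.\<close>

lemma log_power_limit:
  assumes "0 < k" "0 < M"
  shows "(\<lambda>n. 3 * 2 ^ k * (real k * (log 2 (real n) + 2) + 1) ^ M * real n powr (- 1 / real k)) \<longlonglongrightarrow> 0"
proof -
  define \<epsilon> where "\<epsilon> = 1 / (real k * real M)"
  have \<epsilon>: "0 < \<epsilon>" using assms by (simp add: \<epsilon>_def)
  have eq: "((real k * (log 2 (real n) + 2) + 1) * real n powr (- \<epsilon>)) ^ M = (real k * (log 2 (real n) + 2) + 1) ^ M * real n powr (- 1 / real k)"
    if "0 < n" for n
    using that assms by (simp add: power_mult_distrib powr_powr \<epsilon>_def flip: powr_realpow)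
  have "(\<lambda>n. (real k * (log 2 (real n) + 2) + 1) * real n powr (- \<epsilon>)) \<longlonglongrightarrow> 0"
    using \<epsilon> by real_asymp
  then have "(\<lambda>n. 3 * 2 ^ k * ((real k * (log 2 (real n) + 2) + 1) * real n powr (- \<epsilon>)) ^ M) \<longlonglongrightarrow> 3 * 2 ^ k * 0 ^ M"
    by (intro tendsto_intros)
  moreover have "eventually (\<lambda>n. 3 * 2 ^ k * ((real k * (log 2 (real n) + 2) + 1) * real n powr (- \<epsilon>)) ^ M = 3 * 2 ^ k * (real k * (log 2 (real n) + 2) + 1) ^ M * real n powr (- 1 / real k)) sequentially"
    using eventually_gt_at_top[of 0] by eventually_elim (simp add: eq mult.assoc)
  ultimately have "(\<lambda>n. 3 * 2 ^ k * (real k * (log 2 (real n) + 2) + 1) ^ M * real n powr (- 1 / real k)) \<longlonglongrightarrow> 3 * 2 ^ k * 0 ^ M"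
    by (rule Lim_transform_eventually)
  then show ?thesis using assms(2) by (simp add: zero_power)
qed

theorem client_win_zero_statement:
  fixes VH :: "'h set"
  assumes H: "V' \<subseteq> VH" "E' \<subseteq> EH" and h: "bij_betw h {0..<k} V'" "E' = (\<lambda>e. h ` e) ` D0"
    and cover: "\<And>n E. \<not> dense_family n E \<Longrightarrow> coverable (b + 1) (Union ` {A \<in> copies n. A \<subseteq> E})"
  shows "\<exists>c>0. \<forall>p :: nat \<Rightarrow> real. (\<forall>n. 0 \<le> p n \<and> p n \<le> 1) \<longrightarrow>
    eventually (\<lambda>n. p n \<le> c * real n powr (- (real q / real k))) sequentially \<longrightarrow>
    (\<lambda>n. gnp_prob n (p n) (client_win VH EH b n)) \<longlonglongrightarrow> 0"
proof -
  define c where "c = 1 / ((real k + 1) * 2 ^ (k + 3))"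
  have "0 < c" by (simp add: c_def)
  have win: "dense_family n E" if "client_win VH EH b n E" for n E
  proof (rule ccontr)
    assume "\<not> dense_family n E"
    then have cov: "coverable (b + 1) (Union ` {A \<in> copies n. A \<subseteq> E})" by (rule cover)
    have "\<exists>K\<in>Union ` {A \<in> copies n. A \<subseteq> E}. K \<subseteq> S" if S: "S \<subseteq> {0..<n}" "has_copy_in VH EH E S" for S
    proof -
      obtain f where f: "inj_on f VH" "f ` VH \<subseteq> S" "\<forall>e\<in>EH. f ` e \<in> E" using S(2) by (auto simp: has_copy_in_def)
      \<comment> \<open>Every copy of \<open>H\<close> contains the image of its shape, so spoiling
        the shape suffices. The restriction makes the map extensional, as membership in
        \<open>PiE\<close> demands.\<close>
      define g where "g = restrict (f \<circ> h) {0..<k}"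
      have hV: "h ` {0..<k} = V'" using h(1) by (simp add: bij_betw_def)
      have gV: "g ` {0..<k} = f ` V'" by (simp add: g_def image_comp flip: hV)
      have "inj_on (f \<circ> h) {0..<k}"
        using f(1) h(1) H(1) hV by (intro comp_inj_on) (auto simp: bij_betw_def intro: inj_on_subset)
      then have "inj_on g {0..<k}" by (simp add: g_def inj_on_restrict_eq)
      moreover have "f ` V' \<subseteq> S" using f(2) H(1) by auto
      then have gS: "g ` {0..<k} \<subseteq> S" using gV by simp
      then have "g ` {0..<k} \<subseteq> {0..<n}" using S(1) by (rule order_trans)
      then have "g i \<in> {0..<n}" if "i \<in> {0..<k}" for i using that by blast
      then have "g \<in> PiE {0..<k} (\<lambda>_. {0..<n})" by (auto simp: g_def)
      ultimately have "g \<in> embeddings n" by (simp add: embeddings_def)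
      moreover have "copy g \<subseteq> E"
      proof
        fix e assume "e \<in> copy g"
        then obtain d where d: "d \<in> D0" "e = g ` d" by (auto simp: copy_def)
        have "d \<subseteq> {0..<k}" using shape_edge[OF d(1)] by simp
        then have "g ` d = (\<lambda>x. f (h x)) ` d" unfolding g_def by (intro image_cong) auto
        then have "g ` d = f ` (h ` d)" by (simp add: image_image)
        then show "e \<in> E" using d f(3) H(2) h(2) by auto
      qed
      ultimately have "copy g \<in> {A \<in> copies n. A \<subseteq> E}" by (simp add: copies_def)
      moreover have "\<Union>(copy g) \<subseteq> S" unfolding Union_copy by (rule gS)
      ultimately show ?thesis by (intro bexI[OF _ imageI])
    qed
    then have "\<not> client_win VH EH b n E" by (rule coverable_imp_not_client_win[OF cov])
    then show False using that by simp
  qed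
  show ?thesis
  proof (intro exI[of _ c] conjI \<open>0 < c\<close> allI impI)
    fix p :: "nat \<Rightarrow> real"
    assume p: "\<forall>n. 0 \<le> p n \<and> p n \<le> 1" and ev: "eventually (\<lambda>n. p n \<le> c * real n powr (- (real q / real k))) sequentially"
    have lo: "eventually (\<lambda>n. 0 \<le> gnp_prob n (p n) (client_win VH EH b n)) sequentially"
      unfolding gnp_prob_bern using p by (intro always_eventually allI bern_nonneg) auto
    have up: "eventually (\<lambda>n. gnp_prob n (p n) (client_win VH EH b n) \<le>
      3 * 2 ^ k * (real k * (log 2 (real n) + 2) + 1) ^ (k * (k + 1)) * real n powr (- 1 / real k)) sequentially"
      using ev eventually_ge_at_top[of 2]
    proof eventually_elim
      case (elim n)
      have "gnp_prob n (p n) (client_win VH EH b n) \<le> bern (all_edges n) (p n) (\<lambda>E. of_bool (dense_family n E))"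
        unfolding gnp_prob_bern using p win by (intro bern_mono) auto
      also have "\<dots> \<le> 3 * 2 ^ k * (real k * (log 2 (real n) + 2) + 1) ^ (k * (k + 1)) * real n powr (- 1 / real k)"
        using elim p by (intro dense_family_probability[OF _ c_def]) auto
      finally show ?case .
    qed
    have "0 < k" using k2 by simp
    then have lim: "(\<lambda>n. 3 * 2 ^ k * (real k * (log 2 (real n) + 2) + 1) ^ (k * (k + 1)) * real n powr (- 1 / real k)) \<longlonglongrightarrow> 0"
      by (intro log_power_limit) auto
    show "(\<lambda>n. gnp_prob n (p n) (client_win VH EH b n)) \<longlonglongrightarrow> 0"
      by (rule tendsto_sandwich[OF lo up tendsto_const lim])
  qed
qed

end

section \<open>The threshold\<close>

lemma Union_pairs_of: "2 \<le> card K \<Longrightarrow> \<Union>(pairs_of K) = K"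
proof -
  assume "2 \<le> card K"
  have "x \<in> \<Union>(pairs_of K)" if x: "x \<in> K" for x
  proof -
    have "K \<noteq> {x}" using \<open>2 \<le> card K\<close> by auto
    then obtain y where "y \<in> K" "y \<noteq> x" using x by blast
    then have "{x, y} \<in> pairs_of K" using x by (intro pair_in_pairs_of) auto
    then show ?thesis by blast
  qed
  then show ?thesis by (auto simp: pairs_of_def)
qed

text \<open>Strict balance holds because a clique on \<open>j\<close> vertices has
  \<open>e / (v - 1) = j / 2\<close>, which increases with \<open>j\<close>.\<close>

lemma copy_shape_clique:
  assumes "3 \<le> k"
  shows "copy_shape k 2 (pairs_of {0..<k})"
proof
  show "2 \<le> k" "1 \<le> (2 :: nat)" using assms by auto
  show "e \<subseteq> {0..<k} \<and> card e = 2" if "e \<in> pairs_of {0..<k}" for e using that by (auto simp: pairs_of_def)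
  show "\<Union>(pairs_of {0..<k}) = {0..<k}" using assms by (intro Union_pairs_of) auto
  have "2 * int (card (pairs_of {0..<k})) = int k * (int k - 1)" using card_pairs_of[of "{0..<k}"] by simp
  also have "\<dots> = int (k * (k - 1))" using assms by (simp add: of_nat_diff)
  finally show "2 * card (pairs_of {0..<k}) = k * (k - 1)" by linarith
  fix J assume J: "J \<subset> {0..<k}" "2 \<le> card J"
  have finJ: "finite J" using J finite_subset by blast
  have jk: "card J < k" using psubset_card_mono[OF _ J(1)] by simp
  have "{e \<in> pairs_of {0..<k}. e \<subseteq> J} = pairs_of J" using J(1) by (auto simp: pairs_of_def)
  then have "2 * int (card {e \<in> pairs_of {0..<k}. e \<subseteq> J}) = int (card J) * (int (card J) - 1)"
    using card_pairs_of[OF finJ] by simp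
  also have "\<dots> = int (card J * (card J - 1))" using J(2) by (simp add: of_nat_diff)
  finally have "2 * card {e \<in> pairs_of {0..<k}. e \<subseteq> J} = card J * (card J - 1)" by linarith
  also have "\<dots> < k * (card J - 1)" using jk J(2) by (intro mult_strict_right_mono) auto
  finally show "2 * card {e \<in> pairs_of {0..<k}. e \<subseteq> J} < k * (card J - 1)" .
qed

definition cycle_shape :: "nat \<Rightarrow> nat set set" where
  "cycle_shape k = (\<lambda>i. {i, (i + 1) mod k}) ` {0..<k}"

lemma Union_cycle_shape: "0 < k \<Longrightarrow> \<Union>(cycle_shape k) = {0..<k}"
  by (auto simp: cycle_shape_def)

lemma image_cycle_shape: "(\<lambda>e. g ` e) ` cycle_shape k = {{g i, g ((i + 1) mod k)} | i. i < k}"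
  unfolding cycle_shape_def by (auto simp: image_image)

lemma cycle_edges_cycle_shape:
  assumes "3 \<le> k"
  shows "cycle_edges k (cycle_shape k)"
proof -
  have "\<Union>(cycle_shape k) = {0..<k}" using assms by (intro Union_cycle_shape) simp
  then have "bij_betw (\<lambda>i. i) {0..<k} (\<Union>(cycle_shape k))" by (simp add: bij_betw_def)
  moreover have "cycle_shape k = {{i, (i + 1) mod k} | i. i < k}"
    using image_cycle_shape[of "\<lambda>i. i" k] by simp
  ultimately show ?thesis unfolding cycle_edges_def is_cycle_graph_def using assms by blast
qed

text \<open>Strict balance holds because a proper part of a cycle spans a forest, with
  \<open>e / (v - 1)\<close> at most 1, below \<open>k / (k - 1)\<close>.\<close>

lemma copy_shape_cycle:
  assumes "3 \<le> k"
  shows "copy_shape k (k - 1) (cycle_shape k)"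
proof
  note cyc = cycle_edges_cycle_shape[OF assms] and un = Union_cycle_shape[of k]
  note facts = cycle_edges_facts[OF cyc]
  show "2 \<le> k" "1 \<le> k - 1" using assms by auto
  show "e \<subseteq> {0..<k} \<and> card e = 2" if "e \<in> cycle_shape k" for e using that facts(6) un assms by auto
  show "\<Union>(cycle_shape k) = {0..<k}" using un assms by simp
  show "(k - 1) * card (cycle_shape k) = k * (k - 1)" using facts(4) by simp
  fix J assume J: "J \<subset> {0..<k}" "2 \<le> card J"
  have "card {e \<in> cycle_shape k. e \<subseteq> J} + 1 \<le> card J"
    using J un assms by (intro cycle_inner_edges[OF cyc]) auto
  then have "(k - 1) * card {e \<in> cycle_shape k. e \<subseteq> J} \<le> (k - 1) * (card J - 1)" by (intro mult_le_mono) auto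
  also have "\<dots> < k * (card J - 1)" using J(2) assms by (intro mult_strict_right_mono) auto
  finally show "(k - 1) * card {e \<in> cycle_shape k. e \<subseteq> J} < k * (card J - 1)" .
qed

text \<open>Carries connectedness from vertex sets over to edge sets, the form in which the
  exploration uses it.\<close>

lemma linked_pairs_of:
  assumes "connected_family \<G>" "\<And>K. K \<in> \<G> \<Longrightarrow> 2 \<le> card K"
  shows "linked Union (pairs_of ` \<G>)"
  unfolding linked_def
proof (intro allI impI)
  fix \<H> assume H: "\<H> \<subset> pairs_of ` \<G> \<and> \<H> \<noteq> {}"
  define \<H>' where "\<H>' = {K \<in> \<G>. pairs_of K \<in> \<H>}"
  have "\<H>' \<subset> \<G>" "\<H>' \<noteq> {}" using H by (auto simp: \<H>'_def)
  then obtain K where K: "K \<in> \<G> - \<H>'" "K \<inter> \<Union>\<H>' \<noteq> {}"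
    using assms(1) unfolding linked_def image_ident by meson
  have "\<H> = pairs_of ` \<H>'" using H by (auto simp: \<H>'_def)
  then have "\<Union>(Union ` \<H>) = (\<Union>K\<in>\<H>'. \<Union>(pairs_of K))" by auto
  also have "\<dots> = (\<Union>K\<in>\<H>'. K)" using assms(2) Union_pairs_of by (intro SUP_cong) (auto simp: \<H>'_def)
  finally have "\<Union>(Union ` \<H>) = \<Union>\<H>'" by simp
  moreover have "\<Union>(pairs_of K) = K" using K assms(2) Union_pairs_of by auto
  ultimately show "\<exists>A\<in>pairs_of ` \<G> - \<H>. \<Union>A \<inter> \<Union>(Union ` \<H>) \<noteq> {}"
    using K by (intro bexI[of _ "pairs_of K"]) (auto simp: \<H>'_def)
qed

lemma cliques_cover:
  assumes k: "3 \<le> k" and b: "4 \<le> k \<and> 2 \<le> \<beta> \<or> 3 \<le> \<beta>"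
    and sparse: "\<not> copy_shape.dense_family k 2 (pairs_of {0..<k}) n E"
  shows "coverable \<beta> (Union ` {A \<in> copy_shape.copies k (pairs_of {0..<k}) n. A \<subseteq> E})"
proof (rule ccontr)
  interpret copy_shape k 2 "pairs_of {0..<k}" by (rule copy_shape_clique[OF k])
  let ?\<A> = "{A \<in> copies n. A \<subseteq> E}"
  assume "\<not> coverable \<beta> (Union ` ?\<A>)"
  then obtain \<G> where G: "\<G> \<subseteq> Union ` ?\<A>" "\<G> \<noteq> {}" "connected_family \<G>" "\<not> coverable \<beta> \<G>"
    using not_coverable_connected[of "Union ` ?\<A>" \<beta>] finite_copies by auto
  \<comment> \<open>A copy of the clique is determined by its vertex set, by comparing the numbers
    of edges.\<close>
  have copy_eq: "pairs_of (\<Union>A) = A" if "A \<in> copies n" for A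
  proof -
    note facts = copy_facts[OF that]
    have "2 * int (card (pairs_of (\<Union>A))) = 2 * int (card A)"
      using card_pairs_of[OF facts(2)] card_copy_int[OF that] facts(3) by simp
    moreover have "A \<subseteq> pairs_of (\<Union>A)" using facts(7) by (auto simp: pairs_of_def)
    ultimately show ?thesis using finite_pairs_of[OF facts(2)] by (intro card_subset_eq[symmetric]) auto
  qed
  have GK: "finite K \<and> card K = k \<and> pairs_of K \<in> ?\<A>" if K: "K \<in> \<G>" for K
  proof -
    obtain A where A: "A \<in> ?\<A>" "K = \<Union>A" using K G(1) by auto
    then show ?thesis using copy_facts(2,3)[of A n] copy_eq[of A] by auto
  qed
  interpret cf: clique_family \<G> k
  proof
    show "finite \<G>" using G(1) by (rule finite_subset) (simp add: finite_copies)
    show "finite K \<and> card K = k" if "K \<in> \<G>" for K using GK[OF that] by simp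
    show "3 \<le> k" by (rule k)
    show "connected_family \<G>" "\<G> \<noteq> {}" using G by auto
    fix \<H> assume H: "\<H> \<subseteq> \<G>" "\<H> \<noteq> {}" "connected_family \<H>"
    have Hk: "2 \<le> card K" if "K \<in> \<H>" for K using GK[of K] H(1) that k by auto
    have "\<Union>(\<Union>(pairs_of ` \<H>)) = (\<Union>K\<in>\<H>. \<Union>(pairs_of K))" by auto
    also have "\<dots> = (\<Union>K\<in>\<H>. K)" using Union_pairs_of[OF Hk] by (intro SUP_cong) auto
    finally have un: "\<Union>(\<Union>(pairs_of ` \<H>)) = \<Union>\<H>" by simp
    have "linked Union (pairs_of ` \<H>)" using H(3) Hk by (rule linked_pairs_of)
    moreover have "pairs_of ` \<H> \<subseteq> copies n" "\<Union>(pairs_of ` \<H>) \<subseteq> E" using GK H(1) by blast+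
    ultimately have "\<not> phi (\<Union>(pairs_of ` \<H>)) < 0" using sparse H(2) unfolding dense_family_def by blast
    then have "int 2 * int (card (\<Union>(pairs_of ` \<H>))) \<le> int k * int (card (\<Union>\<H>))" unfolding phi_def un by simp
    then show "2 * card (\<Union>(pairs_of ` \<H>)) \<le> k * card (\<Union>\<H>)" by (simp flip: of_nat_mult)
  qed
  show False using cf.cliques_coverable[OF b] G(4) by simp
qed

lemma cycles_cover:
  assumes k: "4 \<le> k" and b: "2 \<le> \<beta>"
    and sparse: "\<not> copy_shape.dense_family k (k - 1) (cycle_shape k) n E"
  shows "coverable \<beta> (Union ` {A \<in> copy_shape.copies k (cycle_shape k) n. A \<subseteq> E})"
proof (rule ccontr)
  have k3: "3 \<le> k" using k by simp
  interpret copy_shape k "k - 1" "cycle_shape k" by (rule copy_shape_cycle[OF k3])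
  let ?\<A> = "{A \<in> copies n. A \<subseteq> E}"
  assume nc: "\<not> coverable \<beta> (Union ` ?\<A>)"
  have "\<not> coverable 2 (Union ` ?\<A>)"
  proof
    assume "coverable 2 (Union ` ?\<A>)"
    then have "coverable \<beta> (Union ` ?\<A>)" unfolding coverable_def using b by (meson le_trans)
    then show False using nc by simp
  qed
  then obtain \<G> where G: "\<G> \<subseteq> Union ` ?\<A>" "\<G> \<noteq> {}" "connected_family \<G>" "\<not> coverable 2 \<G>"
    using not_coverable_connected[of "Union ` ?\<A>" 2] finite_copies by auto
  \<comment> \<open>Different cycles may share a vertex set, so all cycles over the vertex sets in
    \<open>\<G>\<close> are taken.\<close>
  define \<F> where "\<F> = {A \<in> ?\<A>. \<Union>A \<in> \<G>}"
  have FG: "Union ` \<F> = \<G>" using G(1) by (auto simp: \<F>_def)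
  have cyc: "cycle_edges k A" if A: "A \<in> copies n" for A
  proof -
    obtain g where g: "g \<in> embeddings n" "A = copy g" using A by (auto simp: copies_def)
    have "bij_betw g {0..<k} (\<Union>A)" using g Union_copy by (auto simp: bij_betw_def embeddings_def)
    moreover have "A = {{g i, g ((i + 1) mod k)} | i. i < k}" unfolding g(2) copy_def by (rule image_cycle_shape)
    ultimately show ?thesis unfolding cycle_edges_def is_cycle_graph_def using k3 by blast
  qed
  have Une: "\<Union>A \<noteq> {}" if "A \<in> \<F>" for A
  proof -
    have "card (\<Union>A) \<noteq> 0" using copy_facts(3)[of A n] that k by (simp add: \<F>_def)
    then show ?thesis by (metis card.empty)
  qed
  have "coverable 2 (Union ` \<F>)"
  proof (rule cycles_coverable[OF _ _ k])
    show "finite \<F>" using finite_copies by (simp add: \<F>_def)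
    show "cycle_edges k A" if "A \<in> \<F>" for A using that cyc by (simp add: \<F>_def)
    show "\<F> \<noteq> {}" using FG G(2) by auto
    show "linked Union \<F>"
      unfolding linked_def
    proof (intro allI impI)
      fix \<H> assume H: "\<H> \<subset> \<F> \<and> \<H> \<noteq> {}"
      show "\<exists>A\<in>\<F> - \<H>. \<Union>A \<inter> \<Union>(Union ` \<H>) \<noteq> {}"
      proof (cases "Union ` \<H> = \<G>")
        case True
        \<comment> \<open>The subfamily already uses every vertex set in \<open>\<G>\<close>, so a
          missing cycle shares its vertex set with a member.\<close>
        obtain A where A: "A \<in> \<F> - \<H>" using H by auto
        then have "\<Union>A \<in> Union ` \<H>" using True FG by auto
        then have "\<Union>A \<subseteq> \<Union>(Union ` \<H>)" by (rule Union_upper)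
        then show ?thesis using A Une[of A] by (intro bexI[OF _ A]) (simp add: Int_absorb2)
      next
        case False
        then have "Union ` \<H> \<subset> \<G>" using H FG by blast
        moreover have "Union ` \<H> \<noteq> {}" using H by simp
        ultimately obtain K where K: "K \<in> \<G> - Union ` \<H>" "K \<inter> \<Union>(Union ` \<H>) \<noteq> {}"
          using G(3) unfolding linked_def image_ident by meson
        then obtain A where "A \<in> \<F>" "K = \<Union>A" using FG by auto
        then show ?thesis using K by (intro bexI[of _ A]) auto
      qed
    qed
    fix \<H> assume H: "\<H> \<subseteq> \<F>" "\<H> \<noteq> {}" "linked Union \<H>"
    have "\<H> \<subseteq> copies n" "\<Union>\<H> \<subseteq> E" using H(1) by (auto simp: \<F>_def)
    then have "\<not> phi (\<Union>\<H>) < 0" using sparse H(2,3) unfolding dense_family_def by blast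
    then have "int (k - 1) * int (card (\<Union>\<H>)) \<le> int k * int (card (\<Union>(\<Union>\<H>)))" unfolding phi_def by simp
    then show "(k - 1) * card (\<Union>\<H>) \<le> k * card (\<Union>(\<Union>\<H>))" by (simp only: of_nat_mult[symmetric] of_nat_le_iff)
  qed
  then show False using FG G(4) by simp
qed

text \<open>Triangles are handled as cliques, which leaves \<open>k \<ge> 4\<close> for the cycle
  argument.\<close>

lemma cycle_3_is_clique:
  fixes V :: "'a set"
  shows "is_cycle_graph 3 V E \<Longrightarrow> is_clique_graph 3 V E"
proof -
  assume "is_cycle_graph 3 V E"
  then obtain g :: "nat \<Rightarrow> 'a" where g: "bij_betw g {0..<3} V" and E: "E = {{g i, g ((i + 1) mod 3)} | i. i < 3}"
    by (auto simp: is_cycle_graph_def)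
  have "E = (\<lambda>e. g ` e) ` cycle_shape 3" unfolding E by (rule image_cycle_shape[symmetric])
  then have "\<Union>E = g ` \<Union>(cycle_shape 3)" by auto
  then have un: "\<Union>E = V" using g by (simp add: Union_cycle_shape bij_betw_def)
  have cyc: "cycle_edges 3 E" unfolding cycle_edges_def un using \<open>is_cycle_graph 3 V E\<close> .
  note facts = cycle_edges_facts[OF cyc, unfolded un]
  have "card {e. e \<subseteq> V \<and> card e = 2} = 3" using facts(2,3) by (simp add: n_subsets choose_two)
  moreover have "E \<subseteq> {e. e \<subseteq> V \<and> card e = 2}" using facts(6) un by auto
  ultimately have "E = {e. e \<subseteq> V \<and> card e = 2}" using facts(2,4) by (intro card_subset_eq) auto
  then show ?thesis using facts(2,3) by (simp add: is_clique_graph_def)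
qed

theorem theorem9:
  fixes k b :: nat and VH :: "'h set" and EH :: "'h set set"
  assumes "b \<ge> 1"
    and "k \<ge> 4 \<or> (k = 3 \<and> b \<ge> 2)"
    and "is_graph VH EH"
    and "\<exists>V' E'. V' \<subseteq> VH \<and> E' \<subseteq> EH \<and> d1 V' E' = m1 VH EH \<and>
           (is_clique_graph k V' E' \<or> is_cycle_graph k V' E')"
  shows "\<exists>c C :: real. c > 0 \<and> C > 0 \<and>
    (\<forall>p :: nat \<Rightarrow> real. (\<forall>n. 0 \<le> p n \<and> p n \<le> 1) \<longrightarrow>
       (eventually (\<lambda>n. p n \<ge> C * real n powr (- 1 / m1 VH EH)) sequentially \<longrightarrow>
          (\<lambda>n. gnp_prob n (p n) (client_win VH EH b n)) \<longlonglongrightarrow> 1) \<and>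
       (eventually (\<lambda>n. p n \<le> c * real n powr (- 1 / m1 VH EH)) sequentially \<longrightarrow>
          (\<lambda>n. gnp_prob n (p n) (client_win VH EH b n)) \<longlonglongrightarrow> 0))"
proof -
  have k3: "3 \<le> k" using assms(2) by auto
  from assms(4) obtain V' E' where H': "V' \<subseteq> VH" "E' \<subseteq> EH" and d: "d1 V' E' = m1 VH EH"
    and shape: "is_clique_graph k V' E' \<or> is_cycle_graph k V' E'" by blast
  \<comment> \<open>Both cases are merged into one shape with its parameter \<open>q\<close> and its
    covering property, so that the rest is uniform.\<close>
  have "\<exists>q D0 h. copy_shape k q D0 \<and> bij_betw h {0..<k} V' \<and> E' = (\<lambda>e. h ` e) ` D0 \<and>
    (\<forall>n E. \<not> copy_shape.dense_family k q D0 n E \<longrightarrow>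
       coverable (b + 1) (Union ` {A \<in> copy_shape.copies k D0 n. A \<subseteq> E}))"
  proof (cases "is_clique_graph k V' E'")
    case True
    then have V': "finite V'" "card V' = k" "E' = pairs_of V'" by (auto simp: is_clique_graph_def pairs_of_def)
    obtain h where h: "bij_betw h {0..<k} V'" using ex_bij_betw_nat_finite[OF V'(1)] V'(2) by auto
    have "E' = (\<lambda>e. h ` e) ` pairs_of {0..<k}"
    proof
      show "(\<lambda>e. h ` e) ` pairs_of {0..<k} \<subseteq> E'"
        using h unfolding V'(3) pairs_of_def bij_betw_def by (auto simp: card_image inj_on_subset)
      show "E' \<subseteq> (\<lambda>e. h ` e) ` pairs_of {0..<k}"
      proof
        fix e assume "e \<in> E'"
        then have e: "e \<subseteq> h ` {0..<k}" "card e = 2" using h by (auto simp: V'(3) pairs_of_def bij_betw_def)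
        then obtain d where d: "d \<subseteq> {0..<k}" "e = h ` d" by (meson subset_imageE)
        then have "card d = 2" using e(2) h by (metis bij_betw_def card_image inj_on_subset)
        then show "e \<in> (\<lambda>e. h ` e) ` pairs_of {0..<k}" using d by (auto simp: pairs_of_def)
      qed
    qed
    moreover have "4 \<le> k \<and> 2 \<le> b + 1 \<or> 3 \<le> b + 1" using assms(1,2) by auto
    ultimately show ?thesis using h copy_shape_clique[OF k3] cliques_cover[OF k3] by blast
  next
    case False
    then have cyc: "is_cycle_graph k V' E'" using shape by blast
    then have k4: "4 \<le> k" using False cycle_3_is_clique k3 by (cases "k = 3") auto
    obtain h where h: "bij_betw h {0..<k} V'" and E': "E' = {{h i, h ((i + 1) mod k)} | i. i < k}"
      using cyc by (auto simp: is_cycle_graph_def)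
    have "E' = (\<lambda>e. h ` e) ` cycle_shape k" unfolding E' by (rule image_cycle_shape[symmetric])
    moreover have "2 \<le> b + 1" using assms(1) by simp
    ultimately show ?thesis using h copy_shape_cycle[OF k3] cycles_cover[OF k4] by blast
  qed
  then obtain q D0 h where cs: "copy_shape k q D0" and h: "bij_betw h {0..<k} V'" "E' = (\<lambda>e. h ` e) ` D0"
    and cover: "\<And>n E. \<not> copy_shape.dense_family k q D0 n E \<Longrightarrow>
       coverable (b + 1) (Union ` {A \<in> copy_shape.copies k D0 n. A \<subseteq> E})" by blast
  interpret copy_shape k q D0 by (rule cs)
  have cV: "card V' = k" using bij_betw_same_card[OF h(1)] by simp
  have "inj_on (\<lambda>e. h ` e) D0"
  proof (rule inj_onI)
    fix x y assume "x \<in> D0" "y \<in> D0" "h ` x = h ` y"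
    moreover have "inj_on h {0..<k}" using h(1) by (simp add: bij_betw_def)
    ultimately show "x = y" using shape_edge by (metis inj_on_image_eq_iff)
  qed
  then have cE: "card E' = card D0" using h(2) by (simp add: card_image)
  \<comment> \<open>\<open>shape_card\<close> says that the shape has density \<open>k / q\<close>,
    and the given subgraph attains the maximum.\<close>
  have m1_eq: "m1 VH EH = real k / real q"
  proof -
    have "real (q * card D0) = real (k * (k - 1))" using shape_card by simp
    then have "real q * real (card D0) = real k * (real k - 1)" using k3 by (simp add: of_nat_diff)
    then have "real (card D0) / (real k - 1) = real k / real q" using q1 k3 by (simp add: field_simps)
    then show ?thesis using d by (simp add: d1_def cV cE)
  qed
  have m1_pos: "0 < m1 VH EH" using m1_eq q1 k3 by simp
  have "D0 \<noteq> {}" using shape_vertices k3 by auto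
  then have "EH \<noteq> {}" using H'(2) h(2) by auto
  from client_win_one_statement[OF assms(3) this m1_pos, of b]
  obtain C where C: "0 < C" "\<forall>p :: nat \<Rightarrow> real. (\<forall>n. 0 \<le> p n \<and> p n \<le> 1) \<longrightarrow>
    eventually (\<lambda>n. p n \<ge> C * real n powr (- 1 / m1 VH EH)) sequentially \<longrightarrow>
    (\<lambda>n. gnp_prob n (p n) (client_win VH EH b n)) \<longlonglongrightarrow> 1" by blast
  from client_win_zero_statement[OF H' h cover]
  obtain c where c: "0 < c" "\<forall>p :: nat \<Rightarrow> real. (\<forall>n. 0 \<le> p n \<and> p n \<le> 1) \<longrightarrow>
    eventually (\<lambda>n. p n \<le> c * real n powr (- (real q / real k))) sequentially \<longrightarrow>
    (\<lambda>n. gnp_prob n (p n) (client_win VH EH b n)) \<longlonglongrightarrow> 0" by blast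
  have "- 1 / m1 VH EH = - (real q / real k)" unfolding m1_eq by simp
  then show ?thesis using C c by (intro exI[of _ c] exI[of _ C]) simp
qed

end
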